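(* Let $q$ be a power of the prime $3$ and let $\Delta$ be the coset graph, with group $G=\langle G_1,G_2\rangle\le \mathrm{Sym}(\Omega)$ acting by right multiplication, defined in the context. Then $\Delta$ is a locally finite and locally $5$-arc transitive $G$-graph of pushing up type such that, for an edge $\{x_1,x_2\}$ of $\Delta$ (with its two ends suitably labelled), the following hold: (i) $|\Delta(x_1)|=q+1$ and $|\Delta(x_2)|=q$; (ii) $G_{x_1}^{\Delta(x_1)}\cong \mathrm{P\Gamma L}_2(q)$ and $G_{x_2}^{\Delta(x_2)}\cong \mathrm{A\Gamma L}_1(q)$; (iii) $G_{x_1}\cong E_{q^3}\rtimes \mathrm{\Gamma L}_2(q)$; (iv) $G_{x_2}\cong (E_q\times U)\rtimes \mathrm{\Gamma L}_2(q,S_0)$, where $U$ is isomorphic to a Sylow $3$-subgroup of $\mathrm{ASL}_2(q)$; (v) $G_{x_2}$ is transitive on the $6$-arcs originating at $x_2$.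
   Context: Graph terminology. Graphs are finite, connected, undirected, without loops or multiple edges. A $G$-graph is a graph $\Delta$ together with a subgroup $G\le \mathrm{Aut}(\Delta)$. $\Delta(z)$ is the set of neighbours of $z$; $G_z$ is the stabilizer of $z$; $G_z^{[1]}$ is the kernel of the action of $G_z$ on $\Delta(z)$; $G_z^{\Delta(z)}\cong G_z/G_z^{[1]}$ is the induced permutation group. An $s$-arc originating at $x_0$ is a path $(x_0,\dots,x_s)$ with $x_{i-1}\ne x_{i+1}$ for $1\le i\le s-1$. The $G$-graph is locally finite if every $G_z$ is finite; it is locally $s$-arc transitive if for each vertex $z$ the group $G_z$ is transitive on the $s$-arcs originating at $z$. It is of local characteristic $p$ ($p$ prime) if $C_{G_z}(O_p(G_z^{[1]}))\le O_p(G_z^{[1]})$ for all vertices $z$. It is of pushing up type with respect to the $1$-arc $(x_1,x_2)$ and the prime $p$ if it is of local characteristic $p$ and $O_p(G_{x_1}^{[1]})\le O_p(G_{x_2}^{[1]})$; it is of pushing up type if this holds for some $1$-arc and some prime (here $p=3$). Group notation. $E_q$, $E_{q^3}$ denote elementary abelian groups of order $q$, $q^3$. $\mathrm{ASL}_2(q)$ is the semidirect product of $\mathrm{SL}_2(q)$ with its natural module. $\mathrm{\Gamma L}_2(q,S_0):=N_{\mathrm{\Gamma L}_2(q)}(S_0)$ where $S_0$ is a Sylow $3$-subgroup of $\mathrm{SL}_2(q)$. Construction of $\Delta$. Let $q=3^r$ with $r\ge1$, $\varepsilon=q/3$, $\Omega=\{(a,b,c)\mid a,b,c\in\mathbb F_q\}$.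 Permutations are applied from left to right. Define the permutations of $\Omega$: $\alpha_{(u,v,w)}:(a,b,c)\mapsto(a+u,b+v,c+w)$ for $u,v,w\in\mathbb F_q$; $\beta_{\lambda,\mu}:(a,b,c)\mapsto(\lambda a,\mu b,(\lambda\mu)^{2\varepsilon}c)$ for $\lambda,\mu\in\mathbb F_q^*$; $\gamma_e:(a,b,c)\mapsto(a+eb,b,c)$ for $e\in\mathbb F_q$; $\delta:(a,b,c)\mapsto(b,-a,c)$; $\tau_d:(a,b,c)\mapsto(a+db^2+d^{\varepsilon}c,b,c)$ for $d\in\mathbb F_q$; $\sigma:(a,b,c)\mapsto(a^3,b^3,c^3)$. Put $A=\langle\alpha_{(u,v,w)}\mid u,v,w\in\mathbb F_q\rangle$, $C=\langle\gamma_e\mid e\in\mathbb F_q\rangle$, $S=\langle\beta_{\mu^2,\mu}\mid\mu\in\mathbb F_q^*\rangle$, $T=\langle\beta_{\mu,\mu^{-1}}\mid\mu\in\mathbb F_q^*\rangle$, $D=\langle\delta\rangle$, $E=\langle\tau_d\mid d\in\mathbb F_q\rangle$, $\Sigma=\langle\sigma\rangle$, $M=\langle C,D,T\rangle$, $Q=\langle A,C\rangle$. Let $G_1=AMS\Sigma$, $G_2=QSET\Sigma$, $G=\langle G_1,G_2\rangle$. $\Delta$ is the graph whose vertices are the right cosets of $G_1$ and of $G_2$ in $G$, where $G_1g_1$ and $G_2g_2$ are adjacent if and only if $G_1g_1\cap G_2g_2\ne\emptyset$; $G$ acts by right multiplication. *)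

theory Defs
  imports
    "HOL-Analysis.Determinants"
    "HOL-Algebra.Group_Action"
    "HOL-Algebra.Generated_Groups"
    "HOL-Combinatorics.Permutations"
    "HOL-Computational_Algebra.Primes"
begin

section \<open>Groups\<close>

text \<open>Permutations are applied from left to right, hence the order of the factors.\<close>

definition symm_group :: "'b set \<Rightarrow> ('b \<Rightarrow> 'b) monoid"
  where "symm_group X = \<lparr>carrier = {f. f permutes X}, mult = (\<lambda>f g. g \<circ> f), one = id\<rparr>"

definition centralizer :: "('g, 'm) monoid_scheme \<Rightarrow> 'g set \<Rightarrow> 'g set"
  where "centralizer G X = {g \<in> carrier G. \<forall>x\<in>X. g \<otimes>\<^bsub>G\<^esub> x = x \<otimes>\<^bsub>G\<^esub> g}"

text \<open>\<open>O\<^sub>p(G)\<close>, as the join of all normal \<open>p\<close>-subgroups (a set of prime power cardinality is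
  finite, because \<open>card\<close> is \<open>0\<close> on infinite sets).\<close>

definition p_core :: "nat \<Rightarrow> ('g, 'm) monoid_scheme \<Rightarrow> 'g set"
  where "p_core p G = generate G (\<Union>{N. N \<lhd> G \<and> (\<exists>k. card N = p ^ k)})"

definition sylow_subgroup :: "nat \<Rightarrow> ('g, 'm) monoid_scheme \<Rightarrow> 'g set \<Rightarrow> bool"
  where "sylow_subgroup p G P \<longleftrightarrow>
    finite (carrier G) \<and> subgroup P G \<and> card P = p ^ multiplicity p (card (carrier G))"

definition elementary_abelian :: "nat \<Rightarrow> ('g, 'm) monoid_scheme \<Rightarrow> bool"
  where "elementary_abelian p G \<longleftrightarrow>
    comm_group G \<and> finite (carrier G) \<and> (\<forall>x\<in>carrier G. x [^]\<^bsub>G\<^esub> p = \<one>\<^bsub>G\<^esub>)"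

definition semidirect ::
  "('n, 'm1) monoid_scheme \<Rightarrow> ('k, 'm2) monoid_scheme \<Rightarrow> ('k \<Rightarrow> 'n \<Rightarrow> 'n) \<Rightarrow> ('n \<times> 'k) monoid"
  where "semidirect N K \<theta> =
    \<lparr>carrier = carrier N \<times> carrier K,
     mult = (\<lambda>(n, k) (n', k'). (n \<otimes>\<^bsub>N\<^esub> \<theta> k n', k \<otimes>\<^bsub>K\<^esub> k')),
     one = (\<one>\<^bsub>N\<^esub>, \<one>\<^bsub>K\<^esub>)\<rparr>"

text \<open>\<open>G \<cong> N \<rtimes> K\<close> for some action of \<open>K\<close> on \<open>N\<close> by automorphisms.\<close>

definition is_semidirect_product ::
  "('g, 'm) monoid_scheme \<Rightarrow> ('n, 'm1) monoid_scheme \<Rightarrow> ('k, 'm2) monoid_scheme \<Rightarrow> bool"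
  where "is_semidirect_product G N K \<longleftrightarrow>
    (\<exists>\<theta> \<in> hom K (AutoGroup N). G \<cong> semidirect N K \<theta>)"


section \<open>Linear and semilinear groups over a finite field\<close>

definition field_aut :: "('a::field \<Rightarrow> 'a) \<Rightarrow> bool"
  where "field_aut s \<longleftrightarrow>
    bij s \<and> (\<forall>x y. s (x + y) = s x + s y) \<and> (\<forall>x y. s (x * y) = s x * s y)"

definition GammaL2 :: "'a::{finite,field} itself \<Rightarrow> ('a^2 \<Rightarrow> 'a^2) monoid"
  where "GammaL2 _ =
    \<lparr>carrier = {f. bij f \<and> (\<forall>v w. f (v + w) = f v + f w) \<and>
                   (\<exists>s. field_aut s \<and> (\<forall>c v. f (c *s v) = s c *s f v))},
     mult = (\<circ>), one = id\<rparr>"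

definition SL2 :: "'a::{finite,field} itself \<Rightarrow> ('a^2 \<Rightarrow> 'a^2) monoid"
  where "SL2 _ = \<lparr>carrier = {(*v) A | A :: 'a^2^2. det A = 1}, mult = (\<circ>), one = id\<rparr>"

definition scalars2 :: "'a::{finite,field} itself \<Rightarrow> ('a^2 \<Rightarrow> 'a^2) set"
  where "scalars2 _ = {(*s) c | c. c \<noteq> 0}"

definition PGammaL2 :: "'a::{finite,field} itself \<Rightarrow> ('a^2 \<Rightarrow> 'a^2) set monoid"
  where "PGammaL2 F = GammaL2 F Mod scalars2 F"

definition AGammaL1 :: "'a::{finite,field} itself \<Rightarrow> ('a \<Rightarrow> 'a) monoid"
  where "AGammaL1 _ =
    \<lparr>carrier = {\<lambda>x. a * s x + b | a s b. a \<noteq> 0 \<and> field_aut s}, mult = (\<circ>), one = id\<rparr>"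

definition ASL2 :: "'a::{finite,field} itself \<Rightarrow> (('a^2) \<times> ('a^2 \<Rightarrow> 'a^2)) monoid"
  where "ASL2 F = semidirect \<lparr>carrier = UNIV, mult = (+), one = 0\<rparr> (SL2 F) (\<lambda>f. f)"

text \<open>\<open>\<Gamma>L\<^sub>2(q, S\<^sub>0)\<close>\<close>

definition GammaL2_normalizer ::
  "'a::{finite,field} itself \<Rightarrow> ('a^2 \<Rightarrow> 'a^2) set \<Rightarrow> ('a^2 \<Rightarrow> 'a^2) monoid"
  where "GammaL2_normalizer F S0 = (GammaL2 F)\<lparr>carrier := normalizer (GammaL2 F) S0\<rparr>"


section \<open>\<open>G\<close>-graphs\<close>

record 'v graph =
  verts :: "'v set"
  edges :: "'v set set"

definition connected_graph :: "'v graph \<Rightarrow> bool"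
  where "connected_graph \<Delta> \<longleftrightarrow>
    finite (verts \<Delta>) \<and> verts \<Delta> \<noteq> {} \<and>
    (\<forall>e\<in>edges \<Delta>. \<exists>x\<in>verts \<Delta>. \<exists>y\<in>verts \<Delta>. x \<noteq> y \<and> e = {x, y}) \<and>
    (\<forall>x\<in>verts \<Delta>. \<forall>y\<in>verts \<Delta>. (x, y) \<in> {(u, v). {u, v} \<in> edges \<Delta>}\<^sup>*)"

definition nbrs :: "'v graph \<Rightarrow> 'v \<Rightarrow> 'v set"
  where "nbrs \<Delta> z = {w. {z, w} \<in> edges \<Delta>}"

definition graph_Aut :: "'v graph \<Rightarrow> ('v \<Rightarrow> 'v) monoid"
  where "graph_Aut \<Delta> = (symm_group (verts \<Delta>))
    \<lparr>carrier := {f. f permutes verts \<Delta> \<and>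
       (\<forall>x\<in>verts \<Delta>. \<forall>y\<in>verts \<Delta>. {f x, f y} \<in> edges \<Delta> \<longleftrightarrow> {x, y} \<in> edges \<Delta>)}\<rparr>"

text \<open>The group \<open>G\<close> is regarded as a subgroup of the automorphism group by means of the
  injective homomorphism \<open>\<phi>\<close>.\<close>

definition G_graph :: "'v graph \<Rightarrow> ('g, 'm) monoid_scheme \<Rightarrow> ('g \<Rightarrow> 'v \<Rightarrow> 'v) \<Rightarrow> bool"
  where "G_graph \<Delta> G \<phi> \<longleftrightarrow>
    connected_graph \<Delta> \<and> group G \<and> \<phi> \<in> hom G (graph_Aut \<Delta>) \<and> inj_on \<phi> (carrier G)"

definition vstab :: "('g, 'm) monoid_scheme \<Rightarrow> ('g \<Rightarrow> 'v \<Rightarrow> 'v) \<Rightarrow> 'v \<Rightarrow> ('g, 'm) monoid_scheme"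
  where "vstab G \<phi> z = G\<lparr>carrier := stabilizer G \<phi> z\<rparr>"

text \<open>\<open>G\<^sub>z\<^sup>[\<^sup>1\<^sup>]\<close>\<close>

definition local_kernel ::
  "'v graph \<Rightarrow> ('g, 'm) monoid_scheme \<Rightarrow> ('g \<Rightarrow> 'v \<Rightarrow> 'v) \<Rightarrow> 'v \<Rightarrow> ('g, 'm) monoid_scheme"
  where "local_kernel \<Delta> G \<phi> z =
    G\<lparr>carrier := {g \<in> stabilizer G \<phi> z. \<forall>w\<in>nbrs \<Delta> z. \<phi> g w = w}\<rparr>"

text \<open>The permutation group induced by \<open>G\<^sub>z\<close> on \<open>\<Delta>(z)\<close>; permutations of \<open>\<Delta>(z)\<close> are extended by the
  identity, as for \<open>permutes\<close>.\<close>

definition local_group ::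
  "'v graph \<Rightarrow> ('g, 'm) monoid_scheme \<Rightarrow> ('g \<Rightarrow> 'v \<Rightarrow> 'v) \<Rightarrow> 'v \<Rightarrow> ('v \<Rightarrow> 'v) monoid"
  where "local_group \<Delta> G \<phi> z = (symm_group (nbrs \<Delta> z))
    \<lparr>carrier := (\<lambda>g w. if w \<in> nbrs \<Delta> z then \<phi> g w else w) ` stabilizer G \<phi> z\<rparr>"

definition s_arc_from :: "'v graph \<Rightarrow> nat \<Rightarrow> 'v \<Rightarrow> 'v list \<Rightarrow> bool"
  where "s_arc_from \<Delta> s z xs \<longleftrightarrow>
    length xs = s + 1 \<and> xs ! 0 = z \<and> set xs \<subseteq> verts \<Delta> \<and>
    (\<forall>i<s. {xs ! i, xs ! (i + 1)} \<in> edges \<Delta>) \<and>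
    (\<forall>i. 1 \<le> i \<and> i < s \<longrightarrow> xs ! (i - 1) \<noteq> xs ! (i + 1))"

definition transitive_on_s_arcs_from ::
  "'v graph \<Rightarrow> ('g, 'm) monoid_scheme \<Rightarrow> ('g \<Rightarrow> 'v \<Rightarrow> 'v) \<Rightarrow> nat \<Rightarrow> 'v \<Rightarrow> bool"
  where "transitive_on_s_arcs_from \<Delta> G \<phi> s z \<longleftrightarrow>
    (\<forall>xs ys. s_arc_from \<Delta> s z xs \<and> s_arc_from \<Delta> s z ys \<longrightarrow>
       (\<exists>g\<in>stabilizer G \<phi> z. map (\<phi> g) xs = ys))"

definition locally_finite ::
  "'v graph \<Rightarrow> ('g, 'm) monoid_scheme \<Rightarrow> ('g \<Rightarrow> 'v \<Rightarrow> 'v) \<Rightarrow> bool"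
  where "locally_finite \<Delta> G \<phi> \<longleftrightarrow> (\<forall>z\<in>verts \<Delta>. finite (stabilizer G \<phi> z))"

definition locally_s_arc_transitive ::
  "'v graph \<Rightarrow> ('g, 'm) monoid_scheme \<Rightarrow> ('g \<Rightarrow> 'v \<Rightarrow> 'v) \<Rightarrow> nat \<Rightarrow> bool"
  where "locally_s_arc_transitive \<Delta> G \<phi> s \<longleftrightarrow>
    (\<forall>z\<in>verts \<Delta>. transitive_on_s_arcs_from \<Delta> G \<phi> s z)"

definition local_characteristic ::
  "'v graph \<Rightarrow> ('g, 'm) monoid_scheme \<Rightarrow> ('g \<Rightarrow> 'v \<Rightarrow> 'v) \<Rightarrow> nat \<Rightarrow> bool"
  where "local_characteristic \<Delta> G \<phi> p \<longleftrightarrow> prime p \<and>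
    (\<forall>z\<in>verts \<Delta>. centralizer (vstab G \<phi> z) (p_core p (local_kernel \<Delta> G \<phi> z))
                   \<subseteq> p_core p (local_kernel \<Delta> G \<phi> z))"

definition pushing_up_type_wrt ::
  "'v graph \<Rightarrow> ('g, 'm) monoid_scheme \<Rightarrow> ('g \<Rightarrow> 'v \<Rightarrow> 'v) \<Rightarrow> 'v \<Rightarrow> 'v \<Rightarrow> nat \<Rightarrow> bool"
  where "pushing_up_type_wrt \<Delta> G \<phi> x1 x2 p \<longleftrightarrow>
    s_arc_from \<Delta> 1 x1 [x1, x2] \<and> local_characteristic \<Delta> G \<phi> p \<and>
    p_core p (local_kernel \<Delta> G \<phi> x1) \<subseteq> p_core p (local_kernel \<Delta> G \<phi> x2)"

definition pushing_up_type ::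
  "'v graph \<Rightarrow> ('g, 'm) monoid_scheme \<Rightarrow> ('g \<Rightarrow> 'v \<Rightarrow> 'v) \<Rightarrow> nat \<Rightarrow> bool"
  where "pushing_up_type \<Delta> G \<phi> p \<longleftrightarrow> (\<exists>x1 x2. pushing_up_type_wrt \<Delta> G \<phi> x1 x2 p)"


section \<open>The coset graph\<close>

type_synonym 'a omega = "'a \<times> 'a \<times> 'a"
type_synonym 'a perm = "'a omega \<Rightarrow> 'a omega"

abbreviation SymOmega :: "('a::{finite,field}) perm monoid"
  where "SymOmega \<equiv> symm_group UNIV"

definition eps :: "'a::{finite,field} itself \<Rightarrow> nat"
  where "eps _ = CARD('a) div 3"

definition perm_alpha :: "'a::{finite,field} \<Rightarrow> 'a \<Rightarrow> 'a \<Rightarrow> 'a perm"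
  where "perm_alpha u v w = (\<lambda>(a, b, c). (a + u, b + v, c + w))"

definition perm_beta :: "'a::{finite,field} \<Rightarrow> 'a \<Rightarrow> 'a perm"
  where "perm_beta l m = (\<lambda>(a, b, c). (l * a, m * b, (l * m) ^ (2 * eps TYPE('a)) * c))"

definition perm_gamma :: "'a::{finite,field} \<Rightarrow> 'a perm"
  where "perm_gamma e = (\<lambda>(a, b, c). (a + e * b, b, c))"

definition perm_delta :: "('a::{finite,field}) perm"
  where "perm_delta = (\<lambda>(a, b, c). (b, - a, c))"

definition perm_tau :: "'a::{finite,field} \<Rightarrow> 'a perm"
  where "perm_tau d = (\<lambda>(a, b, c). (a + d * b\<^sup>2 + d ^ eps TYPE('a) * c, b, c))"

definition perm_sigma :: "('a::{finite,field}) perm"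
  where "perm_sigma = (\<lambda>(a, b, c). (a ^ 3, b ^ 3, c ^ 3))"

definition grp_A :: "('a::{finite,field}) perm set"
  where "grp_A = generate SymOmega {perm_alpha u v w | u v w. True}"

definition grp_C :: "('a::{finite,field}) perm set"
  where "grp_C = generate SymOmega {perm_gamma e | e. True}"

definition grp_S :: "('a::{finite,field}) perm set"
  where "grp_S = generate SymOmega {perm_beta (m\<^sup>2) m | m. m \<noteq> 0}"

definition grp_T :: "('a::{finite,field}) perm set"
  where "grp_T = generate SymOmega {perm_beta m (inverse m) | m. m \<noteq> 0}"

definition grp_D :: "('a::{finite,field}) perm set"
  where "grp_D = generate SymOmega {perm_delta}"

definition grp_E :: "('a::{finite,field}) perm set"
  where "grp_E = generate SymOmega {perm_tau d | d. True}"

definition grp_Sigma :: "('a::{finite,field}) perm set"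
  where "grp_Sigma = generate SymOmega {perm_sigma}"

definition grp_M :: "('a::{finite,field}) perm set"
  where "grp_M = generate SymOmega (grp_C \<union> grp_D \<union> grp_T)"

definition grp_Q :: "('a::{finite,field}) perm set"
  where "grp_Q = generate SymOmega (grp_A \<union> grp_C)"

definition grp_G1 :: "('a::{finite,field}) perm set"
  where "grp_G1 =
    grp_A <#>\<^bsub>SymOmega\<^esub> grp_M <#>\<^bsub>SymOmega\<^esub> grp_S <#>\<^bsub>SymOmega\<^esub> grp_Sigma"

definition grp_G2 :: "('a::{finite,field}) perm set"
  where "grp_G2 =
    grp_Q <#>\<^bsub>SymOmega\<^esub> grp_S <#>\<^bsub>SymOmega\<^esub> grp_E <#>\<^bsub>SymOmega\<^esub> grp_T <#>\<^bsub>SymOmega\<^esub> grp_Sigma"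

definition group_G :: "'a::{finite,field} itself \<Rightarrow> 'a perm monoid"
  where "group_G _ = SymOmega\<lparr>carrier := generate SymOmega (grp_G1 \<union> grp_G2)\<rparr>"

definition coset_graph :: "'a::{finite,field} itself \<Rightarrow> 'a perm set graph"
  where "coset_graph F =
    \<lparr>verts = rcosets\<^bsub>group_G F\<^esub> grp_G1 \<union> rcosets\<^bsub>group_G F\<^esub> grp_G2,
     edges = {{X, Y} | X Y. X \<in> rcosets\<^bsub>group_G F\<^esub> grp_G1 \<and> Y \<in> rcosets\<^bsub>group_G F\<^esub> grp_G2 \<and>
                            X \<inter> Y \<noteq> {}}\<rparr>"

text \<open>Right multiplication; the value off the vertex set makes it a permutation in the sense of
  \<open>permutes\<close>.\<close>

definition right_mult ::
  "'a::{finite,field} itself \<Rightarrow> 'a perm \<Rightarrow> 'a perm set \<Rightarrow> 'a perm set"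
  where "right_mult F g X = (if X \<in> verts (coset_graph F) then X #>\<^bsub>group_G F\<^esub> g else X)"

end

theory Submission
  imports Defs "HOL-Algebra.Multiplicative_Group" "HOL-Computational_Algebra.Polynomial"
begin

text \<open>All elements of \<open>G\<^sub>1\<close> are semi-affine maps (\<open>smap\<close> below) and all elements of \<open>G\<^sub>2\<close> have a
  triangular normal form (\<open>bmap\<close>), because every field automorphism is a power of the Frobenius map.
  The cosets of \<open>G\<^sub>1 \<inter> G\<^sub>2\<close> in \<open>G\<^sub>1\<close> are the \<open>q + 1\<close> lines of a plane, permuted by the linear parts;
  the neighbours \<open>G\<^sub>1\<tau>\<^sub>d\<close> of \<open>G\<^sub>2\<close> are indexed by the field and permuted by semi-affine maps.
  The \<open>3\<close>-cores of the kernels of these two actions are \<open>A\<close> and \<open>Q\<close>, and \<open>A \<le> Q\<close> is the pushing up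
  property. An arc is moved vertex by vertex onto the standard path through the flags at
  \<open>1, \<tau>\<^sub>1, \<delta>\<tau>\<^sub>1, \<tau>\<^sub>1\<delta>\<tau>\<^sub>1, \<dots>\<close>: at each flag a translation, some \<open>\<gamma>\<^sub>e\<close> or a diagonal map
  \<open>\<beta>\<^bsub>\<lambda>,\<mu>\<^esub>\<close> fixes the part already normalized and still moves the next vertex as required.
  Since a Sylow \<open>3\<close>-subgroup of \<open>SL\<^sub>2(q)\<close> fixes a nonzero vector, all of them are conjugate to the
  group of upper unitriangular maps, so \<open>S\<^sub>0\<close> may be taken to be that group.\<close>


section \<open>Isomorphisms, cores and semidirect products\<close>

text \<open>The exponent q/3 makes \<open>d ^ eps\<close> the cube root of d, an additive and
  multiplicative function. This explains the scalings in the definitions. If \<beta> with diagonal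
  entries l, m is moved past a map \<tau>_d, then d turns into d m^2 / l, and both terms d b^2 and
  \<open>cbrt d\<close> c follow this change because c is scaled by the square of the cube root of l
  m. So the diagonal maps normalize the group of all \<tau>_d. Squaring is not additive, but 2 = -1
  gives (X + Y)^2 = X^2 + Y^2 - X Y, and the cross term with a translation is linear in b, hence
  absorbed by some \<open>perm_gamma\<close>. The same cross term governs the long arcs: a
  translation becomes visible at a distant vertex only after \<delta> and \<tau>_1 have turned it
  into a \<open>perm_gamma\<close>. The group G has no normal form; what is known about it comes
  from the two subgroups, generation, and conjugation. A recurring obstacle is the order of factors.
  Permutations of \<Omega> multiply from left to right, the linear groups by ordinary composition,
  so the natural comparison maps reverse products and are corrected by an inversion.\<close>

lemma is_iso_parametrized:
  assumes f: "f ` P = carrier G" and h: "h ` P = carrier H"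
    and eq: "\<And>p q. p \<in> P \<Longrightarrow> q \<in> P \<Longrightarrow> f p = f q \<longleftrightarrow> h p = h q"
    and mult: "\<And>p q. p \<in> P \<Longrightarrow> q \<in> P \<Longrightarrow>
      \<exists>t\<in>P. f p \<otimes>\<^bsub>G\<^esub> f q = f t \<and> h p \<otimes>\<^bsub>H\<^esub> h q = h t"
  shows "G \<cong> H"
proof -
  \<comment> \<open>\<open>f\<close> may identify parameters; by \<open>eq\<close> it identifies the
    same ones as \<open>h\<close>, so the representative picked by \<open>inv_into\<close> does not
    matter.\<close>
  define \<psi> where "\<psi> x = h (inv_into P f x)" for x
  have \<psi>: "\<psi> (f p) = h p" if "p \<in> P" for p
  proof -
    have "f (inv_into P f (f p)) = f p" "inv_into P f (f p) \<in> P"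
      using that by (auto intro: f_inv_into_f inv_into_into)
    then show ?thesis
      unfolding \<psi>_def using eq that by blast
  qed
  have "\<psi> \<in> hom G H"
  proof (rule homI)
    fix x assume "x \<in> carrier G"
    then obtain p where "p \<in> P" "x = f p" using f by blast
    then show "\<psi> x \<in> carrier H" using \<psi> h by auto
  next
    fix x y assume "x \<in> carrier G" "y \<in> carrier G"
    then obtain p q where pq: "p \<in> P" "x = f p" "q \<in> P" "y = f q" using f by blast
    then obtain t where "t \<in> P" "f p \<otimes>\<^bsub>G\<^esub> f q = f t" "h p \<otimes>\<^bsub>H\<^esub> h q = h t"
      using mult by blast
    then show "\<psi> (x \<otimes>\<^bsub>G\<^esub> y) = \<psi> x \<otimes>\<^bsub>H\<^esub> \<psi> y"
      using pq \<psi> by simp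
  qed
  moreover have "inj_on \<psi> (carrier G)"
    unfolding f[symmetric] by (rule inj_onI) (auto simp: \<psi> eq)
  moreover have "\<psi> ` carrier G = carrier H"
    unfolding f[symmetric] h[symmetric] by (force simp: \<psi> image_iff)
  ultimately show ?thesis
    by (auto simp: is_iso_def iso_def bij_betw_def)
qed

text \<open>Inversion in \<open>H\<close> turns a product-reversing correspondence into an
  isomorphism. This is the form needed to compare groups inside \<open>SymOmega\<close> with
  \<open>GammaL2\<close>, \<open>AGammaL1\<close> and \<open>ASL2\<close>.\<close>

lemma is_iso_parametrized_anti:
  assumes "group H" and f: "f ` P = carrier G" and h: "h ` P = carrier H"
    and eq: "\<And>p q. p \<in> P \<Longrightarrow> q \<in> P \<Longrightarrow> f p = f q \<longleftrightarrow> h p = h q"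
    and mult: "\<And>p q. p \<in> P \<Longrightarrow> q \<in> P \<Longrightarrow>
      \<exists>t\<in>P. f p \<otimes>\<^bsub>G\<^esub> f q = f t \<and> h q \<otimes>\<^bsub>H\<^esub> h p = h t"
  shows "G \<cong> H"
proof (rule is_iso_parametrized[where f = f and P = P and h = "\<lambda>p. inv\<^bsub>H\<^esub> (h p)"])
  interpret H: group H by fact
  have hc: "h p \<in> carrier H" if "p \<in> P" for p using h that by blast
  show "f ` P = carrier G" by fact
  show "(\<lambda>p. inv\<^bsub>H\<^esub> (h p)) ` P = carrier H"
  proof
    show "carrier H \<subseteq> (\<lambda>p. inv\<^bsub>H\<^esub> (h p)) ` P"
    proof
      fix x assume x: "x \<in> carrier H"
      then obtain p where p: "p \<in> P" "inv\<^bsub>H\<^esub> x = h p" using h H.inv_closed[OF x] by blast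
      have "x = inv\<^bsub>H\<^esub> (h p)" using x p(2) H.inv_inv by metis
      then show "x \<in> (\<lambda>p. inv\<^bsub>H\<^esub> (h p)) ` P"
        by (rule image_eqI) fact
    qed
  qed (auto simp: hc)
  fix p q assume pq: "p \<in> P" "q \<in> P"
  show "f p = f q \<longleftrightarrow> inv\<^bsub>H\<^esub> (h p) = inv\<^bsub>H\<^esub> (h q)"
    using eq[OF pq] hc pq H.inv_inv by metis
  obtain t where "t \<in> P" "f p \<otimes>\<^bsub>G\<^esub> f q = f t" "h q \<otimes>\<^bsub>H\<^esub> h p = h t"
    using mult[OF pq] by blast
  then show "\<exists>t\<in>P. f p \<otimes>\<^bsub>G\<^esub> f q = f t \<and>
      inv\<^bsub>H\<^esub> (h p) \<otimes>\<^bsub>H\<^esub> inv\<^bsub>H\<^esub> (h q) = inv\<^bsub>H\<^esub> (h t)"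
    using hc pq by (metis H.inv_mult_group)
qed

text \<open>Two powers of an element must coincide in a finite set closed under products; so some
  positive power is the identity, and the inverse is itself a power.\<close>

lemma (in group) subgroup_of_finite:
  assumes "finite H" "H \<subseteq> carrier G" "H \<noteq> {}"
    and closed: "\<And>x y. x \<in> H \<Longrightarrow> y \<in> H \<Longrightarrow> x \<otimes> y \<in> H"
  shows "subgroup H G"
proof -
  have pow: "x [^] Suc n \<in> H" if "x \<in> H" for x and n :: nat
    by (induction n) (use that assms in \<open>auto simp: nat_pow_Suc\<close>)
  have inv: "inv x \<in> H" if x: "x \<in> H" for x
  proof -
    have xc: "x \<in> carrier G" using x assms by blast
    have "\<not> inj (\<lambda>n::nat. x [^] Suc n)"
      using finite_imageD[of "\<lambda>n::nat. x [^] Suc n" UNIV] finite_subset[OF _ \<open>finite H\<close>] pow[OF x]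
        infinite_UNIV_nat by (metis image_subsetI)
    then obtain i j :: nat where "i < j" and eq: "x [^] Suc i = x [^] Suc j"
      unfolding inj_def by (metis linorder_neqE_nat)
    then obtain k where j: "Suc j = Suc i + Suc k"
      using less_imp_Suc_add by fastforce
    have "x [^] Suc i \<otimes> x [^] Suc k = x [^] Suc i"
      unfolding nat_pow_mult[OF xc] using eq unfolding j by (rule sym)
    then have "x [^] Suc k = \<one>"
      using l_cancel_one xc nat_pow_closed by blast
    then have 1: "x [^] k \<otimes> x = \<one>" using xc by simp
    then have "inv x = x [^] k" using xc by (metis inv_equality nat_pow_closed)
    \<comment> \<open>Only positive powers are known to lie in \<open>H\<close>; for k = 0 the
      element x itself is the identity.\<close>
    moreover have "x [^] k \<in> H"
    proof (cases k)
      case 0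
      then show ?thesis using 1 xc x by simp
    qed (use pow[OF x] in auto)
    ultimately show ?thesis by simp
  qed
  show ?thesis
    by (rule subgroupI) (use assms inv in auto)
qed

section \<open>Groups of permutations and of bijections\<close>

lemma group_symm_group: "group (symm_group X)"
proof (rule groupI)
  show "\<exists>y\<in>carrier (symm_group X). y \<otimes>\<^bsub>symm_group X\<^esub> x = \<one>\<^bsub>symm_group X\<^esub>"
    if "x \<in> carrier (symm_group X)" for x
    using that permutes_inv[of x X] permutes_inv_o[of x X]
    by (intro bexI[of _ "Hilbert_Choice.inv x"]) (auto simp: symm_group_def)
qed (auto simp: symm_group_def permutes_compose permutes_id[unfolded id_def[symmetric]] comp_assoc)

lemma group_bijections: "group \<lparr>carrier = {f. bij f}, mult = (\<circ>), one = id\<rparr>"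
proof (rule groupI)
  fix x :: "'a \<Rightarrow> 'a"
  assume "x \<in> carrier \<lparr>carrier = {f. bij f}, mult = (\<circ>), one = id\<rparr>"
  then show "\<exists>y\<in>carrier \<lparr>carrier = {f. bij f}, mult = (\<circ>), one = id\<rparr>.
      y \<otimes>\<^bsub>\<lparr>carrier = {f. bij f}, mult = (\<circ>), one = id\<rparr>\<^esub> x
        = \<one>\<^bsub>\<lparr>carrier = {f. bij f}, mult = (\<circ>), one = id\<rparr>\<^esub>"
    by (intro bexI[of _ "Hilbert_Choice.inv x"]) (auto simp: bij_is_inj bij_imp_bij_inv)
qed (auto simp: bij_comp comp_assoc)

lemma group_of_bijections:
  fixes S :: "('b::finite \<Rightarrow> 'b) set"
  assumes "S \<subseteq> {f. bij f}" "S \<noteq> {}" "\<And>f g. f \<in> S \<Longrightarrow> g \<in> S \<Longrightarrow> f \<circ> g \<in> S"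
  shows "group \<lparr>carrier = S, mult = (\<circ>), one = id\<rparr>"
proof -
  have "subgroup S \<lparr>carrier = {f. bij f}, mult = (\<circ>), one = id\<rparr>"
    by (rule group.subgroup_of_finite[OF group_bijections]) (use assms in auto)
  then show ?thesis
    using subgroup.subgroup_is_group[OF _ group_bijections] by fastforce
qed

text \<open>An isomorphism matches the normal subgroups of p-power order on both sides and commutes
  with generation. It is used for conjugation, which carries the core at one vertex to the core at a
  translate.\<close>

lemma iso_p_core:
  assumes "group G" "group H" and \<psi>: "\<psi> \<in> iso G H"
  shows "p_core p H = \<psi> ` p_core p G"
proof -
  interpret group_hom G H \<psi>
    using assms by (simp add: group_hom_def group_hom_axioms_def iso_def)
  have inj: "inj_on \<psi> (carrier G)" and img: "\<psi> ` carrier G = carrier H"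
    using \<psi> by (auto simp: iso_def bij_betw_def)
  have sub: "N \<subseteq> carrier G" if "N \<lhd> G" for N
    using that normal_imp_subgroup subgroup.subset by blast
  define A where "A = {N. N \<lhd> G \<and> (\<exists>k. card N = p ^ k)}"
  have "{N. N \<lhd> H \<and> (\<exists>k. card N = p ^ k)} = (`) \<psi> ` A"
  proof (intro subset_antisym subsetI)
    fix N assume "N \<in> {N. N \<lhd> H \<and> (\<exists>k. card N = p ^ k)}"
    then have N: "N \<lhd> H" and cN: "\<exists>k. card N = p ^ k" by auto
    have "inv_into (carrier G) \<psi> \<in> iso H G"
      using assms(1) \<psi> by (simp add: G.iso_set_sym)
    then have nN: "inv_into (carrier G) \<psi> ` N \<lhd> G"
      using iso_normal_subgroup assms N by blast
    have "N \<subseteq> \<psi> ` carrier G"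
      using N normal_imp_subgroup subgroup.subset img by blast
    then have "\<psi> ` inv_into (carrier G) \<psi> ` N = N" "card (inv_into (carrier G) \<psi> ` N) = card N"
      by (auto simp: image_inv_into_cancel intro: card_image inj_on_inv_into)
    then show "N \<in> (`) \<psi> ` A"
      using nN cN unfolding A_def by (intro image_eqI[of _ _ "inv_into (carrier G) \<psi> ` N"]) auto
  next
    fix N assume "N \<in> (`) \<psi> ` A"
    then obtain M where M: "M \<lhd> G" "\<exists>k. card M = p ^ k" "N = \<psi> ` M" by (auto simp: A_def)
    then show "N \<in> {N. N \<lhd> H \<and> (\<exists>k. card N = p ^ k)}"
      using iso_normal_subgroup[OF \<psi> assms(1,2)] card_image[OF inj_on_subset[OF inj sub]] by auto
  qed
  moreover have "\<Union>((`) \<psi> ` A) = \<psi> ` \<Union>A" by auto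
  moreover have "\<Union>A \<subseteq> carrier G" using sub by (auto simp: A_def)
  ultimately show ?thesis
    unfolding p_core_def A_def[symmetric] using generate_img by metis
qed

text \<open>A normal subgroup of p-power order whose index m is prime to p absorbs every other
  normal subgroup of p-power order, since an element of p-power order is a power of its own m-th
  power.\<close>

lemma (in group) p_core_eqI:
  assumes "finite (carrier G)" and N: "N \<lhd> G" and "card N = p ^ k"
    and "card (carrier G) = card N * m" "coprime m p"
  shows "p_core p G = N"
proof -
  interpret N: normal N G by fact
  have Np: "card N > 0"
    using \<open>finite (carrier G)\<close> N.subset N.one_closed finite_subset card_gt_0_iff by blast
  have Q: "group (G Mod N)" by (rule N.factorgroup_is_group)
  have m: "Coset.order (G Mod N) = m"
  proof -
    have "card (rcosets N) * card N = Coset.order G"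
      using lagrange[OF N.subgroup_axioms] by simp
    then have "card (rcosets N) = m"
      using assms(4) Np by (simp add: Coset.order_def mult.commute)
    then show ?thesis by (simp add: Coset.order_def FactGroup_def)
  qed
  have powm: "x [^] m \<in> N" if x: "x \<in> carrier G" for x
  proof -
    have "(N #> x) [^]\<^bsub>G Mod N\<^esub> m = N"
      using group.pow_order_eq_1[OF Q, of "N #> x"] x m rcosetsI[OF N.subset]
      by (auto simp: FactGroup_def)
    moreover have "(N #> x) [^]\<^bsub>G Mod N\<^esub> n = N #> (x [^] n)" for n :: nat
      by (induction n) (use x in \<open>auto simp: FactGroup_def N.rcos_sum N.subset\<close>)
    ultimately have "N #> (x [^] m) = N" by simp
    then show ?thesis using x N.subgroup_axioms by (metis nat_pow_closed rcos_self)
  qed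
  have "N' \<subseteq> N" if N': "N' \<lhd> G" and "card N' = p ^ j" for N' j
  proof
    interpret N': normal N' G by fact
    fix x assume x: "x \<in> N'"
    then have xc: "x \<in> carrier G" using N'.subset by blast
    have "x [^]\<^bsub>G\<lparr>carrier := N'\<rparr>\<^esub> Coset.order (G\<lparr>carrier := N'\<rparr>) = \<one>\<^bsub>G\<lparr>carrier := N'\<rparr>\<^esub>"
      by (rule group.pow_order_eq_1[OF N'.subgroup_is_group[OF is_group]]) (use x in auto)
    then have pj: "x [^] (p ^ j) = \<one>"
      using \<open>card N' = p ^ j\<close> by (simp add: Coset.order_def nat_pow_def)
    have "coprime (int m) (int (p ^ j))" using \<open>coprime m p\<close> by simp
    \<comment> \<open>Bezout splits x into a power of x^m, which lies in \<open>N\<close> because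
      the quotient has order m, and a power of x^(p^j), which is trivial.\<close>
    then obtain a b where ab: "a * int m + b * int (p ^ j) = 1"
      using bezout_int[of "int m" "int (p ^ j)"] by auto
    have "x = x [^] (int m * a + int (p ^ j) * b)"
      using ab xc by (simp add: mult.commute)
    also have "\<dots> = (x [^] int m) [^] a \<otimes> (x [^] int (p ^ j)) [^] b"
      using xc by (simp add: int_pow_mult int_pow_pow)
    also have "\<dots> = (x [^] m) [^] a"
      using xc pj by (simp add: int_pow_int int_pow_one del: of_nat_power)
    also have "\<dots> \<in> N"
      using N.subgroup_axioms powm[OF xc] by (simp add: subgroup_int_pow_closed)
    finally show "x \<in> N" .
  qed
  then have "\<Union>{N. N \<lhd> G \<and> (\<exists>k. card N = p ^ k)} = N"
    using N \<open>card N = p ^ k\<close> by blast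
  then show ?thesis
    unfolding p_core_def using generateI[OF N.subgroup_axioms subset_refl] by simp
qed

text \<open>Recognition of an internal semidirect product whose factors are known only up to
  isomorphism; the action of \<open>K\<close> on \<open>N\<close> is conjugation in
  \<open>G\<close>, transported along both isomorphisms.\<close>

lemma (in group) is_semidirect_productI:
  assumes N': "N' \<lhd> G" and K': "subgroup K' G"
    and int: "N' \<inter> K' \<subseteq> {\<one>}" and prod: "carrier G \<subseteq> N' <#> K'"
    and N: "group N" "G\<lparr>carrier := N'\<rparr> \<cong> N" and K: "group K" "G\<lparr>carrier := K'\<rparr> \<cong> K"
  shows "is_semidirect_product G N K"
proof -
  interpret N': normal N' G by fact
  interpret K': subgroup K' G by fact
  interpret N: group N by fact
  interpret K: group K by fact
  obtain f where f: "f \<in> iso N (G\<lparr>carrier := N'\<rparr>)"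
    using group.iso_sym[OF N'.subgroup_is_group[OF is_group] N(2)] by (auto simp: is_iso_def)
  obtain g where g: "g \<in> iso K (G\<lparr>carrier := K'\<rparr>)"
    using group.iso_sym[OF K'.subgroup_is_group[OF is_group] K(2)] by (auto simp: is_iso_def)
  have fb: "bij_betw f (carrier N) N'" and gb: "bij_betw g (carrier K) K'"
    using f g by (auto simp: iso_def)
  have fN: "f n \<in> N'" if "n \<in> carrier N" for n using fb that bij_betwE by blast
  have gK: "g k \<in> K'" if "k \<in> carrier K" for k using gb that bij_betwE by blast
  have fc[simp]: "f n \<in> carrier G" if "n \<in> carrier N" for n using fN[OF that] N'.subset by blast
  have gc[simp]: "g k \<in> carrier G" if "k \<in> carrier K" for k using gK[OF that] K'.subset by blast
  have fm: "f (m \<otimes>\<^bsub>N\<^esub> n) = f m \<otimes> f n" if "m \<in> carrier N" "n \<in> carrier N" for m n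
    using f that by (auto simp: iso_def hom_def)
  have gm: "g (k \<otimes>\<^bsub>K\<^esub> l) = g k \<otimes> g l" if "k \<in> carrier K" "l \<in> carrier K" for k l
    using g that by (auto simp: iso_def hom_def)
  have finj: "m = n" if "f m = f n" "m \<in> carrier N" "n \<in> carrier N" for m n
    using fb that by (auto simp: bij_betw_def inj_on_def)
  define c where "c k n = inv_into (carrier N) f (g k \<otimes> f n \<otimes> inv (g k))" for k n
  have cc: "c k n \<in> carrier N" and fc': "f (c k n) = g k \<otimes> f n \<otimes> inv (g k)"
    if "k \<in> carrier K" "n \<in> carrier N" for k n
  proof -
    have "g k \<otimes> f n \<otimes> inv (g k) \<in> N'" using N'.inv_op_closed2 gc[OF that(1)] fN[OF that(2)] by simp
    then have *: "g k \<otimes> f n \<otimes> inv (g k) \<in> f ` carrier N" using fb by (simp add: bij_betw_def)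
    show "c k n \<in> carrier N" unfolding c_def by (rule inv_into_into[OF *])
    show "f (c k n) = g k \<otimes> f n \<otimes> inv (g k)" unfolding c_def by (rule f_inv_into_f[OF *])
  qed
  have ccomp: "c (k \<otimes>\<^bsub>K\<^esub> l) n = c k (c l n)"
    if "k \<in> carrier K" "l \<in> carrier K" "n \<in> carrier N" for k l n
    by (rule finj) (use that in \<open>simp_all add: cc fc' gm m_assoc inv_mult_group\<close>)
  have cmult: "c k (m \<otimes>\<^bsub>N\<^esub> n) = c k m \<otimes>\<^bsub>N\<^esub> c k n"
    if "k \<in> carrier K" "m \<in> carrier N" "n \<in> carrier N" for k m n
  proof (rule finj)
    have [simp]: "inv (g k) \<otimes> (g k \<otimes> x) = x" if "x \<in> carrier G" for x
      using that \<open>k \<in> carrier K\<close> by (simp flip: m_assoc)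
    show "f (c k (m \<otimes>\<^bsub>N\<^esub> n)) = f (c k m \<otimes>\<^bsub>N\<^esub> c k n)"
      using that by (simp add: cc fc' fm m_assoc)
  qed (use that cc in auto)
  have g1: "g \<one>\<^bsub>K\<^esub> = \<one>"
    using gm[OF K.one_closed K.one_closed] by (metis gc K.l_one K.one_closed l_cancel_one')
  have c1: "c \<one>\<^bsub>K\<^esub> n = n" if "n \<in> carrier N" for n
    by (rule finj) (use that in \<open>simp_all add: cc fc' g1\<close>)
  have cbij: "bij_betw (c k) (carrier N) (carrier N)" if k: "k \<in> carrier K" for k
  proof (rule bij_betw_byWitness[where f' = "c (inv\<^bsub>K\<^esub> k)"])
    show "\<forall>a\<in>carrier N. c (inv\<^bsub>K\<^esub> k) (c k a) = a" "\<forall>a\<in>carrier N. c k (c (inv\<^bsub>K\<^esub> k) a) = a"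
      using k by (simp_all add: c1 flip: ccomp)
  qed (use cc k in auto)
  define \<theta> where "\<theta> k = restrict (c k) (carrier N)" for k
  have \<theta>B: "\<theta> k \<in> Bij (carrier N)" if "k \<in> carrier K" for k
    unfolding Bij_def \<theta>_def using cbij[OF that] by simp
  have "\<theta> \<in> hom K (AutoGroup N)"
  proof (rule homI)
    fix k assume "k \<in> carrier K"
    then show "\<theta> k \<in> carrier (AutoGroup N)"
      using \<theta>B by (auto simp: AutoGroup_def auto_def hom_def \<theta>_def cc cmult)
  next
    fix k l assume kl: "k \<in> carrier K" "l \<in> carrier K"
    then show "\<theta> (k \<otimes>\<^bsub>K\<^esub> l) = \<theta> k \<otimes>\<^bsub>AutoGroup N\<^esub> \<theta> l"
      by (auto simp: AutoGroup_def BijGroup_def \<theta>B) (auto simp: \<theta>_def compose_def ccomp cc)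
  qed
  moreover have "G \<cong> semidirect N K \<theta>"
  proof (rule is_iso_parametrized[where f = "\<lambda>(n, k). f n \<otimes> g k" and h = id
        and P = "carrier N \<times> carrier K"])
    show "(\<lambda>(n, k). f n \<otimes> g k) ` (carrier N \<times> carrier K) = carrier G"
    proof
      show "carrier G \<subseteq> (\<lambda>(n, k). f n \<otimes> g k) ` (carrier N \<times> carrier K)"
      proof
        fix x assume "x \<in> carrier G"
        then obtain n k where "n \<in> N'" "k \<in> K'" "x = n \<otimes> k"
          using prod by (auto simp: set_mult_def)
        moreover have "N' = f ` carrier N" "K' = g ` carrier K"
          using fb gb by (auto simp: bij_betw_def)
        ultimately show "x \<in> (\<lambda>(n, k). f n \<otimes> g k) ` (carrier N \<times> carrier K)" by auto
      qed
    qed auto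
    show "id ` (carrier N \<times> carrier K) = carrier (semidirect N K \<theta>)"
      by (simp add: semidirect_def)
    fix p q assume p: "p \<in> carrier N \<times> carrier K" and q: "q \<in> carrier N \<times> carrier K"
    obtain n k n' k' where pq: "p = (n, k)" "q = (n', k')" by fastforce
    have c: "n \<in> carrier N" "k \<in> carrier K" "n' \<in> carrier N" "k' \<in> carrier K" using p q pq by auto
    show "((\<lambda>(n, k). f n \<otimes> g k) p = (\<lambda>(n, k). f n \<otimes> g k) q) = (id p = id q)"
    proof
      assume "(\<lambda>(n, k). f n \<otimes> g k) p = (\<lambda>(n, k). f n \<otimes> g k) q"
      then have e: "f n \<otimes> g k = f n' \<otimes> g k'" by (simp add: pq)
      \<comment> \<open>An equation n k = n' k' is rearranged so that one side lies in
        \<open>N'\<close> and the other in \<open>K'\<close>; both are then trivial.\<close>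
      have "inv (f n') \<otimes> f n = g k' \<otimes> inv (g k)"
      proof -
        have "inv (f n') \<otimes> f n = inv (f n') \<otimes> (f n \<otimes> g k \<otimes> inv (g k))"
          using c by (simp add: m_assoc)
        also have "\<dots> = inv (f n') \<otimes> f n' \<otimes> (g k' \<otimes> inv (g k))"
          unfolding e using c by (simp only: m_assoc m_closed inv_closed fc gc)
        finally show ?thesis using c by simp
      qed
      moreover have "inv (f n') \<otimes> f n \<in> N'" "g k' \<otimes> inv (g k) \<in> K'"
        using fN gK c by auto
      ultimately have "inv (f n') \<otimes> f n = \<one>" "g k' \<otimes> inv (g k) = \<one>" using int by auto
      then have "f n = f n'" "g k' = g k"
        using c inv_solve_left'[of \<one> "f n'" "f n"] inv_solve_right'[of \<one> "g k'" "g k"] by auto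
      then show "id p = id q" using fb gb c by (auto simp: pq bij_betw_def inj_on_def)
    qed simp
    have "f n \<otimes> g k \<otimes> (f n' \<otimes> g k') = f (n \<otimes>\<^bsub>N\<^esub> c k n') \<otimes> g (k \<otimes>\<^bsub>K\<^esub> k')"
    proof -
      have "inv (g k) \<otimes> (g k \<otimes> g k') = g k'" using c by (simp flip: m_assoc)
      then show ?thesis using c by (simp add: fm gm fc' cc m_assoc)
    qed
    then show "\<exists>t\<in>carrier N \<times> carrier K. (\<lambda>(n, k). f n \<otimes> g k) p \<otimes> (\<lambda>(n, k). f n \<otimes> g k) q
        = (\<lambda>(n, k). f n \<otimes> g k) t \<and> id p \<otimes>\<^bsub>semidirect N K \<theta>\<^esub> id q = id t"
      using c by (intro bexI[of _ "(n \<otimes>\<^bsub>N\<^esub> c k n', k \<otimes>\<^bsub>K\<^esub> k')"])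
        (auto simp: pq semidirect_def \<theta>_def cc)
  qed
  ultimately show ?thesis unfolding is_semidirect_product_def by blast
qed

lemma is_semidirect_product_iso:
  "G \<cong> H \<Longrightarrow> is_semidirect_product H N K \<Longrightarrow> is_semidirect_product G N K"
  unfolding is_semidirect_product_def using iso_trans by blast

section \<open>Automorphisms of finite fields of characteristic 3\<close>

context
  fixes s :: "'a::field \<Rightarrow> 'a"
  assumes s: "field_aut s"
begin

lemma field_aut_add: "s (x + y) = s x + s y"
  and field_aut_mult: "s (x * y) = s x * s y"
  and field_aut_inj: "s x = s y \<longleftrightarrow> x = y"
  using s by (auto simp: field_aut_def bij_def inj_eq)

lemma field_aut_0: "s 0 = 0"
  using field_aut_add[of 0 0] by (metis add.right_neutral add_cancel_left_right)

lemma field_aut_eq_0: "s x = 0 \<longleftrightarrow> x = 0"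
  using field_aut_inj[of x 0] by (simp add: field_aut_0)

lemma field_aut_1: "s 1 = 1"
  using field_aut_mult[of 1 1] by (simp add: field_aut_eq_0)

lemma field_aut_uminus: "s (- x) = - s x"
  using field_aut_add[of x "- x"] by (simp add: field_aut_0 eq_neg_iff_add_eq_0 add.commute)

lemma field_aut_diff: "s (x - y) = s x - s y"
  using field_aut_add[of x "- y"] by (simp add: field_aut_uminus)

lemma field_aut_power: "s (x ^ n) = s x ^ n"
  by (induction n) (simp_all add: field_aut_1 field_aut_mult)

lemma field_aut_inverse: "s (inverse x) = inverse (s x)"
proof (cases "x = 0")
  case False
  then have "s x * s (inverse x) = 1"
    by (simp flip: field_aut_mult add: field_aut_1)
  then show ?thesis by (metis inverse_unique)
qed (simp add: field_aut_0)

lemma field_aut_divide: "s (x / y) = s x / s y"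
  by (simp add: divide_inverse field_aut_mult field_aut_inverse)

lemma field_aut_sum: "s (sum f A) = (\<Sum>x\<in>A. s (f x))"
  by (induction A rule: infinite_finite_induct) (simp_all add: field_aut_0 field_aut_add)

lemmas field_aut_simps =
  field_aut_add field_aut_mult field_aut_0 field_aut_eq_0 field_aut_1 field_aut_uminus
  field_aut_diff field_aut_power field_aut_inverse field_aut_divide

lemma field_aut_map_poly_mult: "map_poly s (p * q) = map_poly s p * map_poly s q"
  by (rule poly_eqI)
    (simp add: coeff_map_poly coeff_mult field_aut_0 field_aut_sum field_aut_mult)

lemma field_aut_map_poly_prod: "map_poly s (prod f A) = (\<Prod>x\<in>A. map_poly s (f x))"
  by (induction A rule: infinite_finite_induct)
    (simp_all add: field_aut_map_poly_mult field_aut_1 map_poly_pCons)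

lemma field_aut_poly: "s (poly p x) = poly (map_poly s p) (s x)"
  by (induction p) (simp_all add: field_aut_simps map_poly_pCons)

end

lemma field_aut_id: "field_aut (\<lambda>x. x)" "field_aut id"
  by (auto simp: field_aut_def bij_def id_def)

lemma field_aut_comp: "field_aut s \<Longrightarrow> field_aut t \<Longrightarrow> field_aut (\<lambda>x. s (t x))"
  using bij_comp[of t s] by (auto simp: field_aut_def comp_def)

text \<open>Cyclicity of the multiplicative group is available for rings given by carrier records,
  so the type-class field is first packaged as such a record.\<close>

lemma finite_field_primitive_element:
  obtains g :: "'a::{finite,field}" where "g \<noteq> 0" "\<And>x. x \<noteq> 0 \<Longrightarrow> \<exists>n::nat. x = g ^ n"
proof -
  define R :: "'a ring" where
    "R = \<lparr>carrier = UNIV, mult = (*), one = 1, zero = 0, add = (+)\<rparr>"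
  have "cring R"
  proof (rule cringI)
    show "abelian_group R"
    proof (rule abelian_groupI)
      show "\<exists>y\<in>carrier R. y \<oplus>\<^bsub>R\<^esub> x = \<zero>\<^bsub>R\<^esub>" for x
        by (intro bexI[of _ "- x"]) (auto simp: R_def)
    qed (auto simp: R_def)
    show "comm_monoid R"
      by (rule comm_monoidI) (auto simp: R_def)
  qed (auto simp: R_def algebra_simps)
  then have "field R"
  proof (rule cring.cring_fieldI2)
    show "\<exists>b\<in>carrier R. a \<otimes>\<^bsub>R\<^esub> b = \<one>\<^bsub>R\<^esub>" if "a \<noteq> \<zero>\<^bsub>R\<^esub>" for a
      using that by (intro bexI[of _ "inverse a"]) (auto simp: R_def)
  qed (auto simp: R_def)
  then obtain g where g: "g \<in> carrier (mult_of R)"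
    "carrier (mult_of R) = {g [^]\<^bsub>R\<^esub> i | i::nat. i \<in> UNIV}"
    using field.finite_field_mult_group_has_gen[of R] by (auto simp: R_def)
  have pow: "x [^]\<^bsub>R\<^esub> i = x ^ i" for x and i :: nat
    by (induction i) (simp_all add: R_def nat_pow_def)
  show ?thesis
    by (rule that[of g]) (use g pow in \<open>auto simp: R_def\<close>)
qed

text \<open>Multiplication by a nonzero x permutes the nonzero elements; comparing their products
  gives x^(q-1) = 1.\<close>

lemma finite_field_power_CARD: "x ^ CARD('a) = x" for x :: "'a::{finite,field}"
proof (cases "x = 0")
  case False
  have "(\<Prod>y\<in>UNIV - {0}. x * y) = \<Prod>(UNIV - {0})"
    by (rule prod.reindex_bij_witness[of _ "\<lambda>y. y / x" "\<lambda>y. x * y"]) (use False in auto)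
  then have "x ^ (CARD('a) - 1) * \<Prod>(UNIV - {0}) = 1 * \<Prod>(UNIV - {0})"
    by (simp add: prod.distrib card_Diff_singleton)
  then have "x ^ (CARD('a) - 1) = 1" by (simp add: prod_zero_iff)
  then have "x ^ Suc (CARD('a) - 1) = x" by (simp only: power_Suc mult_1_right)
  moreover have "Suc (CARD('a) - 1) = CARD('a)" by (simp add: card_gt_0_iff)
  ultimately show ?thesis by (simp only:)
qed (simp add: power_0_left)

section \<open>Characteristic 3: Frobenius map and cube roots\<close>

locale field_char_3 =
  fixes F :: "'a::{finite,field} itself" and r :: nat
  assumes CARD: "CARD('a) = 3 ^ r" and r: "r \<ge> 1"
begin

text \<open>Translation by 1 permutes the field, so summing over it shows that q = 3^r vanishes in
  the field, and hence 3 does.\<close>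

lemma three_eq_0: "(3::'a) = 0"
proof -
  have "(\<Sum>x\<in>UNIV. x + 1) = (\<Sum>x\<in>UNIV. x::'a)"
    by (rule sum.reindex_bij_witness[of _ "\<lambda>x. x - 1" "\<lambda>x. x + 1"]) auto
  then have "of_nat CARD('a) = (0::'a)" by (simp add: sum.distrib)
  then have "(of_nat 3 :: 'a) ^ r = 0" unfolding CARD by simp
  then show ?thesis by simp
qed

lemma two_eq: "(2::'a) = - 1"
  using three_eq_0 by (simp add: eq_neg_iff_add_eq_0)

lemma triple: "x + x = - x" for x :: 'a
  using two_eq by (metis mult_2 mult_minus1)

lemma cube_add: "(x + y) ^ 3 = x ^ 3 + y ^ 3" for x y :: 'a
proof -
  have "(x + y) ^ 3 = x ^ 3 + y ^ 3 + 3 * (x\<^sup>2 * y + x * y\<^sup>2)"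
    by (simp add: power3_eq_cube power2_eq_square algebra_simps)
  then show ?thesis by (simp add: three_eq_0)
qed

lemma frobenius_add: "(x + y) ^ (3 ^ n) = x ^ (3 ^ n) + y ^ (3 ^ n)" for x y :: 'a
  by (induction n) (simp_all add: cube_add power_mult mult.commute[of 3])

lemma power_r: "x ^ (3 ^ r) = x" for x :: 'a
  using finite_field_power_CARD[of x] by (simp add: CARD)

lemma eps: "eps TYPE('a) = 3 ^ (r - 1)"
  using r by (cases r) (simp_all add: eps_def CARD)

text \<open>The inverse of the Frobenius map, since the cube of x^(3^(r-1)) is x^q = x; the exponent
  is the \<epsilon> of the construction.\<close>

definition cbrt :: "'a \<Rightarrow> 'a" where "cbrt x = x ^ (3 ^ (r - 1))"

lemma power_eps: "x ^ eps TYPE('a) = cbrt x" "x ^ (2 * eps TYPE('a)) = (cbrt x)\<^sup>2" for x :: 'a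
  by (simp_all only: eps cbrt_def mult.commute[of 2] power_mult)

lemma cbrt_cube: "cbrt (x ^ 3) = x" "cbrt x ^ 3 = x"
proof -
  obtain k where "r = Suc k" using r by (cases r) auto
  then show "cbrt (x ^ 3) = x" "cbrt x ^ 3 = x"
    using power_r[of x] unfolding cbrt_def power_mult[symmetric] by (simp_all add: mult.commute)
qed

lemma cbrt_simps:
  "cbrt (x + y) = cbrt x + cbrt y" "cbrt (x * y) = cbrt x * cbrt y" "cbrt 0 = 0" "cbrt 1 = 1"
  "cbrt (x / y) = cbrt x / cbrt y" "cbrt (x ^ n) = cbrt x ^ n" "cbrt (inverse x) = inverse (cbrt x)"
  by (simp_all add: cbrt_def frobenius_add power_mult_distrib power_divide power_inverse)
    (metis power_mult mult.commute)

lemma field_aut_frobenius: "field_aut (\<lambda>x::'a. x ^ (3 ^ n))"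
proof -
  have "inj (\<lambda>x::'a. x ^ (3 ^ n))"
  proof (rule injI)
    fix x y :: 'a assume "x ^ 3 ^ n = y ^ 3 ^ n"
    then have "(x - y) ^ 3 ^ n = 0" using frobenius_add[of "x - y" y n] by simp
    then show "x = y" by simp
  qed
  then have "bij (\<lambda>x::'a. x ^ (3 ^ n))" by (simp add: bij_def finite_UNIV_inj_surj)
  then show ?thesis by (simp add: field_aut_def frobenius_add power_mult_distrib)
qed

lemma field_aut_cbrt: "field_aut cbrt"
  unfolding cbrt_def[abs_def] by (rule field_aut_frobenius)

text \<open>The conjugates of a primitive element are the roots of a polynomial with coefficients in the
  prime field.\<close>

lemma field_aut_imp_frobenius:
  fixes s :: "'a \<Rightarrow> 'a"
  assumes s: "field_aut s"
  obtains n where "s = (\<lambda>x. x ^ (3 ^ n))"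
proof -
  obtain g :: 'a where g: "g \<noteq> 0" "\<And>x. x \<noteq> 0 \<Longrightarrow> \<exists>n::nat. x = g ^ n"
    using finite_field_primitive_element by blast
  define f where "f i = [:- (g ^ (3 ^ i)), 1:]" for i :: nat
  \<comment> \<open>The roots are the images of the primitive element g under the first r powers of
    the Frobenius map.\<close>
  define P where "P = (\<Prod>i<r. f i)"
  have aut: "field_aut (\<lambda>x::'a. x ^ 3)" using field_aut_frobenius[of 1] by simp
  have "map_poly (\<lambda>x. x ^ 3) P = (\<Prod>i<r. f (Suc i))"
    unfolding P_def field_aut_map_poly_prod[OF aut]
    by (simp add: f_def map_poly_pCons mult.commute[of 3] power_mult)
  \<comment> \<open>Cubing the coefficients shifts the factors by one place, and the sequence closes
    up because g^(3^r) = g.\<close>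
  also have "\<dots> = P"
  proof -
    have "f 0 * (\<Prod>i<r. f (Suc i)) = (\<Prod>i<r. f i) * f r"
      by (simp flip: prod.lessThan_Suc_shift)
    moreover have "f r = f 0" "f 0 \<noteq> 0" by (simp_all add: f_def power_r)
    ultimately show ?thesis by (metis P_def mult.commute mult_cancel_left)
  qed
  finally have "coeff P n ^ 3 = coeff P n" for n
    by (metis coeff_map_poly zero_power zero_less_numeral)
  then have "s (coeff P n) = coeff P n" for n
  proof -
    \<comment> \<open>X^3 - X = X (X - 1) (X + 1), so a coefficient fixed by cubing is 0, 1 or -1,
      and these are fixed by every automorphism.\<close>
    have "coeff P n * (coeff P n - 1) * (coeff P n + 1) = 0"
      using \<open>coeff P n ^ 3 = coeff P n\<close> by (simp add: algebra_simps power3_eq_cube)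
    then have "coeff P n \<in> {0, 1, - 1}" by (auto simp: eq_neg_iff_add_eq_0)
    then show ?thesis by (auto simp: field_aut_simps[OF s])
  qed
  then have "map_poly s P = P"
    by (intro poly_eqI) (simp add: coeff_map_poly field_aut_0[OF s])
  moreover have "poly P g = 0"
    unfolding P_def poly_prod using r by (intro prod_zero) (auto simp: f_def intro!: bexI[of _ 0])
  \<comment> \<open>An automorphism fixing the coefficients sends the root g to a root, and its
    value at the generator g determines it everywhere.\<close>
  ultimately have "poly P (s g) = 0"
    using field_aut_poly[OF s, of P g] by (simp add: field_aut_0[OF s])
  then obtain n where n: "s g = g ^ (3 ^ n)"
    unfolding P_def poly_prod by (auto simp: f_def prod_zero_iff)
  have "s x = x ^ (3 ^ n)" for x
  proof (cases "x = 0")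
    case False
    then obtain k where "x = g ^ k" using g by blast
    then show ?thesis
      by (metis field_aut_power[OF s] n mult.commute power_mult)
  qed (simp add: field_aut_0[OF s] power_0_left)
  then show ?thesis using that by blast
qed

end

section \<open>Groups acting on graphs\<close>

lemma (in group) conjugation_iso:
  assumes g: "g \<in> carrier G" and "K \<subseteq> carrier G"
  shows "(\<lambda>h. inv g \<otimes> h \<otimes> g) \<in> iso (G\<lparr>carrier := K\<rparr>) (G\<lparr>carrier := (\<lambda>h. inv g \<otimes> h \<otimes> g) ` K\<rparr>)"
proof -
  have "inj_on (\<lambda>h. inv g \<otimes> h \<otimes> g) K"
    by (rule inj_onI) (use assms in \<open>auto simp: subset_iff\<close>)
  moreover have "inv g \<otimes> (h \<otimes> k) \<otimes> g = inv g \<otimes> h \<otimes> g \<otimes> (inv g \<otimes> k \<otimes> g)"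
    if "h \<in> K" "k \<in> K" for h k
  proof -
    have "g \<otimes> (inv g \<otimes> (k \<otimes> g)) = k \<otimes> g"
      using that assms m_assoc[of g "inv g" "k \<otimes> g"] by (auto simp: subset_iff)
    then show ?thesis using that assms by (simp add: m_assoc subset_iff)
  qed
  ultimately show ?thesis
    by (auto simp: iso_def hom_def bij_betw_def)
qed

lemma (in group) conj_mem_iff:
  assumes g: "g \<in> carrier G" and "K \<subseteq> carrier G"
  shows "x \<in> (\<lambda>h. inv g \<otimes> h \<otimes> g) ` K \<longleftrightarrow> x \<in> carrier G \<and> g \<otimes> x \<otimes> inv g \<in> K"
proof
  assume "x \<in> (\<lambda>h. inv g \<otimes> h \<otimes> g) ` K"
  then obtain h where h: "h \<in> K" "x = inv g \<otimes> h \<otimes> g" by auto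
  then have "g \<otimes> x \<otimes> inv g = h"
    using assms by (simp add: subset_iff m_assoc) (simp flip: m_assoc)
  then show "x \<in> carrier G \<and> g \<otimes> x \<otimes> inv g \<in> K" using h assms by auto
next
  assume x: "x \<in> carrier G \<and> g \<otimes> x \<otimes> inv g \<in> K"
  then have "x = inv g \<otimes> (g \<otimes> x \<otimes> inv g) \<otimes> g"
    using assms by (simp add: m_assoc) (simp flip: m_assoc)
  then show "x \<in> (\<lambda>h. inv g \<otimes> h \<otimes> g) ` K" using x by blast
qed

text \<open>Since \<open>graph_Aut\<close> multiplies from left to right, \<open>\<phi>\<close> is a
  right action: in a product the left factor acts first. Translating a vertex by g therefore
  replaces its stabilizer by the conjugate under h \<mapsto>
  \<open>inv g \<otimes> h \<otimes> g\<close>.\<close>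

locale group_graph = group G for G (structure) +
  fixes \<Delta> :: "'v graph" and \<phi> :: "'a \<Rightarrow> 'v \<Rightarrow> 'v"
  assumes G_graph: "G_graph \<Delta> G \<phi>"
begin

lemma action_permutes: "g \<in> carrier G \<Longrightarrow> \<phi> g permutes verts \<Delta>"
  and action_edge: "g \<in> carrier G \<Longrightarrow> x \<in> verts \<Delta> \<Longrightarrow> y \<in> verts \<Delta> \<Longrightarrow>
    {\<phi> g x, \<phi> g y} \<in> edges \<Delta> \<longleftrightarrow> {x, y} \<in> edges \<Delta>"
  and action_mult: "g \<in> carrier G \<Longrightarrow> h \<in> carrier G \<Longrightarrow> \<phi> (g \<otimes> h) x = \<phi> h (\<phi> g x)"
  using G_graph unfolding G_graph_def hom_def by (auto simp: graph_Aut_def symm_group_def)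

lemma action_bij: "g \<in> carrier G \<Longrightarrow> bij (\<phi> g)"
  using action_permutes permutes_bij by blast

lemma action_one: "\<phi> \<one> x = x"
  using action_mult[of \<one> \<one> x] action_bij[of \<one>] by (auto simp: bij_def inj_eq)

lemma action_inv: "g \<in> carrier G \<Longrightarrow> \<phi> (inv g) (\<phi> g x) = x"
  "g \<in> carrier G \<Longrightarrow> \<phi> g (\<phi> (inv g) x) = x"
  by (simp_all flip: action_mult add: action_one)

lemma action_in_verts: "g \<in> carrier G \<Longrightarrow> \<phi> g x \<in> verts \<Delta> \<longleftrightarrow> x \<in> verts \<Delta>"
  using action_permutes permutes_in_image by metis

lemma edge_verts: "{x, y} \<in> edges \<Delta> \<Longrightarrow> x \<in> verts \<Delta> \<and> y \<in> verts \<Delta>"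
  using G_graph unfolding G_graph_def connected_graph_def by (metis doubleton_eq_iff)

lemma nbrs_action:
  assumes g: "g \<in> carrier G" and z: "z \<in> verts \<Delta>"
  shows "nbrs \<Delta> (\<phi> g z) = \<phi> g ` nbrs \<Delta> z"
proof (intro subset_antisym subsetI)
  fix w assume "w \<in> nbrs \<Delta> (\<phi> g z)"
  then have w: "{\<phi> g z, \<phi> g (\<phi> (inv g) w)} \<in> edges \<Delta>" "w \<in> verts \<Delta>"
    using edge_verts[of "\<phi> g z" w] g by (simp_all add: nbrs_def action_inv)
  then have "\<phi> (inv g) w \<in> verts \<Delta>" using g action_in_verts[of "inv g" w] by simp
  then have "\<phi> (inv g) w \<in> nbrs \<Delta> z"
    using action_edge[OF g z] w by (simp add: nbrs_def)
  then show "w \<in> \<phi> g ` nbrs \<Delta> z" using g by (metis action_inv(2) image_eqI)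
next
  fix w assume "w \<in> \<phi> g ` nbrs \<Delta> z"
  then obtain v where v: "w = \<phi> g v" "{z, v} \<in> edges \<Delta>" by (auto simp: nbrs_def)
  then show "w \<in> nbrs \<Delta> (\<phi> g z)"
    using edge_verts[OF v(2)] action_edge[OF g z, of v] by (simp add: nbrs_def)
qed

lemma card_nbrs_action: "g \<in> carrier G \<Longrightarrow> z \<in> verts \<Delta> \<Longrightarrow> card (nbrs \<Delta> (\<phi> g z)) = card (nbrs \<Delta> z)"
  by (simp add: nbrs_action card_image action_bij bij_is_inj inj_on_subset[OF _ subset_UNIV])

lemma stabilizer_subgroup: "subgroup (stabilizer G \<phi> z) G"
proof (rule subgroupI)
  show "stabilizer G \<phi> z \<noteq> {}" using action_one by (auto simp: stabilizer_def)
next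
  fix a assume "a \<in> stabilizer G \<phi> z"
  then show "inv a \<in> stabilizer G \<phi> z"
    using action_inv(1)[of a z] by (simp add: stabilizer_def)
qed (auto simp: stabilizer_def action_mult)

lemma local_kernel_subgroup: "subgroup (carrier (local_kernel \<Delta> G \<phi> z)) G"
proof (rule subgroupI)
  show "carrier (local_kernel \<Delta> G \<phi> z) \<noteq> {}"
    using action_one by (auto simp: stabilizer_def local_kernel_def)
next
  fix a assume a: "a \<in> carrier (local_kernel \<Delta> G \<phi> z)"
  then have "\<phi> (inv a) w = w" if "\<phi> a w = w" for w
    using that action_inv(1)[of a w] by (simp add: stabilizer_def local_kernel_def)
  then show "inv a \<in> carrier (local_kernel \<Delta> G \<phi> z)"
    using a by (simp add: stabilizer_def local_kernel_def)
qed (auto simp: stabilizer_def local_kernel_def action_mult)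

lemma stabilizer_action:
  assumes g: "g \<in> carrier G"
  shows "stabilizer G \<phi> (\<phi> g z) = (\<lambda>h. inv g \<otimes> h \<otimes> g) ` stabilizer G \<phi> z"
proof -
  have "\<phi> x (\<phi> g z) = \<phi> g z \<longleftrightarrow> \<phi> (g \<otimes> x \<otimes> inv g) z = z" if "x \<in> carrier G" for x
    using that g action_inv(1)[OF g, of z] action_inv(2)[OF g, of "\<phi> x (\<phi> g z)"]
    by (auto simp: action_mult)
  moreover have "stabilizer G \<phi> z \<subseteq> carrier G" by (auto simp: stabilizer_def)
  ultimately show ?thesis
    unfolding set_eq_iff by (simp only: conj_mem_iff[OF g]) (use g in \<open>auto simp: stabilizer_def\<close>)
qed

lemma local_kernel_action:
  assumes g: "g \<in> carrier G" and z: "z \<in> verts \<Delta>"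
  shows "carrier (local_kernel \<Delta> G \<phi> (\<phi> g z)) =
    (\<lambda>h. inv g \<otimes> h \<otimes> g) ` carrier (local_kernel \<Delta> G \<phi> z)"
proof -
  have *: "\<phi> x (\<phi> g w) = \<phi> g w \<longleftrightarrow> \<phi> (g \<otimes> x \<otimes> inv g) w = w" if "x \<in> carrier G" for x w
    using that g action_inv(1)[OF g, of w] action_inv(2)[OF g, of "\<phi> x (\<phi> g w)"]
    by (auto simp: action_mult)
  moreover have "carrier (local_kernel \<Delta> G \<phi> z) \<subseteq> carrier G"
    by (auto simp: local_kernel_def stabilizer_def)
  ultimately show ?thesis
    unfolding set_eq_iff by (simp only: conj_mem_iff[OF g])
      (use g z in \<open>auto simp: local_kernel_def stabilizer_def nbrs_action\<close>)
qed

lemma vstab_action: "g \<in> carrier G \<Longrightarrow> vstab G \<phi> (\<phi> g z) \<cong> vstab G \<phi> z"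
  unfolding vstab_def stabilizer_action
  by (intro group.iso_sym[OF subgroup.subgroup_is_group[OF stabilizer_subgroup is_group]]
      is_isoI[OF conjugation_iso] subgroup.subset[OF stabilizer_subgroup])

lemma local_action_mult:
  assumes "h \<in> stabilizer G \<phi> z" "k \<in> stabilizer G \<phi> z" "z \<in> verts \<Delta>"
  shows "(\<lambda>w. if w \<in> nbrs \<Delta> z then \<phi> k w else w) \<circ> (\<lambda>w. if w \<in> nbrs \<Delta> z then \<phi> h w else w)
    = (\<lambda>w. if w \<in> nbrs \<Delta> z then \<phi> (h \<otimes> k) w else w)"
proof -
  have hk: "h \<in> carrier G" "k \<in> carrier G" "\<phi> h z = z" using assms by (auto simp: stabilizer_def)
  have "\<phi> h ` nbrs \<Delta> z = nbrs \<Delta> z" using nbrs_action[of h z] hk assms by simp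
  then show ?thesis using hk by (auto simp: fun_eq_iff action_mult)
qed

text \<open>\<open>\<psi>\<close> encodes the permutation that a stabilizer element induces on the
  neighbours; two elements inducing the same one have the same code. The product in \<open>X\<close>
  is reversed because \<open>\<phi>\<close> is a right action and the codes compose as
  functions.\<close>

lemma local_group_isoI:
  assumes z: "z \<in> verts \<Delta>" and "group X" and img: "\<psi> ` stabilizer G \<phi> z = carrier X"
    and eq: "\<And>g h. g \<in> stabilizer G \<phi> z \<Longrightarrow> h \<in> stabilizer G \<phi> z \<Longrightarrow>
      (\<forall>w\<in>nbrs \<Delta> z. \<phi> g w = \<phi> h w) \<longleftrightarrow> \<psi> g = \<psi> h"
    and mult: "\<And>g h. g \<in> stabilizer G \<phi> z \<Longrightarrow> h \<in> stabilizer G \<phi> z \<Longrightarrow> \<psi> h \<otimes>\<^bsub>X\<^esub> \<psi> g = \<psi> (g \<otimes> h)"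
  shows "local_group \<Delta> G \<phi> z \<cong> X"
proof (rule is_iso_parametrized_anti[where P = "stabilizer G \<phi> z" and h = \<psi>])
  let ?f = "\<lambda>g w. if w \<in> nbrs \<Delta> z then \<phi> g w else w"
  show "?f ` stabilizer G \<phi> z = carrier (local_group \<Delta> G \<phi> z)" by (simp add: local_group_def)
  fix g h assume gh: "g \<in> stabilizer G \<phi> z" "h \<in> stabilizer G \<phi> z"
  have "?f g = ?f h \<longleftrightarrow> (\<forall>w\<in>nbrs \<Delta> z. \<phi> g w = \<phi> h w)" by (auto simp: fun_eq_iff)
  then show "?f g = ?f h \<longleftrightarrow> \<psi> g = \<psi> h" using eq[OF gh] by simp
  have "?f g \<otimes>\<^bsub>local_group \<Delta> G \<phi> z\<^esub> ?f h = ?f (g \<otimes> h)"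
    using local_action_mult[OF gh z] by (simp add: local_group_def symm_group_def)
  then show "\<exists>t\<in>stabilizer G \<phi> z. ?f g \<otimes>\<^bsub>local_group \<Delta> G \<phi> z\<^esub> ?f h = ?f t \<and> \<psi> h \<otimes>\<^bsub>X\<^esub> \<psi> g = \<psi> t"
    using mult[OF gh] subgroup.m_closed[OF stabilizer_subgroup gh] by blast
qed (use assms in auto)

lemma local_group_action:
  assumes g: "g \<in> carrier G" and z: "z \<in> verts \<Delta>"
  shows "local_group \<Delta> G \<phi> (\<phi> g z) \<cong> local_group \<Delta> G \<phi> z"
proof (rule is_iso_parametrized)
  let ?f = "\<lambda>z g w. if w \<in> nbrs \<Delta> z then \<phi> g w else w"
  let ?c = "\<lambda>h. inv g \<otimes> h \<otimes> g"
  have sc: "h \<in> carrier G" "\<phi> h z = z" if "h \<in> stabilizer G \<phi> z" for h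
    using that by (auto simp: stabilizer_def)
  show "?f z ` stabilizer G \<phi> z = carrier (local_group \<Delta> G \<phi> z)"
    by (simp add: local_group_def)
  show "(\<lambda>h. ?f (\<phi> g z) (?c h)) ` stabilizer G \<phi> z = carrier (local_group \<Delta> G \<phi> (\<phi> g z))"
    by (simp add: local_group_def stabilizer_action[OF g] image_image)
  fix h k assume hk: "h \<in> stabilizer G \<phi> z" "k \<in> stabilizer G \<phi> z"
  have c: "\<phi> (?c h) (\<phi> g w) = \<phi> g (\<phi> h w)" if "h \<in> stabilizer G \<phi> z" for h w
    using that g sc by (simp add: action_mult action_inv)
  have eq: "?f z h = ?f z k \<longleftrightarrow> (\<forall>w\<in>nbrs \<Delta> z. \<phi> h w = \<phi> k w)" for z h k
    by (auto simp: fun_eq_iff)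
  have "\<phi> g x = \<phi> g y \<longleftrightarrow> x = y" for x y
    using action_bij[OF g] by (auto simp: bij_def inj_eq)
  then show "?f (\<phi> g z) (?c h) = ?f (\<phi> g z) (?c k) \<longleftrightarrow> ?f z h = ?f z k"
    unfolding eq by (simp add: nbrs_action g z c hk)
  note mult = local_action_mult
  have "?c (h \<otimes> k) = ?c h \<otimes> ?c k"
    using conjugation_iso[OF g, of "carrier G"] sc hk by (auto simp: iso_def hom_def)
  moreover have "?c h \<in> stabilizer G \<phi> (\<phi> g z)" "?c k \<in> stabilizer G \<phi> (\<phi> g z)"
    using hk by (auto simp: stabilizer_action[OF g])
  moreover have "h \<otimes> k \<in> stabilizer G \<phi> z"
    using hk by (simp add: subgroup.m_closed[OF stabilizer_subgroup])
  ultimately show "\<exists>t\<in>stabilizer G \<phi> z.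
     ?f (\<phi> g z) (?c h) \<otimes>\<^bsub>local_group \<Delta> G \<phi> (\<phi> g z)\<^esub> ?f (\<phi> g z) (?c k) = ?f (\<phi> g z) (?c t) \<and>
     ?f z h \<otimes>\<^bsub>local_group \<Delta> G \<phi> z\<^esub> ?f z k = ?f z t"
    using mult[of h z k] mult[of "?c h" "\<phi> g z" "?c k"] hk z g action_in_verts
    by (intro bexI[of _ "h \<otimes> k"]) (simp_all only: local_group_def symm_group_def simp_thms
        partial_object.simps monoid.simps)
qed

text \<open>Conjugation by g carries stabilizer, local kernel and core at z to those at the
  translate, so the centralizer condition has to be verified only at one vertex of each
  orbit.\<close>

lemma local_characteristic_action:
  assumes g: "g \<in> carrier G" and z: "z \<in> verts \<Delta>"
    and "centralizer (vstab G \<phi> z) (p_core p (local_kernel \<Delta> G \<phi> z))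
      \<subseteq> p_core p (local_kernel \<Delta> G \<phi> z)"
  shows "centralizer (vstab G \<phi> (\<phi> g z)) (p_core p (local_kernel \<Delta> G \<phi> (\<phi> g z)))
      \<subseteq> p_core p (local_kernel \<Delta> G \<phi> (\<phi> g z))"
proof -
  let ?c = "\<lambda>h. inv g \<otimes> h \<otimes> g"
  have lk: "local_kernel \<Delta> G \<phi> z = G\<lparr>carrier := carrier (local_kernel \<Delta> G \<phi> z)\<rparr>" for z
    by (simp add: local_kernel_def)
  have grp: "group (local_kernel \<Delta> G \<phi> z)" for z
    using subgroup.subgroup_is_group[OF local_kernel_subgroup is_group] lk by metis
  have "?c \<in> iso (local_kernel \<Delta> G \<phi> z) (local_kernel \<Delta> G \<phi> (\<phi> g z))"
    using conjugation_iso[OF g subgroup.subset[OF local_kernel_subgroup]] lk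
    by (metis local_kernel_action[OF g z])
  then have core: "p_core p (local_kernel \<Delta> G \<phi> (\<phi> g z)) = ?c ` p_core p (local_kernel \<Delta> G \<phi> z)"
    using iso_p_core grp by blast
  have sub: "p_core p (local_kernel \<Delta> G \<phi> z) \<subseteq> carrier G"
  proof -
    have "p_core p (local_kernel \<Delta> G \<phi> z) \<subseteq> carrier (local_kernel \<Delta> G \<phi> z)"
      unfolding p_core_def
      by (rule group.generate_incl[OF grp]) (auto dest!: normal_imp_subgroup subgroup.subset)
    then show ?thesis using subgroup.subset[OF local_kernel_subgroup] by blast
  qed
  show ?thesis
  proof
    fix x assume "x \<in> centralizer (vstab G \<phi> (\<phi> g z)) (p_core p (local_kernel \<Delta> G \<phi> (\<phi> g z)))"
    then have x: "x \<in> stabilizer G \<phi> (\<phi> g z)"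
      "\<And>y. y \<in> p_core p (local_kernel \<Delta> G \<phi> z) \<Longrightarrow> x \<otimes> ?c y = ?c y \<otimes> x"
      unfolding core by (auto simp: centralizer_def vstab_def)
    then obtain y where y: "y \<in> stabilizer G \<phi> z" "x = ?c y" by (auto simp: stabilizer_action[OF g])
    have yc: "y \<in> carrier G" using y by (simp add: stabilizer_def)
    have "y \<otimes> u = u \<otimes> y" if u: "u \<in> p_core p (local_kernel \<Delta> G \<phi> z)" for u
    proof -
      have uc: "u \<in> carrier G" using u sub by blast
      have "?c (y \<otimes> u) = ?c (u \<otimes> y)"
        using x(2)[OF u] conjugation_iso[OF g, of "carrier G"] yc uc
        by (auto simp: iso_def hom_def y(2))
      then show ?thesis using g yc uc by simp
    qed
    then have "y \<in> p_core p (local_kernel \<Delta> G \<phi> z)"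
      using assms(3) y(1) by (auto simp: centralizer_def vstab_def)
    then show "x \<in> p_core p (local_kernel \<Delta> G \<phi> (\<phi> g z))" unfolding core y(2) by blast
  qed
qed

section \<open>Arcs under the group action\<close>

lemma s_arc_from_action:
  assumes g: "g \<in> carrier G" and xs: "s_arc_from \<Delta> s z xs"
  shows "s_arc_from \<Delta> s (\<phi> g z) (map (\<phi> g) xs)"
proof -
  have "xs ! i \<in> verts \<Delta>" if "i \<le> s" for i
    using xs that by (auto simp: s_arc_from_def subset_iff)
  moreover have "\<phi> g x = \<phi> g y \<longleftrightarrow> x = y" for x y
    using action_bij[OF g] by (auto simp: bij_def inj_eq)
  ultimately show ?thesis
    using xs g by (auto simp: s_arc_from_def action_in_verts action_edge)
qed

lemma transitive_on_s_arcs_from_action: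
  assumes g: "g \<in> carrier G" and tr: "transitive_on_s_arcs_from \<Delta> G \<phi> s z"
  shows "transitive_on_s_arcs_from \<Delta> G \<phi> s (\<phi> g z)"
  unfolding transitive_on_s_arcs_from_def
proof (intro allI impI)
  fix xs ys assume a: "s_arc_from \<Delta> s (\<phi> g z) xs \<and> s_arc_from \<Delta> s (\<phi> g z) ys"
  let ?xs = "map (\<phi> (inv g)) xs" and ?ys = "map (\<phi> (inv g)) ys"
  have "s_arc_from \<Delta> s z ?xs" "s_arc_from \<Delta> s z ?ys"
    using s_arc_from_action[of "inv g" s "\<phi> g z"] a g by (auto simp: action_inv)
  then obtain h where h: "h \<in> stabilizer G \<phi> z" "map (\<phi> h) ?xs = ?ys"
    using tr unfolding transitive_on_s_arcs_from_def by blast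
  have "h \<in> carrier G" using h by (simp add: stabilizer_def)
  moreover have "map (\<phi> g) (map (\<phi> h) ?xs) = map (\<phi> g) ?ys" unfolding h(2) ..
  ultimately have "map (\<phi> (inv g \<otimes> h \<otimes> g)) xs = ys"
    using g by (simp add: comp_def action_inv cong: map_cong) (simp add: action_mult)
  then show "\<exists>h\<in>stabilizer G \<phi> (\<phi> g z). map (\<phi> h) xs = ys"
    using h(1) unfolding stabilizer_action[OF g] by blast
qed

text \<open>Any arc is brought onto the fixed walk x one vertex at a time: the element used at stage
  i fixes what is already in place. The premise on the predecessor excludes turning back; its guard
  is needed because i - 1 is 0 for i = 0.\<close>

lemma transitive_on_s_arcs_fromI:
  assumes "t \<le> s"
    and step: "\<And>i w. i < s \<Longrightarrow> w \<in> nbrs \<Delta> (x i) \<Longrightarrow> (0 < i \<Longrightarrow> w \<noteq> x (i - 1)) \<Longrightarrow>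
      \<exists>g\<in>carrier G. (\<forall>j\<le>i. \<phi> g (x j) = x j) \<and> \<phi> g w = x (Suc i)"
  shows "transitive_on_s_arcs_from \<Delta> G \<phi> t (x 0)"
proof -
  have *: "\<exists>g\<in>carrier G. \<forall>j\<le>t. \<phi> g (ys ! j) = x j" if ys: "s_arc_from \<Delta> t (x 0) ys" for ys
  proof -
    have "i \<le> t \<Longrightarrow> \<exists>g\<in>carrier G. \<forall>j\<le>i. \<phi> g (ys ! j) = x j" for i
    proof (induction i)
      case 0
      show ?case using ys by (intro bexI[of _ \<one>]) (auto simp: s_arc_from_def action_one)
    next
      case (Suc i)
      then obtain g where g: "g \<in> carrier G" "\<And>j. j \<le> i \<Longrightarrow> \<phi> g (ys ! j) = x j" by auto
      have e: "{ys ! i, ys ! Suc i} \<in> edges \<Delta>" using ys Suc.prems by (auto simp: s_arc_from_def)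
      then have "\<phi> g (ys ! Suc i) \<in> nbrs \<Delta> (x i)"
        using action_edge[OF g(1), of "ys ! i" "ys ! Suc i"] edge_verts[OF e] g(2)[of i]
        by (simp add: nbrs_def)
      moreover have "\<phi> g (ys ! Suc i) \<noteq> x (i - 1)" if "0 < i"
      proof -
        have "ys ! (i - 1) \<noteq> ys ! Suc i"
          using ys Suc.prems that by (auto simp: s_arc_from_def)
        then show ?thesis
          using g(2)[of "i - 1"] action_bij[OF g(1)] by (metis bij_def diff_le_self injD)
      qed
      ultimately obtain h where h: "h \<in> carrier G" "\<And>j. j \<le> i \<Longrightarrow> \<phi> h (x j) = x j"
        "\<phi> h (\<phi> g (ys ! Suc i)) = x (Suc i)"
        using step[of i] Suc.prems \<open>t \<le> s\<close> by force
      have "\<phi> (g \<otimes> h) (ys ! j) = x j" if "j \<le> Suc i" for j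
        using that g h by (cases "j = Suc i") (auto simp: action_mult le_Suc_eq)
      then show ?case using g(1) h(1) by (intro bexI[of _ "g \<otimes> h"]) auto
    qed
    then show ?thesis by blast
  qed
  show ?thesis
    unfolding transitive_on_s_arcs_from_def
  proof (intro allI impI)
    fix ys zs assume a: "s_arc_from \<Delta> t (x 0) ys \<and> s_arc_from \<Delta> t (x 0) zs"
    obtain g h where g: "g \<in> carrier G" "\<And>j. j \<le> t \<Longrightarrow> \<phi> g (ys ! j) = x j"
      and h: "h \<in> carrier G" "\<And>j. j \<le> t \<Longrightarrow> \<phi> h (zs ! j) = x j"
      using * a by meson
    have len: "length ys = t + 1" "length zs = t + 1" "ys ! 0 = x 0" "zs ! 0 = x 0"
      using a by (auto simp: s_arc_from_def)
    \<comment> \<open>One arc is moved onto the standard walk, then the normalization of the other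
      arc is undone.\<close>
    have gh: "\<phi> (g \<otimes> inv h) (ys ! j) = zs ! j" if "j \<le> t" for j
      using g h(1) h(2)[symmetric] that by (simp add: action_mult action_inv)
    then have "map (\<phi> (g \<otimes> inv h)) ys = zs"
      using len by (intro nth_equalityI) auto
    moreover have "g \<otimes> inv h \<in> stabilizer G \<phi> (x 0)"
      using gh[of 0] len g h by (auto simp: stabilizer_def)
    ultimately show "\<exists>g\<in>stabilizer G \<phi> (x 0). map (\<phi> g) ys = zs" by blast
  qed
qed

end

section \<open>Coset graphs\<close>

text \<open>Stated for an arbitrary pair of subgroups because the construction is symmetric in them:
  facts about the second type of vertex follow from those about the first by exchanging
  \<open>H\<close> and \<open>K\<close>.\<close>

definition coset_graph_on :: "('g, 'm) monoid_scheme \<Rightarrow> 'g set \<Rightarrow> 'g set \<Rightarrow> 'g set graph"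
  where "coset_graph_on G H K =
    \<lparr>verts = rcosets\<^bsub>G\<^esub> H \<union> rcosets\<^bsub>G\<^esub> K,
     edges = {{X, Y} | X Y. X \<in> rcosets\<^bsub>G\<^esub> H \<and> Y \<in> rcosets\<^bsub>G\<^esub> K \<and> X \<inter> Y \<noteq> {}}\<rparr>"

definition coset_action :: "('g, 'm) monoid_scheme \<Rightarrow> 'g set \<Rightarrow> 'g set \<Rightarrow> 'g \<Rightarrow> 'g set \<Rightarrow> 'g set"
  where "coset_action G H K g X =
    (if X \<in> verts (coset_graph_on G H K) then X #>\<^bsub>G\<^esub> g else X)"

lemma coset_graph_on_swap: "coset_graph_on G H K = coset_graph_on G K H"
proof -
  have "{{X, Y} | X Y. X \<in> A \<and> Y \<in> B \<and> X \<inter> Y \<noteq> {}} \<subseteq> {{X, Y} | X Y. X \<in> B \<and> Y \<in> A \<and> X \<inter> Y \<noteq> {}}"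
    for A B :: "'a set set"
  proof
    fix e assume "e \<in> {{X, Y} | X Y. X \<in> A \<and> Y \<in> B \<and> X \<inter> Y \<noteq> {}}"
    then obtain X Y where "X \<in> A" "Y \<in> B" "X \<inter> Y \<noteq> {}" "e = {X, Y}" by blast
    then have "Y \<in> B" "X \<in> A" "Y \<inter> X \<noteq> {}" "e = {Y, X}" by auto
    then show "e \<in> {{X, Y} | X Y. X \<in> B \<and> Y \<in> A \<and> X \<inter> Y \<noteq> {}}" by blast
  qed
  then show ?thesis unfolding coset_graph_on_def by (simp add: Un_commute subset_antisym)
qed

lemma coset_action_swap: "coset_action G H K = coset_action G K H"
  unfolding coset_action_def[abs_def] coset_graph_on_swap[of G H K] ..

text \<open>\<open>gen\<close> yields connectedness, \<open>core_free\<close> faithfulness of the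
  action on cosets, and \<open>HK\<close> keeps the two types of vertices apart.\<close>

locale coset_pair = group G for G (structure) +
  fixes H K :: "'a set"
  assumes H: "subgroup H G" and K: "subgroup K G" and fin: "finite (carrier G)"
    and HK: "H \<noteq> K" and gen: "generate G (H \<union> K) = carrier G"
    and core_free: "\<And>g. g \<in> carrier G \<Longrightarrow>
      (\<And>a. a \<in> carrier G \<Longrightarrow> H #> (a \<otimes> g) = H #> a) \<Longrightarrow>
      (\<And>a. a \<in> carrier G \<Longrightarrow> K #> (a \<otimes> g) = K #> a) \<Longrightarrow> g = \<one>"
begin

abbreviation \<Gamma> where "\<Gamma> \<equiv> coset_graph_on G H K"
abbreviation \<rho> where "\<rho> \<equiv> coset_action G H K"

lemma swap: "coset_pair G K H"
proof unfold_locales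
  show "generate G (K \<union> H) = carrier G" using gen by (simp add: Un_commute)
  show "g = \<one>" if "g \<in> carrier G" "\<And>a. a \<in> carrier G \<Longrightarrow> K #> (a \<otimes> g) = K #> a"
      "\<And>a. a \<in> carrier G \<Longrightarrow> H #> (a \<otimes> g) = H #> a" for g
    by (rule core_free) fact+
  show "K \<noteq> H" using HK by simp
qed (use H K fin in \<open>auto simp: subgroup_def\<close>)

lemma verts: "verts \<Gamma> = (#>) H ` carrier G \<union> (#>) K ` carrier G"
  by (auto simp: coset_graph_on_def RCOSETS_def)

lemma coset_in_verts: "a \<in> carrier G \<Longrightarrow> H #> a \<in> verts \<Gamma>" "a \<in> carrier G \<Longrightarrow> K #> a \<in> verts \<Gamma>"
  by (auto simp: verts)

lemma action_coset: "a \<in> carrier G \<Longrightarrow> g \<in> carrier G \<Longrightarrow> \<rho> g (H #> a) = H #> (a \<otimes> g)"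
    "a \<in> carrier G \<Longrightarrow> g \<in> carrier G \<Longrightarrow> \<rho> g (K #> a) = K #> (a \<otimes> g)"
  using subgroup.subset[OF H] subgroup.subset[OF K]
  by (simp_all add: coset_action_def coset_in_verts coset_mult_assoc)

lemma coset_eq_iff:
  assumes "a \<in> carrier G" "b \<in> carrier G" "subgroup L G"
  shows "L #> a = L #> b \<longleftrightarrow> a \<otimes> inv b \<in> L"
proof -
  have iff: "a \<in> L #> b \<longleftrightarrow> a \<otimes> inv b \<in> L"
    using subgroup.rcos_module[OF assms(3) is_group assms(2,1)] .
  show ?thesis
  proof
    assume "L #> a = L #> b"
    then show "a \<otimes> inv b \<in> L" using rcos_self[OF assms(1,3)] iff by simp
  next
    assume "a \<otimes> inv b \<in> L"
    then show "L #> a = L #> b" using iff repr_independence[OF _ assms(2,3)] by simp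
  qed
qed

text \<open>Two cosets that meet can both be written with a common element as representative; so
  every edge is a translate of the base edge.\<close>

lemma edges: "edges \<Gamma> = (\<lambda>a. {H #> a, K #> a}) ` carrier G"
proof (intro subset_antisym subsetI)
  fix e assume "e \<in> edges \<Gamma>"
  then obtain X Y where "X \<in> rcosets H" "Y \<in> rcosets K" and e: "e = {X, Y}" "X \<inter> Y \<noteq> {}"
    unfolding coset_graph_on_def by auto
  then obtain a b where ab: "a \<in> carrier G" "b \<in> carrier G" "X = H #> a" "Y = K #> b"
    unfolding RCOSETS_def by auto
  obtain x where x: "x \<in> H #> a" "x \<in> K #> b" using e ab by blast
  have "x \<in> carrier G"
    using x(1) r_coset_subset_G[OF subgroup.subset[OF H] ab(1)] by blast
  moreover have "e = {H #> x, K #> x}"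
    using e ab repr_independence[OF x(1) ab(1) H] repr_independence[OF x(2) ab(2) K] by simp
  ultimately show "e \<in> (\<lambda>a. {H #> a, K #> a}) ` carrier G" by (rule rev_image_eqI)
next
  fix e assume "e \<in> (\<lambda>a. {H #> a, K #> a}) ` carrier G"
  then obtain a where a: "a \<in> carrier G" "e = {H #> a, K #> a}" by auto
  have "H #> a \<in> rcosets H" "K #> a \<in> rcosets K"
    using a by (auto simp: RCOSETS_def)
  moreover have "(H #> a) \<inter> (K #> a) \<noteq> {}"
    using rcos_self[OF a(1) H] rcos_self[OF a(1) K] by blast
  ultimately show "e \<in> edges \<Gamma>"
    unfolding coset_graph_on_def using a(2) by auto
qed

text \<open>A common coset of \<open>H\<close> and \<open>K\<close> has the same representative for
  both, and translating it back gives \<open>H = K\<close>.\<close>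

lemma cosets_distinct:
  assumes a: "a \<in> carrier G" and b: "b \<in> carrier G"
  shows "H #> a \<noteq> K #> b"
proof
  assume eq: "H #> a = K #> b"
  then have "a \<in> K #> b" using rcos_self[OF a H] by simp
  then have "H #> a = K #> a" using eq repr_independence[OF _ b K] by simp
  then have "H #> a #> inv a = K #> a #> inv a" by simp
  then have "H = K"
    using a coset_mult_assoc[OF subgroup.subset[OF H] a inv_closed[OF a]]
      coset_mult_assoc[OF subgroup.subset[OF K] a inv_closed[OF a]]
    by (simp add: coset_mult_one subgroup.subset[OF H] subgroup.subset[OF K])
  then show False using HK by simp
qed

lemma nbrs_H:
  assumes a: "a \<in> carrier G"
  shows "nbrs \<Gamma> (H #> a) = (\<lambda>h. K #> (h \<otimes> a)) ` H"
proof (intro subset_antisym subsetI)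
  fix w assume "w \<in> nbrs \<Gamma> (H #> a)"
  then obtain b where b: "b \<in> carrier G" "{H #> a, w} = {H #> b, K #> b}"
    unfolding nbrs_def edges by blast
  then have *: "H #> a = H #> b" "w = K #> b"
    using cosets_distinct[OF a b(1)] by (auto simp: doubleton_eq_iff)
  then have "b \<otimes> inv a \<in> H" using coset_eq_iff[OF b(1) a H] by simp
  moreover have "b \<otimes> inv a \<otimes> a = b" using a b by (simp add: m_assoc)
  then have "w = K #> (b \<otimes> inv a \<otimes> a)" using * by simp
  ultimately show "w \<in> (\<lambda>h. K #> (h \<otimes> a)) ` H" by (rule rev_image_eqI)
next
  fix w assume "w \<in> (\<lambda>h. K #> (h \<otimes> a)) ` H"
  then obtain h where h: "h \<in> H" "w = K #> (h \<otimes> a)" by auto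
  moreover have hc: "h \<in> carrier G" using h subgroup.subset[OF H] by blast
  moreover have "H #> (h \<otimes> a) = H #> a"
    using coset_eq_iff[OF m_closed[OF hc a] a H] h hc a by (simp add: m_assoc)
  ultimately have "{H #> a, w} = {H #> (h \<otimes> a), K #> (h \<otimes> a)}" by simp
  then show "w \<in> nbrs \<Gamma> (H #> a)"
    using m_closed[OF hc a] unfolding nbrs_def edges mem_Collect_eq by (rule image_eqI)
qed

lemma action_comp:
  "g \<in> carrier G \<Longrightarrow> h \<in> carrier G \<Longrightarrow> \<rho> (g \<otimes> h) = \<rho> h \<circ> \<rho> g"
proof
  fix X assume gh: "g \<in> carrier G" "h \<in> carrier G"
  show "\<rho> (g \<otimes> h) X = (\<rho> h \<circ> \<rho> g) X"
  proof (cases "X \<in> verts \<Gamma>")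
    case True
    then show ?thesis using gh by (auto simp: verts action_coset m_assoc)
  qed (simp add: coset_action_def)
qed

lemma action_id: "\<rho> \<one> = id"
proof
  fix X
  show "\<rho> \<one> X = id X"
  proof (cases "X \<in> verts \<Gamma>")
    case True
    then show ?thesis by (auto simp: verts action_coset)
  qed (simp add: coset_action_def)
qed

lemma action_permutes_verts:
  assumes g: "g \<in> carrier G"
  shows "\<rho> g permutes verts \<Gamma>"
proof (rule bij_imp_permutes)
  show "bij_betw (\<rho> g) (verts \<Gamma>) (verts \<Gamma>)"
  proof (rule bij_betw_byWitness[where f' = "\<rho> (inv g)"])
    have inv: "\<rho> g (\<rho> (inv g) X) = X" "\<rho> (inv g) (\<rho> g X) = X" for X
      using action_comp[of g "inv g"] action_comp[of "inv g" g] g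
      by (auto simp: action_id fun_eq_iff)
    show "\<forall>X\<in>verts \<Gamma>. \<rho> (inv g) (\<rho> g X) = X" "\<forall>X\<in>verts \<Gamma>. \<rho> g (\<rho> (inv g) X) = X"
      by (simp_all add: inv)
    show "\<rho> g ` verts \<Gamma> \<subseteq> verts \<Gamma>" "\<rho> (inv g) ` verts \<Gamma> \<subseteq> verts \<Gamma>"
      using g by (auto simp: verts action_coset)
  qed
qed (simp add: coset_action_def)

lemma action_edges:
  assumes g: "g \<in> carrier G" and e: "{X, Y} \<in> edges \<Gamma>"
  shows "{\<rho> g X, \<rho> g Y} \<in> edges \<Gamma>"
proof -
  obtain a where a: "a \<in> carrier G" "{X, Y} = {H #> a, K #> a}" using e by (auto simp: edges)
  then have "{\<rho> g X, \<rho> g Y} = {H #> (a \<otimes> g), K #> (a \<otimes> g)}"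
    using g by (auto simp: doubleton_eq_iff action_coset)
  then show ?thesis using a g by (auto simp: edges)
qed

lemma connected: "connected_graph \<Gamma>"
proof -
  define R where "R = {(X, Y). {X, Y} \<in> edges \<Gamma>}"
  have "sym R" by (simp add: sym_def R_def insert_commute)
  then have sym: "sym (R\<^sup>*)" by (rule sym_rtrancl)
  have act: "(\<rho> g X, \<rho> g Y) \<in> R\<^sup>*" if "(X, Y) \<in> R\<^sup>*" "g \<in> carrier G" for X Y g
    using that(1)
  proof induction
    case (step Y Z)
    then have "(\<rho> g Y, \<rho> g Z) \<in> R" using action_edges[OF that(2)] by (simp add: R_def)
    with step.IH show ?case by (rule rtrancl_into_rtrancl)
  qed simp
  have adj: "(H #> a, K #> a) \<in> R" "(K #> a, H #> a) \<in> R" if "a \<in> carrier G" for a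
    using imageI[OF that, of "\<lambda>a. {H #> a, K #> a}"] unfolding R_def edges
    by (simp_all add: insert_commute)
  have base: "K #> \<one> = K" "H #> \<one> = H"
    using coset_mult_one subgroup.subset H K by blast+
  have gen_step: "(H, H #> h) \<in> R\<^sup>*" if h: "h \<in> H \<union> K" for h
  proof (cases "h \<in> H")
    case True
    then show ?thesis using H by (simp add: coset_join2 subgroup.mem_carrier)
  next
    case False
    then have h: "h \<in> K" "h \<in> carrier G" using h subgroup.subset[OF K] by auto
    have "K #> h = K" using coset_join2[OF h(2) K h(1)] .
    then have "(H, K) \<in> R" "(K, H #> h) \<in> R"
      using adj(1)[OF one_closed] adj(2)[OF h(2)] by (simp_all only: base)
    then show ?thesis by (rule converse_rtrancl_into_rtrancl[OF _ r_into_rtrancl])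
  qed
  have reach: "(H, H #> g) \<in> R\<^sup>*" if "g \<in> carrier G" for g
    using that unfolding gen[symmetric]
  proof (induction rule: generate.induct)
    case one
    then show ?case by (simp only: base rtrancl.rtrancl_refl)
  next
    case (inv h)
    then have "inv h \<in> H \<union> K"
      using subgroup.m_inv_closed[OF H] subgroup.m_inv_closed[OF K] by blast
    then show ?case by (rule gen_step)
  next
    case (eng h1 h2)
    then have c: "h1 \<in> carrier G" "h2 \<in> carrier G" by (simp_all add: gen)
    have "\<rho> h2 H = H #> h2" "\<rho> h2 (H #> h1) = H #> (h1 \<otimes> h2)"
      using action_coset(1)[OF one_closed c(2)] action_coset(1)[OF c] c by (simp_all add: base)
    \<comment> \<open>The walk that reaches \<open>H #> h1\<close> is translated by
      \<open>h2\<close> and attached to the walk that reaches \<open>H #> h2\<close>.\<close>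
    then have "(H #> h2, H #> (h1 \<otimes> h2)) \<in> R\<^sup>*" using act[OF eng.IH(1) c(2)] by simp
    with eng.IH(2) show ?case by (rule rtrancl_trans)
  qed (rule gen_step)
  have reach': "(H, X) \<in> R\<^sup>*" if X: "X \<in> verts \<Gamma>" for X
  proof -
    obtain a where a: "a \<in> carrier G" "X = H #> a \<or> X = K #> a" using X by (auto simp: verts)
    then show ?thesis
      using reach[OF a(1)] rtrancl_into_rtrancl[OF reach[OF a(1)] adj(1)[OF a(1)]] by blast
  qed
  have "(X, Y) \<in> R\<^sup>*" if "X \<in> verts \<Gamma>" "Y \<in> verts \<Gamma>" for X Y
    using symD[OF sym reach'[OF that(1)]] reach'[OF that(2)] by (rule rtrancl_trans)
  moreover have "\<exists>x\<in>verts \<Gamma>. \<exists>y\<in>verts \<Gamma>. x \<noteq> y \<and> e = {x, y}" if e: "e \<in> edges \<Gamma>" for e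
  proof -
    obtain a where a: "a \<in> carrier G" "e = {H #> a, K #> a}" using e by (auto simp: edges)
    then show ?thesis
      using cosets_distinct[OF a(1,1)] coset_in_verts[OF a(1)] by blast
  qed
  moreover have "finite (verts \<Gamma>)" using fin by (simp add: verts)
  moreover have "verts \<Gamma> \<noteq> {}" using coset_in_verts[OF one_closed] by blast
  ultimately show ?thesis unfolding connected_graph_def R_def by simp
qed

lemma G_graph_coset: "G_graph \<Gamma> G \<rho>"
  unfolding G_graph_def
proof (intro conjI)
  show "\<rho> \<in> hom G (graph_Aut \<Gamma>)"
  proof (rule homI)
    fix g assume g: "g \<in> carrier G"
    have "{\<rho> g X, \<rho> g Y} \<in> edges \<Gamma> \<longleftrightarrow> {X, Y} \<in> edges \<Gamma>" for X Y
    proof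
      assume "{\<rho> g X, \<rho> g Y} \<in> edges \<Gamma>"
      then have "{(\<rho> (inv g) \<circ> \<rho> g) X, (\<rho> (inv g) \<circ> \<rho> g) Y} \<in> edges \<Gamma>"
        using action_edges g by fastforce
      then show "{X, Y} \<in> edges \<Gamma>" using g by (simp add: action_id flip: action_comp)
    qed (rule action_edges[OF g])
    then show "\<rho> g \<in> carrier (graph_Aut \<Gamma>)"
      using action_permutes_verts g by (auto simp: graph_Aut_def)
  qed (simp add: graph_Aut_def symm_group_def action_comp)
  show "inj_on \<rho> (carrier G)"
  proof (rule inj_onI)
    fix g h assume gh: "g \<in> carrier G" "h \<in> carrier G" "\<rho> g = \<rho> h"
    have "\<rho> (g \<otimes> inv h) = id"
      using gh action_comp[of h "inv h"] by (simp add: action_comp action_id)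
    then have "H #> (a \<otimes> (g \<otimes> inv h)) = H #> a" "K #> (a \<otimes> (g \<otimes> inv h)) = K #> a"
      if "a \<in> carrier G" for a
      using action_coset[of a "g \<otimes> inv h"] that gh by simp_all
    then have "g \<otimes> inv h = \<one>" using core_free gh by auto
    then show "g = h" using gh by (metis inv_closed inv_inv inv_equality)
  qed
qed (use connected in auto)

sublocale group_graph G \<Gamma> \<rho>
  by unfold_locales (rule G_graph_coset)

lemma base_cosets: "H #> \<one> = H" "K #> \<one> = K"
  using coset_mult_one subgroup.subset H K by blast+

lemma base_verts: "H \<in> verts \<Gamma>" "K \<in> verts \<Gamma>"
  using coset_in_verts[of \<one>] by (simp_all add: base_cosets)

lemma action_base: "g \<in> carrier G \<Longrightarrow> \<rho> g H = H #> g" "g \<in> carrier G \<Longrightarrow> \<rho> g K = K #> g"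
  using base_verts by (simp_all add: coset_action_def)

lemma stabilizer_H: "stabilizer G \<rho> H = H"
  using coset_join1[OF _ _ H] coset_join2[OF _ H] subgroup.subset[OF H]
  by (auto simp: stabilizer_def action_base)

lemma nbrs_base_H: "nbrs \<Gamma> H = (#>) K ` H"
  using nbrs_H[of \<one>] subgroup.subset[OF H] by (auto simp: base_cosets subset_iff image_iff)

lemma local_kernel_H:
  "carrier (local_kernel \<Gamma> G \<rho> H) = {g \<in> H. \<forall>h\<in>H. K #> (h \<otimes> g) = K #> h}"
  using subgroup.subset[OF H]
  by (auto simp: local_kernel_def stabilizer_H nbrs_base_H action_coset subset_iff)

lemma stabilizer_K: "stabilizer G \<rho> K = K"
  and nbrs_base_K: "nbrs \<Gamma> K = (#>) H ` K"
  and local_kernel_K: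
    "carrier (local_kernel \<Gamma> G \<rho> K) = {g \<in> K. \<forall>h\<in>K. H #> (h \<otimes> g) = H #> h}"
  using coset_pair.stabilizer_H[OF swap] coset_pair.nbrs_base_H[OF swap]
    coset_pair.local_kernel_H[OF swap]
  by (simp_all add: coset_graph_on_swap[of G K H] coset_action_swap[of G K H])

lemma vert_cases:
  assumes "X \<in> verts \<Gamma>"
  obtains g where "g \<in> carrier G" "X = \<rho> g H" | g where "g \<in> carrier G" "X = \<rho> g K"
  using assms by (auto simp: verts action_base)

lemma edge_cases:
  assumes "e \<in> edges \<Gamma>"
  obtains g where "g \<in> carrier G" "e = {\<rho> g H, \<rho> g K}"
  using assms by (auto simp: edges action_base)

end

section \<open>Normal forms of the elements of \<open>G\<^sub>1\<close> and \<open>G\<^sub>2\<close>\<close>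

context field_char_3
begin

lemma field_aut_cbrt_commute: "field_aut s \<Longrightarrow> s (cbrt x) = cbrt (s x)"
  by (simp add: cbrt_def field_aut_power)

lemma cbrt_eq_0: "cbrt x = 0 \<longleftrightarrow> x = 0"
  using field_aut_eq_0[OF field_aut_cbrt] by simp

lemma cbrt_uminus: "cbrt (- x) = - cbrt x"
  using field_aut_uminus[OF field_aut_cbrt] .

lemma field_aut_surjE:
  assumes "field_aut s" obtains y :: 'a where "s y = x"
  using assms by (metis bij_pointE field_aut_def)

text \<open>The shape of the elements of G1: first the field automorphism, then the matrix with rows
  (x, y), (z, w) on the first two coordinates, then a translation. The factor on c extends
  (\<lambda>\<mu>)^(2\<epsilon>) from diagonal matrices to all of them through the
  determinant.\<close>

definition smap :: "('a \<Rightarrow> 'a) \<Rightarrow> 'a \<Rightarrow> 'a \<Rightarrow> 'a \<Rightarrow> 'a \<Rightarrow> 'a \<Rightarrow> 'a \<Rightarrow> 'a \<Rightarrow> 'a perm" where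
  "smap s x y z w u v t = (\<lambda>(a, b, c).
    (x * s a + y * s b + u, z * s a + w * s b + v, (cbrt (x * w - y * z))\<^sup>2 * s c + t))"

text \<open>The shape of the elements of G2: first the field automorphism, then \<tau>_d, then the
  upper triangular matrix with diagonal l, m and corner e, then a translation.\<close>

definition bmap :: "('a \<Rightarrow> 'a) \<Rightarrow> 'a \<Rightarrow> 'a \<Rightarrow> 'a \<Rightarrow> 'a \<Rightarrow> 'a \<Rightarrow> 'a \<Rightarrow> 'a \<Rightarrow> 'a perm" where
  "bmap s l m e d u v t = (\<lambda>(a, b, c).
    (l * s a + e * s b + l * (d * (s b)\<^sup>2 + cbrt d * s c) + u, m * s b + v,
     (cbrt (l * m))\<^sup>2 * s c + t))"

lemma bmap_eq_smap: "bmap s l m e 0 u v t = smap s l e 0 m u v t"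
  by (simp add: bmap_def smap_def cbrt_simps)

lemma smap_comp:
  assumes s': "field_aut s'"
  shows "smap s' x' y' z' w' u' v' t' \<circ> smap s x y z w u v t =
    smap (\<lambda>a. s' (s a)) (x' * s' x + y' * s' z) (x' * s' y + y' * s' w)
      (z' * s' x + w' * s' z) (z' * s' y + w' * s' w)
      (x' * s' u + y' * s' v + u') (z' * s' u + w' * s' v + v')
      ((cbrt (x' * w' - y' * z'))\<^sup>2 * s' t + t')"
proof -
  \<comment> \<open>The matrix of the composite is the product of the outer matrix with the
    \<open>s'\<close>-image of the inner one, so determinants multiply up to
    \<open>s'\<close>.\<close>
  have "(x' * s' x + y' * s' z) * (z' * s' y + w' * s' w)
      - (x' * s' y + y' * s' w) * (z' * s' x + w' * s' z) = (x' * w' - y' * z') * s' (x * w - y * z)"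
    by (simp add: field_aut_simps[OF s'] algebra_simps)
  then have c: "(cbrt ((x' * s' x + y' * s' z) * (z' * s' y + w' * s' w)
      - (x' * s' y + y' * s' w) * (z' * s' x + w' * s' z)))\<^sup>2
      = (cbrt (x' * w' - y' * z'))\<^sup>2 * s' ((cbrt (x * w - y * z))\<^sup>2)"
    by (simp only: cbrt_simps(2) power_mult_distrib field_aut_power[OF s'] field_aut_cbrt_commute[OF s'])
  show ?thesis
    unfolding smap_def c
    by (rule ext) (auto simp: field_aut_add[OF s'] field_aut_mult[OF s'] algebra_simps)
qed

text \<open>The outer quadratic term meets the shifted coordinate m b + v; its cross term is linear
  in b and enters the corner e with a minus sign, since 2 = -1. The outer d' becomes d' m^2 / l when
  it is moved inside the scaling by l.\<close>

lemma bmap_comp: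
  assumes s': "field_aut s'" and l: "l \<noteq> 0"
  shows "bmap s' l' m' e' d' u' v' t' \<circ> bmap s l m e d u v t =
    bmap (\<lambda>a. s' (s a)) (l' * s' l) (m' * s' m) (l' * s' e + e' * s' m - l' * d' * s' m * s' v)
      (s' d + d' * (s' m)\<^sup>2 / s' l)
      (l' * s' u + e' * s' v + l' * (d' * (s' v)\<^sup>2 + cbrt d' * s' t) + u')
      (m' * s' v + v') ((cbrt (l' * m'))\<^sup>2 * s' t + t')"
proof -
  define D where "D = s' d + d' * (s' m)\<^sup>2 / s' l"
  define L where "L = cbrt (s' l)"
  have L: "s' l = L * L\<^sup>2" "L \<noteq> 0"
    using l cbrt_cube(2)[of "s' l"]
    by (simp_all add: L_def cbrt_eq_0 field_aut_eq_0[OF s'] power2_eq_square power3_eq_cube mult.assoc)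
  have 1: "s' l * D = s' l * s' d + d' * (s' m)\<^sup>2"
    using l by (simp add: D_def field_aut_eq_0[OF s'] distrib_left)
  \<comment> \<open>The coefficient of c has to be produced by the same parameter D as the
    coefficient of b^2. This works because l times the cube root of m^2 / l is the square of the
    cube root of l m.\<close>
  have 2: "s' l * cbrt D = s' l * cbrt (s' d) + cbrt d' * s' ((cbrt (l * m))\<^sup>2)"
  proof -
    have "cbrt D = cbrt (s' d) + cbrt d' * (cbrt (s' m))\<^sup>2 / L"
      by (simp add: D_def cbrt_simps L_def)
    moreover have "s' ((cbrt (l * m))\<^sup>2) = L\<^sup>2 * (cbrt (s' m))\<^sup>2"
      by (simp only: field_aut_power[OF s'] field_aut_cbrt_commute[OF s'] field_aut_mult[OF s']
          cbrt_simps(2) power_mult_distrib L_def)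
    ultimately show ?thesis using L by (simp add: distrib_left)
  qed
  have 3: "(cbrt (l' * s' l * (m' * s' m)))\<^sup>2 = (cbrt (l' * m'))\<^sup>2 * s' ((cbrt (l * m))\<^sup>2)"
    by (simp only: field_aut_power[OF s'] field_aut_cbrt_commute[OF s'] field_aut_mult[OF s']
          cbrt_simps(2) power_mult_distrib mult.assoc mult.left_commute)
  have 4: "s' (cbrt d) = cbrt (s' d)" by (rule field_aut_cbrt_commute[OF s'])
  have sq: "(X + Y)\<^sup>2 = X\<^sup>2 + Y\<^sup>2 - X * Y" for X Y :: 'a
    using triple[of "X * Y"] by (simp add: power2_eq_square algebra_simps)
  show ?thesis
  proof (rule ext)
    fix p :: "'a omega"
    obtain a b c where p: "p = (a, b, c)" by (metis prod_cases3)
    have "l' * s' l * (D * (s' (s b))\<^sup>2 + cbrt D * s' (s c))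
        = l' * ((s' l * D) * (s' (s b))\<^sup>2 + (s' l * cbrt D) * s' (s c))"
      by (simp only: distrib_left mult.assoc)
    then show "(bmap s' l' m' e' d' u' v' t' \<circ> bmap s l m e d u v t) p =
      bmap (\<lambda>a. s' (s a)) (l' * s' l) (m' * s' m) (l' * s' e + e' * s' m - l' * d' * s' m * s' v)
      (s' d + d' * (s' m)\<^sup>2 / s' l)
      (l' * s' u + e' * s' v + l' * (d' * (s' v)\<^sup>2 + cbrt d' * s' t) + u')
      (m' * s' v + v') ((cbrt (l' * m'))\<^sup>2 * s' t + t') p"
      unfolding bmap_def p D_def[symmetric] 3 comp_apply prod.case 1 2
      by (simp only: field_aut_add[OF s'] field_aut_mult[OF s'] field_aut_power[OF s', of "s b"] 4 sq prod.inject)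
        (simp add: algebra_simps power_mult_distrib)
  qed
qed

text \<open>The values at the origin and at the first two unit vectors give translation and matrix.
  The determinant guarantees a nonzero entry in the first column, against which \<open>s\<close> can
  be read off.\<close>

lemma smap_eq_iff:
  assumes "field_aut s" "field_aut s'" "x * w - y * z \<noteq> 0"
  shows "smap s x y z w u v t = smap s' x' y' z' w' u' v' t' \<longleftrightarrow>
    s = s' \<and> x = x' \<and> y = y' \<and> z = z' \<and> w = w' \<and> u = u' \<and> v = v' \<and> t = t'" (is "?l \<longleftrightarrow> ?r")
proof
  assume eq: ?l
  note s01 = field_aut_0[OF assms(1)] field_aut_0[OF assms(2)] field_aut_1[OF assms(1)]
    field_aut_1[OF assms(2)]
  have 0: "u = u'" "v = v'" "t = t'" using fun_cong[OF eq, of "(0, 0, 0)"] by (simp_all add: smap_def s01)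
  then have 1: "x = x'" "z = z'" using fun_cong[OF eq, of "(1, 0, 0)"] by (simp_all add: smap_def s01)
  have 2: "y = y'" "w = w'" using fun_cong[OF eq, of "(0, 1, 0)"] 0 by (simp_all add: smap_def s01)
  have "x * s a = x * s' a \<and> z * s a = z * s' a" for a
    using fun_cong[OF eq, of "(a, 0, 0)"] 0 1 by (simp add: smap_def s01)
  moreover have "x \<noteq> 0 \<or> z \<noteq> 0" using assms(3) by auto
  ultimately have "s = s'" by (auto simp: fun_eq_iff)
  then show ?r using 0 1 2 by simp
qed simp

text \<open>At b = 1 the parameters e and d occur only in a sum; b = -1 reverses the linear term but
  not the quadratic one, and 2 = -1 is invertible.\<close>

lemma bmap_eq_iff:
  assumes "field_aut s" "field_aut s'" "l \<noteq> 0"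
  shows "bmap s l m e d u v t = bmap s' l' m' e' d' u' v' t' \<longleftrightarrow>
    s = s' \<and> l = l' \<and> m = m' \<and> e = e' \<and> d = d' \<and> u = u' \<and> v = v' \<and> t = t'" (is "?l \<longleftrightarrow> ?r")
proof
  assume eq: ?l
  note s01 = field_aut_0[OF assms(1)] field_aut_0[OF assms(2)] field_aut_1[OF assms(1)]
    field_aut_1[OF assms(2)] field_aut_uminus[OF assms(1)] field_aut_uminus[OF assms(2)]
  have 0: "u = u'" "v = v'" "t = t'" using fun_cong[OF eq, of "(0, 0, 0)"] by (simp_all add: bmap_def s01)
  have l: "l = l'" using fun_cong[OF eq, of "(1, 0, 0)"] 0 by (simp add: bmap_def s01)
  have m: "m = m'" "e + l * d = e' + l * d'"
    using fun_cong[OF eq, of "(0, 1, 0)"] 0 l by (simp_all add: bmap_def s01)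
  moreover have "- e + l * d = - e' + l * d'"
    using fun_cong[OF eq, of "(0, - 1, 0)"] 0 l by (simp add: bmap_def s01)
  ultimately have "(e + l * d) + (- e + l * d) = (e' + l * d') + (- e' + l * d')" by simp
  then have "l * d + l * d = l * d' + l * d'" by simp
  then have d: "d = d'" using assms(3) unfolding triple by simp
  have "s = s'"
    using fun_cong[OF eq, of "(_, 0, 0)"] 0 l assms(3) by (simp add: bmap_def s01 fun_eq_iff)
  then show ?r using 0 l m d by simp
qed simp

lemma smap_bij:
  assumes s: "field_aut s" and det: "x * w - y * z \<noteq> 0"
  shows "bij (smap s x y z w u v t)"
proof -
  have "inj (smap s x y z w u v t)"
  proof (rule injI)
    fix p p' :: "'a omega"
    assume eq: "smap s x y z w u v t p = smap s x y z w u v t p'"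
    obtain a b c a' b' c' where p: "p = (a, b, c)" "p' = (a', b', c')" by (metis prod_cases3)
    have c: "c = c'" using eq det by (simp add: p smap_def cbrt_eq_0 field_aut_inj[OF s])
    have e: "x * (s a - s a') + y * (s b - s b') = 0" "z * (s a - s a') + w * (s b - s b') = 0"
      using eq by (simp_all add: p smap_def algebra_simps)
    have "(x * w - y * z) * (s a - s a') = w * (x * (s a - s a') + y * (s b - s b'))
        - y * (z * (s a - s a') + w * (s b - s b'))" by (simp add: algebra_simps)
    then have "s a = s a'" using det unfolding e by simp
    moreover have "(x * w - y * z) * (s b - s b') = x * (z * (s a - s a') + w * (s b - s b'))
        - z * (x * (s a - s a') + y * (s b - s b'))" by (simp add: algebra_simps)
    then have "s b = s b'" using det unfolding e by simp
    ultimately show "p = p'" using c by (simp add: p field_aut_inj[OF s])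
  qed
  then show ?thesis by (simp add: bij_def finite_UNIV_inj_surj)
qed

lemma bmap_bij:
  assumes s: "field_aut s" and lm: "l \<noteq> 0" "m \<noteq> 0"
  shows "bij (bmap s l m e d u v t)"
proof -
  have "inj (bmap s l m e d u v t)"
  proof (rule injI)
    fix p p' :: "'a omega"
    assume eq: "bmap s l m e d u v t p = bmap s l m e d u v t p'"
    obtain a b c a' b' c' where p: "p = (a, b, c)" "p' = (a', b', c')" by (metis prod_cases3)
    have bc: "b = b'" "c = c'" using eq lm by (simp_all add: p bmap_def cbrt_eq_0 field_aut_inj[OF s])
    then show "p = p'" using eq lm by (simp add: p bmap_def field_aut_inj[OF s])
  qed
  then show ?thesis by (simp add: bij_def finite_UNIV_inj_surj)
qed

lemma perm_alpha_smap: "perm_alpha u v w = smap id 1 0 0 1 u v w"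
  by (simp add: fun_eq_iff perm_alpha_def smap_def cbrt_simps)

lemma perm_alpha_bmap: "perm_alpha u v w = bmap id 1 1 0 0 u v w"
  by (simp add: fun_eq_iff perm_alpha_def bmap_def cbrt_simps)

lemma perm_beta_bmap: "perm_beta l m = bmap id l m 0 0 0 0 0"
  by (simp add: fun_eq_iff perm_beta_def bmap_def cbrt_simps power_eps)

lemma perm_gamma_bmap: "perm_gamma e = bmap id 1 1 e 0 0 0 0"
  by (simp add: fun_eq_iff perm_gamma_def bmap_def cbrt_simps)

lemma perm_tau_bmap: "perm_tau d = bmap id 1 1 0 d 0 0 0"
  by (simp add: fun_eq_iff perm_tau_def bmap_def cbrt_simps power_eps)

lemma perm_sigma_bmap: "perm_sigma = bmap (\<lambda>x. x ^ 3) 1 1 0 0 0 0 0"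
  by (simp add: fun_eq_iff perm_sigma_def bmap_def cbrt_simps)

lemma perm_delta_smap: "perm_delta = smap id 0 1 (- 1) 0 0 0 0"
  by (simp add: fun_eq_iff perm_delta_def smap_def cbrt_simps)

section \<open>The groups of all semi-affine and of all semi-triangular maps\<close>

definition semi_affine :: "'a perm set" where
  "semi_affine = {smap s x y z w u v t | s x y z w u v t. field_aut s \<and> x * w - y * z \<noteq> 0}"

definition semi_triangular :: "'a perm set" where
  "semi_triangular = {bmap s l m e d u v t | s l m e d u v t. field_aut s \<and> l \<noteq> 0 \<and> m \<noteq> 0}"

lemma smap_mem: "field_aut s \<Longrightarrow> x * w - y * z \<noteq> 0 \<Longrightarrow> smap s x y z w u v t \<in> semi_affine"
  unfolding semi_affine_def by blast

lemma bmap_mem: "field_aut s \<Longrightarrow> l \<noteq> 0 \<Longrightarrow> m \<noteq> 0 \<Longrightarrow> bmap s l m e d u v t \<in> semi_triangular"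
  unfolding semi_triangular_def by blast

lemma semi_affineE:
  assumes "g \<in> semi_affine"
  obtains s x y z w u v t where "g = smap s x y z w u v t" "field_aut s" "x * w - y * z \<noteq> 0"
  using assms unfolding semi_affine_def by blast

lemma semi_triangularE:
  assumes "g \<in> semi_triangular"
  obtains s l m e d u v t where "g = bmap s l m e d u v t" "field_aut s" "l \<noteq> 0" "m \<noteq> 0"
  using assms unfolding semi_triangular_def by blast

text \<open>The second coordinate of a semi-triangular map does not depend on a; the values at (0,
  0, 0) and (1, 0, 0) isolate z.\<close>

lemma smap_mem_semi_triangular:
  assumes "field_aut s" "x * w - y * z \<noteq> 0"
  shows "smap s x y z w u v t \<in> semi_triangular \<longleftrightarrow> z = 0"
proof
  assume "smap s x y z w u v t \<in> semi_triangular"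
  then obtain s' l m e d u' v' t' where eq: "smap s x y z w u v t = bmap s' l m e d u' v' t'"
    and s': "field_aut s'" by (rule semi_triangularE)
  show "z = 0"
    using fun_cong[OF eq, of "(0, 0, 0)"] fun_cong[OF eq, of "(1, 0, 0)"]
    by (simp add: smap_def bmap_def field_aut_0[OF assms(1)] field_aut_1[OF assms(1)]
        field_aut_0[OF s'] field_aut_1[OF s'])
next
  assume "z = 0"
  then show "smap s x y z w u v t \<in> semi_triangular"
    using assms bmap_mem[of s x w y 0] by (simp add: bmap_eq_smap)
qed

text \<open>Up to its constant a semi-affine map is odd in b, whereas d contributes an even term; b
  = 1 and b = -1 tell them apart.\<close>

lemma bmap_mem_semi_affine:
  assumes s: "field_aut s" and l: "l \<noteq> 0" "m \<noteq> 0"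
  shows "bmap s l m e d u v t \<in> semi_affine \<longleftrightarrow> d = 0"
proof
  assume "bmap s l m e d u v t \<in> semi_affine"
  then obtain s' x y z w u' v' t' where eq: "bmap s l m e d u v t = smap s' x y z w u' v' t'"
    and s': "field_aut s'" by (rule semi_affineE)
  note s01 = field_aut_0[OF s] field_aut_0[OF s'] field_aut_1[OF s]
    field_aut_1[OF s'] field_aut_uminus[OF s] field_aut_uminus[OF s']
  have u: "u = u'" using fun_cong[OF eq, of "(0, 0, 0)"] by (simp add: smap_def bmap_def s01)
  have "e + l * d = y" "- e + l * d = - y"
    using fun_cong[OF eq, of "(0, 1, 0)"] fun_cong[OF eq, of "(0, - 1, 0)"]
    by (simp_all add: smap_def bmap_def s01 u)
  moreover have "(e + l * d) + (- e + l * d) = l * d + l * d" by simp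
  ultimately have "l * d + l * d = 0" by (metis add.right_inverse)
  then show "d = 0" using l unfolding triple by simp
next
  assume "d = 0"
  then show "bmap s l m e d u v t \<in> semi_affine"
    using assms smap_mem[of s l m e 0] by (simp add: bmap_eq_smap)
qed

lemma SymOmega_simps:
  "carrier (SymOmega :: 'a perm monoid) = {f. bij f}"
  "f \<otimes>\<^bsub>SymOmega\<^esub> g = g \<circ> f" "\<one>\<^bsub>SymOmega\<^esub> = id"
  by (auto simp: symm_group_def permutes_def bij_iff)

lemma subgroup_semi_affine: "subgroup semi_affine SymOmega"
proof (rule group.subgroup_of_finite[OF group_symm_group])
  show "semi_affine \<noteq> {}" using smap_mem[OF field_aut_id(2), of 1 1 0 0] by auto
  show "f \<otimes>\<^bsub>SymOmega\<^esub> g \<in> semi_affine" if fg: "f \<in> semi_affine" "g \<in> semi_affine" for f g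
  proof -
    obtain s x y z w u v t where f: "f = smap s x y z w u v t" "field_aut s" "x * w - y * z \<noteq> 0"
      using fg(1) by (rule semi_affineE)
    obtain s' x' y' z' w' u' v' t' where
      g: "g = smap s' x' y' z' w' u' v' t'" "field_aut s'" "x' * w' - y' * z' \<noteq> 0"
      using fg(2) by (rule semi_affineE)
    have det: "(x' * s' x + y' * s' z) * (z' * s' y + w' * s' w)
        - (x' * s' y + y' * s' w) * (z' * s' x + w' * s' z) = (x' * w' - y' * z') * s' (x * w - y * z)"
      by (simp add: field_aut_add[OF g(2)] field_aut_diff[OF g(2)] field_aut_mult[OF g(2)] algebra_simps)
    show ?thesis
      unfolding SymOmega_simps f(1) g(1) smap_comp[OF g(2)]
      by (rule smap_mem[OF field_aut_comp[OF g(2) f(2)]])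
        (simp only: det mult_eq_0_iff field_aut_eq_0[OF g(2)] f(3) g(3) simp_thms)
  qed
  show "semi_affine \<subseteq> carrier SymOmega"
  proof
    fix f :: "'a perm" assume "f \<in> semi_affine"
    then obtain s x y z w u v t where "f = smap s x y z w u v t" "field_aut s" "x * w - y * z \<noteq> 0"
      by (rule semi_affineE)
    then show "f \<in> carrier SymOmega" unfolding SymOmega_simps using smap_bij by blast
  qed
qed simp

lemma subgroup_semi_triangular: "subgroup semi_triangular SymOmega"
proof (rule group.subgroup_of_finite[OF group_symm_group])
  show "semi_triangular \<noteq> {}" using bmap_mem[OF field_aut_id(2), of 1 1] by auto
  show "f \<otimes>\<^bsub>SymOmega\<^esub> g \<in> semi_triangular"
    if fg: "f \<in> semi_triangular" "g \<in> semi_triangular" for f g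
  proof -
    obtain s l m e d u v t where f: "f = bmap s l m e d u v t" "field_aut s" "l \<noteq> 0" "m \<noteq> 0"
      using fg(1) by (rule semi_triangularE)
    obtain s' l' m' e' d' u' v' t' where
      g: "g = bmap s' l' m' e' d' u' v' t'" "field_aut s'" "l' \<noteq> 0" "m' \<noteq> 0"
      using fg(2) by (rule semi_triangularE)
    show ?thesis
      unfolding SymOmega_simps f(1) g(1) bmap_comp[OF g(2) f(3)]
      by (rule bmap_mem[OF field_aut_comp[OF g(2) f(2)]])
        (simp_all only: mult_eq_0_iff field_aut_eq_0[OF g(2)] f(3,4) g(3,4) simp_thms)
  qed
  show "semi_triangular \<subseteq> carrier SymOmega"
  proof
    fix f :: "'a perm" assume "f \<in> semi_triangular"
    then obtain s l m e d u v t where "f = bmap s l m e d u v t" "field_aut s" "l \<noteq> 0" "m \<noteq> 0"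
      by (rule semi_triangularE)
    then show "f \<in> carrier SymOmega" unfolding SymOmega_simps using bmap_bij by blast
  qed
qed simp

lemma set_multI: "f \<in> A \<Longrightarrow> g \<in> B \<Longrightarrow> g \<circ> f \<in> A <#>\<^bsub>SymOmega\<^esub> B"
  by (force simp: set_mult_def SymOmega_simps)

lemma set_mult_subgroup:
  "subgroup K (SymOmega :: 'a perm monoid) \<Longrightarrow> A \<subseteq> K \<Longrightarrow> B \<subseteq> K \<Longrightarrow> A <#>\<^bsub>SymOmega\<^esub> B \<subseteq> K"
  unfolding set_mult_def by (auto intro!: subgroup.m_closed)

lemma generate_comp:
  "f \<in> generate SymOmega X \<Longrightarrow> g \<in> generate SymOmega X \<Longrightarrow> g \<circ> f \<in> generate (SymOmega :: 'a perm monoid) X"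
  using generate.eng[of f SymOmega X g] by (simp add: SymOmega_simps)

lemma frobenius_in_grp_Sigma:
  assumes s: "field_aut s"
  shows "bmap s 1 1 0 0 0 0 0 \<in> grp_Sigma"
proof -
  obtain n where "s = (\<lambda>x. x ^ (3 ^ n))" using field_aut_imp_frobenius[OF s] .
  moreover have "bmap (\<lambda>x. x ^ (3 ^ n)) 1 1 0 0 0 0 0 \<in> grp_Sigma" for n
  proof (induction n)
    case 0
    have "bmap (\<lambda>x. x) 1 1 0 0 0 0 0 = id" by (simp add: fun_eq_iff bmap_def cbrt_simps)
    then show ?case
      using generate.one[of SymOmega "{perm_sigma :: 'a perm}"] by (simp add: grp_Sigma_def SymOmega_simps id_def)
  next
    case (Suc n)
    have "bmap (\<lambda>x. x ^ (3 ^ Suc n)) 1 1 0 0 0 0 0 = perm_sigma \<circ> bmap (\<lambda>x. x ^ (3 ^ n)) 1 1 0 0 0 0 0"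
      by (simp add: fun_eq_iff bmap_def cbrt_simps perm_sigma_def mult.commute[of 3] power_mult)
    then show ?case
      using generate_comp[OF Suc[unfolded grp_Sigma_def] generate.incl[of perm_sigma]]
      unfolding grp_Sigma_def by (simp only: singletonI)
  qed
  ultimately show ?thesis by simp
qed

text \<open>Bruhat decomposition of SL2: a matrix with z = 0 is diagonal times unipotent, and any
  other one is unipotent, times \<delta>, times diagonal, times unipotent.\<close>

lemma smap_in_grp_M:
  assumes det: "x * w - y * z = 1"
  shows "smap id x y z w 0 0 0 \<in> grp_M"
proof -
  have C: "perm_gamma e \<in> grp_M" for e :: 'a
    unfolding grp_M_def grp_C_def by (intro generate.incl) (blast intro: generate.incl)
  have T: "perm_beta \<mu> (inverse \<mu>) \<in> grp_M" if "\<mu> \<noteq> 0" for \<mu> :: 'a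
    unfolding grp_M_def grp_T_def using that by (intro generate.incl UnI2) (blast intro: generate.incl)
  have D: "(perm_delta :: 'a perm) \<in> grp_M"
    unfolding grp_M_def grp_D_def by (intro generate.incl) (blast intro: generate.incl)
  have comp: "g \<circ> f \<in> grp_M" if "f \<in> grp_M" "g \<in> grp_M" for f g :: "'a perm"
    using that unfolding grp_M_def by (rule generate_comp)
  have c1: "cbrt (x * w - y * z) = 1" unfolding det by (simp add: cbrt_simps)
  show ?thesis
  proof (cases "z = 0")
    case True
    then have x: "x \<noteq> 0" "w = inverse x" using det by (auto simp: inverse_unique)
    have "smap id x y z w 0 0 0 = perm_beta x (inverse x) \<circ> perm_gamma (y / x)"
      using x True by (simp add: fun_eq_iff smap_def perm_beta_bmap bmap_def perm_gamma_def cbrt_simps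
          field_simps)
    then show ?thesis using comp C T[OF x(1)] by simp
  next
    case False
    then have y: "y = (x * w - 1) / z" using det by (simp add: field_simps)
    have "smap id x y z w 0 0 0 =
      perm_gamma (x / z) \<circ> (perm_delta \<circ> (perm_beta (- z) (inverse (- z)) \<circ> perm_gamma (w / z)))"
      using False unfolding smap_def c1 by (simp add: fun_eq_iff perm_beta_bmap bmap_def perm_gamma_def
          perm_delta_def cbrt_simps cbrt_uminus y) (simp add: field_simps)
    moreover have "- z \<noteq> 0" using False by simp
    ultimately show ?thesis using comp C T D by presburger
  qed
qed

lemma grp_G1_eq: "grp_G1 = semi_affine"
proof
  have "grp_A \<subseteq> semi_affine" "grp_C \<subseteq> semi_affine" "grp_D \<subseteq> semi_affine" "grp_T \<subseteq> semi_affine"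
      "grp_S \<subseteq> semi_affine" "grp_Sigma \<subseteq> semi_affine"
    using field_aut_frobenius[of 1]
    unfolding grp_A_def grp_C_def grp_D_def grp_T_def grp_S_def grp_Sigma_def
    by (auto intro!: group.generate_subgroup_incl[OF group_symm_group _ subgroup_semi_affine] smap_mem
        simp: perm_alpha_smap perm_gamma_bmap perm_delta_smap perm_beta_bmap perm_sigma_bmap
          bmap_eq_smap field_aut_id)
  moreover from this have "grp_M \<subseteq> semi_affine"
    unfolding grp_M_def
    by (intro group.generate_subgroup_incl[OF group_symm_group _ subgroup_semi_affine]) auto
  ultimately show "grp_G1 \<subseteq> semi_affine"
    unfolding grp_G1_def by (intro set_mult_subgroup[OF subgroup_semi_affine])
next
  show "semi_affine \<subseteq> grp_G1"
  proof
    fix g assume "g \<in> semi_affine"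
    then obtain s x y z w u v t where g: "g = smap s x y z w u v t" and s: "field_aut s"
      and det: "x * w - y * z \<noteq> 0" by (rule semi_affineE)
    \<comment> \<open>\<Sigma> is the last factor of G1 and so acts last, while \<open>smap\<close>
      applies \<open>s\<close> first; hence all parameters are pulled back through
      \<open>s\<close>.\<close>
    obtain x' y' z' w' u' v' t' where p: "s x' = x" "s y' = y" "s z' = z" "s w' = w" "s u' = u"
      "s v' = v" "s t' = t" using field_aut_surjE[OF s] by metis
    define D where "D = x' * w' - y' * z'"
    have sD: "s D = x * w - y * z" by (simp add: D_def field_aut_simps[OF s] p)
    then have D: "D \<noteq> 0" using det field_aut_eq_0[OF s] by metis
    \<comment> \<open>The diagonal matrix with entries \<mu>^2, \<mu> from S has determinant
      \<mu>^3; this choice leaves a matrix of determinant 1, which M can supply.\<close>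
    define \<mu> where "\<mu> = cbrt D"
    have \<mu>: "\<mu> \<noteq> 0" "\<mu> ^ 3 = D" using D by (simp_all add: \<mu>_def cbrt_eq_0 cbrt_cube)
    \<comment> \<open>A acts before the matrix, so the translation is pulled back through it by
      Cramer's rule.\<close>
    define P where "P = (w' * u' - y' * v') / D"
    define Q where "Q = (x' * v' - z' * u') / D"
    define t0 where "t0 = t' / \<mu>\<^sup>2"
    let ?M = "smap id (x' / \<mu>\<^sup>2) (y' / \<mu>\<^sup>2) (z' / \<mu>) (w' / \<mu>) 0 0 0"
    have det': "x' / \<mu>\<^sup>2 * (w' / \<mu>) - y' / \<mu>\<^sup>2 * (z' / \<mu>) = 1"
    proof -
      have "x' / \<mu>\<^sup>2 * (w' / \<mu>) - y' / \<mu>\<^sup>2 * (z' / \<mu>) = D / \<mu> ^ 3"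
        by (simp add: D_def diff_divide_distrib power2_eq_square power3_eq_cube)
      then show ?thesis using \<mu> D by simp
    qed
    have "D * (x' * P + y' * Q) = D * u'" "D * (z' * P + w' * Q) = D * v'"
      using D by (simp_all add: P_def Q_def distrib_left) (simp_all add: D_def algebra_simps)
    then have u'v': "u' = x' * P + y' * Q" "v' = z' * P + w' * Q" using D by simp_all
    have t': "t' = \<mu>\<^sup>2 * t0" using \<mu> by (simp add: t0_def)
    have cbrts: "cbrt (\<mu>\<^sup>2 * \<mu>) = \<mu>" "cbrt (x' * w' - y' * z') = \<mu>"
    proof -
      have "\<mu>\<^sup>2 * \<mu> = D" using \<mu> by (simp add: power2_eq_square power3_eq_cube)
      then show "cbrt (\<mu>\<^sup>2 * \<mu>) = \<mu>" "cbrt (x' * w' - y' * z') = \<mu>"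
        by (simp_all add: \<mu>_def D_def)
    qed
    have "smap id x' y' z' w' u' v' t' = perm_beta (\<mu>\<^sup>2) \<mu> \<circ> (?M \<circ> perm_alpha P Q t0)"
      unfolding perm_beta_bmap bmap_def smap_def perm_alpha_def det' cbrts u'v' t'
      using \<mu>(1) by (auto simp: fun_eq_iff cbrt_simps field_simps)
    moreover have "g = bmap s 1 1 0 0 0 0 0 \<circ> smap id x' y' z' w' u' v' t'"
      using sD by (simp add: g fun_eq_iff smap_def bmap_def field_aut_simps[OF s] cbrt_simps p
          field_aut_cbrt_commute[OF s])
    moreover have "perm_beta (\<mu>\<^sup>2) \<mu> \<in> grp_S"
      unfolding grp_S_def using \<mu> by (intro generate.incl) auto
    moreover have "perm_alpha P Q t0 \<in> grp_A"
      unfolding grp_A_def by (intro generate.incl) auto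
    ultimately show "g \<in> grp_G1"
      unfolding grp_G1_def
      using smap_in_grp_M[OF det'] frobenius_in_grp_Sigma[OF s] by (simp only: set_multI)
  qed
qed

lemma grp_G2_eq: "grp_G2 = semi_triangular"
proof
  have "grp_A \<subseteq> semi_triangular" "grp_C \<subseteq> semi_triangular" "grp_E \<subseteq> semi_triangular"
      "grp_T \<subseteq> semi_triangular" "grp_S \<subseteq> semi_triangular" "grp_Sigma \<subseteq> semi_triangular"
    using field_aut_frobenius[of 1]
    unfolding grp_A_def grp_C_def grp_E_def grp_T_def grp_S_def grp_Sigma_def
    by (auto intro!: group.generate_subgroup_incl[OF group_symm_group _ subgroup_semi_triangular]
        bmap_mem simp: perm_alpha_bmap perm_gamma_bmap perm_tau_bmap perm_beta_bmap perm_sigma_bmap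
        field_aut_id)
  moreover from this have "grp_Q \<subseteq> semi_triangular"
    unfolding grp_Q_def
    by (intro group.generate_subgroup_incl[OF group_symm_group _ subgroup_semi_triangular]) auto
  ultimately show "grp_G2 \<subseteq> semi_triangular"
    unfolding grp_G2_def by (intro set_mult_subgroup[OF subgroup_semi_triangular])
next
  show "semi_triangular \<subseteq> grp_G2"
  proof
    fix g assume "g \<in> semi_triangular"
    then obtain s l m e d u v t where g: "g = bmap s l m e d u v t" and s: "field_aut s"
      and lm: "l \<noteq> 0" "m \<noteq> 0" by (rule semi_triangularE)
    obtain l' m' e' u' v' t' d' where p: "s l' = l" "s m' = m" "s e' = e" "s u' = u"
      "s v' = v" "s t' = t" "s d' = d" using field_aut_surjE[OF s] by metis
    have lm': "l' \<noteq> 0" "m' \<noteq> 0" using lm p field_aut_eq_0[OF s] by metis+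
    \<comment> \<open>S and T together give every diagonal matrix: l' = \<nu> \<mu>^2 and m' = \<mu>
      / \<nu>, where \<mu>^3 = l' m'.\<close>
    define \<mu> where "\<mu> = cbrt (l' * m')"
    define \<nu> where "\<nu> = l' / \<mu>\<^sup>2"
    have \<mu>: "\<mu> \<noteq> 0" "\<mu> ^ 3 = l' * m'" using lm' by (simp_all add: \<mu>_def cbrt_eq_0 cbrt_cube)
    have \<nu>: "\<nu> \<noteq> 0" "\<nu> * \<mu>\<^sup>2 = l'" using lm' \<mu> by (simp_all add: \<nu>_def)
    have \<nu>': "m' = \<mu> / \<nu>"
      using lm' \<mu> by (simp add: \<nu>_def field_simps power3_eq_cube power2_eq_square)
    define v0 where "v0 = v' / m'"
    define t0 where "t0 = t' / \<mu>\<^sup>2"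
    \<comment> \<open>The translation by v0 and t0 acts before \<tau>, which then produces the extra
      terms - d' v0 b, d' v0^2 and \<open>cbrt d' * t0\<close>; \<open>e0\<close> and
      \<open>u0\<close> compensate for them in advance.\<close>
    define e0 where "e0 = e' / l' + d' * v0"
    define u0 where "u0 = u' / l' - d' * v0\<^sup>2 - cbrt d' * t0"
    have p': "v' = m' * v0" "t' = \<mu>\<^sup>2 * t0" "e' = l' * (e0 - d' * v0)"
      "u' = l' * (u0 + d' * v0\<^sup>2 + cbrt d' * t0)"
      using lm' \<mu> by (simp_all add: v0_def t0_def e0_def u0_def)
    have cbrts: "cbrt (\<mu>\<^sup>2 * \<mu>) = \<mu>" "cbrt (l' * m') = \<mu>"
    proof -
      have "\<mu>\<^sup>2 * \<mu> = l' * m'" using \<mu> by (simp add: power2_eq_square power3_eq_cube)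
      then show "cbrt (\<mu>\<^sup>2 * \<mu>) = \<mu>" by (simp add: \<mu>_def)
    qed (simp add: \<mu>_def)
    have sq: "(X + Y)\<^sup>2 = X\<^sup>2 + Y\<^sup>2 - X * Y" for X Y :: 'a
      using triple[of "X * Y"] by (simp add: power2_eq_square algebra_simps)
    have "bmap id l' m' e' d' u' v' t' =
      perm_beta \<nu> (inverse \<nu>) \<circ> (perm_tau d' \<circ> (perm_beta (\<mu>\<^sup>2) \<mu> \<circ>
        (perm_gamma e0 \<circ> perm_alpha (u0 - e0 * v0) v0 t0)))"
    proof (rule ext)
      fix p :: "'a omega"
      obtain a b c where p: "p = (a, b, c)" by (metis prod_cases3)
      \<comment> \<open>The elements \<beta> with entries \<mu>^2, \<mu> commute with every
        \<tau>_d, so \<mu>^2 can be taken out of all the terms.\<close>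
      have "\<nu> * (\<mu>\<^sup>2 * (a + e0 * b + u0) + d' * (\<mu> * (b + v0))\<^sup>2 + cbrt d' * (\<mu>\<^sup>2 * (c + t0)))
        = \<nu> * \<mu>\<^sup>2 * (a + e0 * b + u0 + d' * (b + v0)\<^sup>2 + cbrt d' * (c + t0))"
        by (simp only: power_mult_distrib) (simp add: algebra_simps)
      also have "\<dots> = l' * (a + e0 * b + u0 + d' * (b\<^sup>2 + v0\<^sup>2 - b * v0) + cbrt d' * (c + t0))"
        unfolding \<nu>(2) sq ..
      also have "\<dots> = l' * a + e' * b + l' * (d' * b\<^sup>2 + cbrt d' * c) + u'"
        unfolding p' by (simp add: algebra_simps)
      finally have 1: "\<nu> * (\<mu>\<^sup>2 * (a + e0 * b + u0) + d' * (\<mu> * (b + v0))\<^sup>2 + cbrt d' * (\<mu>\<^sup>2 * (c + t0)))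
        = l' * a + e' * b + l' * (d' * b\<^sup>2 + cbrt d' * c) + u'" .
      have 2: "a + (u0 - e0 * v0) + e0 * (b + v0) = a + e0 * b + u0" by (simp add: algebra_simps)
      have 3: "inverse \<nu> * (\<mu> * (b + v0)) = m' * b + v'"
        using \<nu> unfolding p' \<nu>' by (simp add: field_simps)
      show "bmap id l' m' e' d' u' v' t' p = (perm_beta \<nu> (inverse \<nu>) \<circ> (perm_tau d' \<circ> (perm_beta (\<mu>\<^sup>2) \<mu> \<circ>
        (perm_gamma e0 \<circ> perm_alpha (u0 - e0 * v0) v0 t0)))) p"
        using 1 3 \<nu>
        by (simp add: p bmap_def perm_beta_def perm_tau_def perm_gamma_def perm_alpha_def power_eps
            cbrts 2) (simp add: cbrt_simps p' distrib_left)
    qed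
    moreover have "g = bmap s 1 1 0 0 0 0 0 \<circ> bmap id l' m' e' d' u' v' t'"
      using p by (simp add: g fun_eq_iff bmap_def field_aut_simps[OF s] cbrt_simps
          field_aut_cbrt_commute[OF s])
    moreover have "perm_beta (\<mu>\<^sup>2) \<mu> \<in> grp_S"
      unfolding grp_S_def using \<mu> by (intro generate.incl) auto
    moreover have "perm_beta \<nu> (inverse \<nu>) \<in> grp_T"
      unfolding grp_T_def using \<nu> by (intro generate.incl) auto
    moreover have "perm_tau d' \<in> grp_E"
      unfolding grp_E_def by (intro generate.incl) auto
    moreover have "perm_gamma e0 \<circ> perm_alpha (u0 - e0 * v0) v0 t0 \<in> grp_Q"
      unfolding grp_Q_def
    proof (rule generate_comp; rule generate.incl)
      show "perm_alpha (u0 - e0 * v0) v0 t0 \<in> grp_A \<union> grp_C"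
        unfolding grp_A_def by (intro UnI1 generate.incl) auto
      show "perm_gamma e0 \<in> grp_A \<union> grp_C"
        unfolding grp_C_def by (intro UnI2 generate.incl) auto
    qed
    ultimately show "g \<in> grp_G2"
      unfolding grp_G2_def
      using frobenius_in_grp_Sigma[OF s] by (simp only: set_multI)
  qed
qed

end

section \<open>The action on the neighbours of the base vertices\<close>

lemma (in group) rcos_eq_iff_factor:
  assumes L: "subgroup L G" and x: "x \<in> carrier G" and y: "y \<in> carrier G"
  shows "L #> x = L #> y \<longleftrightarrow> (\<exists>h\<in>L. x = h \<otimes> y)"
proof
  assume "L #> x = L #> y"
  then have "x \<in> L #> y" using rcos_self[OF x L] by simp
  then show "\<exists>h\<in>L. x = h \<otimes> y" unfolding r_coset_def by blast
next
  assume "\<exists>h\<in>L. x = h \<otimes> y"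
  then have "x \<in> L #> y" unfolding r_coset_def by blast
  then show "L #> x = L #> y" using repr_independence[OF _ y L] by simp
qed

context field_char_3
begin

section \<open>The generated group and its two subgroups\<close>

lemma group_G_simps:
  "carrier (group_G F) = generate SymOmega (semi_affine \<union> semi_triangular)"
  "f \<otimes>\<^bsub>group_G F\<^esub> g = g \<circ> f" "\<one>\<^bsub>group_G F\<^esub> = id"
  by (simp_all add: group_G_def grp_G1_eq grp_G2_eq SymOmega_simps)

lemma group_G_subgroups:
  "subgroup (carrier (group_G F)) SymOmega"
  "subgroup semi_affine (group_G F)" "subgroup semi_triangular (group_G F)"
proof -
  interpret S: group "SymOmega :: 'a perm monoid" by (rule group_symm_group)
  have sub: "semi_affine \<union> semi_triangular \<subseteq> carrier (SymOmega :: 'a perm monoid)"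
    using subgroup.subset[OF subgroup_semi_affine] subgroup.subset[OF subgroup_semi_triangular] by blast
  show 1: "subgroup (carrier (group_G F)) SymOmega"
    unfolding group_G_simps by (rule S.generate_is_subgroup[OF sub])
  have sub': "semi_affine \<subseteq> carrier (group_G F)" "semi_triangular \<subseteq> carrier (group_G F)"
    unfolding group_G_simps by (auto intro: generate.incl)
  have "SymOmega\<lparr>carrier := carrier (group_G F)\<rparr> = group_G F"
    by (simp add: group_G_def)
  then show "subgroup semi_affine (group_G F)" "subgroup semi_triangular (group_G F)"
    using S.subgroup_incl[OF subgroup_semi_affine 1 sub'(1)]
      S.subgroup_incl[OF subgroup_semi_triangular 1 sub'(2)] by simp_all
qed

lemma group_group_G: "group (group_G F)"
  using subgroup.subgroup_is_group[OF group_G_subgroups(1) group_symm_group]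
  by (simp add: group_G_def)

lemma mem_carrier_G:
  "g \<in> semi_affine \<Longrightarrow> g \<in> carrier (group_G F)" "g \<in> semi_triangular \<Longrightarrow> g \<in> carrier (group_G F)"
  using subgroup.subset[OF group_G_subgroups(2)] subgroup.subset[OF group_G_subgroups(3)] by blast+

lemma generators_mem:
  "perm_tau d \<in> semi_triangular" "perm_gamma e \<in> semi_triangular" "perm_gamma e \<in> semi_affine"
  "perm_delta \<in> semi_affine" "perm_alpha u v w \<in> semi_affine" "perm_alpha u v w \<in> semi_triangular"
  "l \<noteq> 0 \<Longrightarrow> m \<noteq> 0 \<Longrightarrow> perm_beta l m \<in> semi_triangular"
  "l \<noteq> 0 \<Longrightarrow> m \<noteq> 0 \<Longrightarrow> perm_beta l m \<in> semi_affine"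
  by (simp_all add: perm_tau_bmap perm_gamma_bmap perm_delta_smap perm_alpha_bmap perm_beta_bmap
      bmap_mem smap_mem field_aut_id bmap_mem_semi_affine)

lemma bmap_comp_tau:
  assumes s: "field_aut s"
  shows "bmap s l m e d u v t \<circ> perm_tau c = bmap s l m e (s c + d) u v t"
  unfolding perm_tau_bmap bmap_comp[OF s one_neq_zero]
  by (simp add: field_aut_simps[OF s] cbrt_simps)

lemma tau_comp_bmap:
  assumes l: "l \<noteq> 0"
  shows "perm_tau c \<circ> bmap s l m e d u v t =
    bmap s l m (e - c * m * v) (d + c * m\<^sup>2 / l) (u + c * v\<^sup>2 + cbrt c * t) v t"
  unfolding perm_tau_bmap bmap_comp[OF field_aut_id(2) l] by (simp add: cbrt_simps algebra_simps)

lemma tau_comp: "perm_tau c \<circ> perm_tau d = perm_tau (c + d)" for c d :: 'a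
  using tau_comp_bmap[OF one_neq_zero, of c id 1 0 d 0 0 0]
  by (simp add: perm_tau_bmap cbrt_simps add.commute)

text \<open>Moving some \<tau>_c' out on the left of the composite removes its whole quadratic part;
  what remains is semi-affine and is swallowed by the coset.\<close>

lemma coset_tau_act:
  assumes s: "field_aut s" and l: "l \<noteq> 0" and m: "m \<noteq> 0"
  shows "semi_affine #>\<^bsub>group_G F\<^esub> (perm_tau c \<otimes>\<^bsub>group_G F\<^esub> bmap s l m e d u v t) =
    semi_affine #>\<^bsub>group_G F\<^esub> perm_tau (l / m\<^sup>2 * (s c + d))"
proof -
  interpret group "group_G F" by (rule group_group_G)
  \<comment> \<open>The solution of c' m^2 / l = s(c) + d, the condition under which the quadratic
    parts agree.\<close>
  define c' where "c' = l / m\<^sup>2 * (s c + d)"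
  define h where "h = bmap s l m (e + c' * m * v) 0 (u - c' * v\<^sup>2 - cbrt c' * t) v t"
  have "c' * m\<^sup>2 / l = s c + d" using l m by (simp add: c'_def)
  then have "bmap s l m e d u v t \<circ> perm_tau c = perm_tau c' \<circ> h"
    unfolding h_def bmap_comp_tau[OF s] tau_comp_bmap[OF l] by simp
  moreover have "h \<in> semi_affine" using assms by (simp add: h_def bmap_mem_semi_affine)
  ultimately show ?thesis
    unfolding c'_def[symmetric]
    using rcos_eq_iff_factor[OF group_G_subgroups(2)
        m_closed[OF mem_carrier_G(2)[OF generators_mem(1)] mem_carrier_G(2)[OF bmap_mem[OF assms]]]
        mem_carrier_G(2)[OF generators_mem(1)]]
    unfolding group_G_simps(2) by blast
qed

lemma coset_tau_eq_iff:
  "semi_affine #>\<^bsub>group_G F\<^esub> perm_tau c = semi_affine #>\<^bsub>group_G F\<^esub> perm_tau d \<longleftrightarrow> c = d"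
proof
  interpret group "group_G F" by (rule group_group_G)
  assume "semi_affine #>\<^bsub>group_G F\<^esub> perm_tau c = semi_affine #>\<^bsub>group_G F\<^esub> perm_tau d"
  then obtain h where h: "h \<in> semi_affine" "perm_tau c = perm_tau d \<circ> h"
    using rcos_eq_iff_factor[OF group_G_subgroups(2)
        mem_carrier_G(2)[OF generators_mem(1)] mem_carrier_G(2)[OF generators_mem(1)]]
    unfolding group_G_simps(2) by blast
  have "perm_tau (- d) \<circ> perm_tau c = perm_tau 0 \<circ> h"
    unfolding h(2) comp_assoc[symmetric] tau_comp by simp
  moreover have "perm_tau (0::'a) = id" by (simp add: fun_eq_iff perm_tau_bmap bmap_def cbrt_simps)
  ultimately have "perm_tau (c - d) \<in> semi_affine" using h(1) by (simp add: tau_comp)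
  then show "c = d" unfolding perm_tau_bmap using bmap_mem_semi_affine[OF field_aut_id(2)] by simp
qed simp

text \<open>The cosets of \<open>semi_triangular\<close> in \<open>semi_affine\<close> correspond to the lines of the plane: a line
  is the image of the first coordinate axis under the linear part.\<close>

definition line :: "'a \<Rightarrow> 'a \<Rightarrow> 'a perm set" where
  "line p q = semi_triangular #>\<^bsub>group_G F\<^esub>
    (if p = 0 then smap id 0 1 q 0 0 0 0 else smap id p 0 q 1 0 0 0)"

text \<open>A coset remembers exactly the line spanned by the first column. The quotient k of the
  two elements is triangular iff its lower left entry z1 vanishes, and by Cramer's rule the image of
  z1 times a determinant is x' z - x z'.\<close>

lemma coset_smap_eq_iff:
  assumes s: "field_aut s" "x * w - y * z \<noteq> 0" and s': "field_aut s'" "x' * w' - y' * z' \<noteq> 0"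
  shows "semi_triangular #>\<^bsub>group_G F\<^esub> smap s x y z w u v t =
    semi_triangular #>\<^bsub>group_G F\<^esub> smap s' x' y' z' w' u' v' t' \<longleftrightarrow> x * z' = x' * z" (is "?L = ?R \<longleftrightarrow> _")
proof -
  interpret group "group_G F" by (rule group_group_G)
  let ?g = "smap s x y z w u v t" and ?h = "smap s' x' y' z' w' u' v' t'"
  have gh: "?g \<in> semi_affine" "?h \<in> semi_affine" using assms by (simp_all add: smap_mem)
  have c: "?g \<in> carrier (group_G F)" "?h \<in> carrier (group_G F)" using gh mem_carrier_G by blast+
  define k where "k = ?g \<otimes>\<^bsub>group_G F\<^esub> inv\<^bsub>group_G F\<^esub> ?h"
  have kG: "k \<in> carrier (group_G F)" unfolding k_def using c by simp
  have kH: "k \<in> semi_affine"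
    unfolding k_def using gh group_G_subgroups(2) by (simp add: subgroup.m_closed subgroup.m_inv_closed)
  have g: "?g = k \<otimes>\<^bsub>group_G F\<^esub> ?h" unfolding k_def using c by (simp add: m_assoc)
  obtain s1 x1 y1 z1 w1 u1 v1 t1 where k: "k = smap s1 x1 y1 z1 w1 u1 v1 t1" "field_aut s1"
    "x1 * w1 - y1 * z1 \<noteq> 0" using kH by (rule semi_affineE)
  have "smap s x y z w u v t = smap s' x' y' z' w' u' v' t' \<circ> smap s1 x1 y1 z1 w1 u1 v1 t1"
    using g unfolding k(1) group_G_simps(2) .
  then have xz: "x = x' * s' x1 + y' * s' z1" "z = z' * s' x1 + w' * s' z1"
    unfolding smap_comp[OF s'(1)] smap_eq_iff[OF s(1) field_aut_comp[OF s'(1) k(2)] s(2)] by simp_all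
  have "?L = ?R \<longleftrightarrow> k \<in> semi_triangular"
  proof
    assume "?L = ?R"
    then obtain h where "h \<in> semi_triangular" "?g = h \<otimes>\<^bsub>group_G F\<^esub> ?h"
      using rcos_eq_iff_factor[OF group_G_subgroups(3) c] by blast
    moreover from this have "h = k"
      using g c kG mem_carrier_G(2) right_cancel by metis
    ultimately show "k \<in> semi_triangular" by simp
  next
    assume "k \<in> semi_triangular"
    then show "?L = ?R" using rcos_eq_iff_factor[OF group_G_subgroups(3) c] g by blast
  qed
  also have "\<dots> \<longleftrightarrow> z1 = 0" unfolding k(1) by (rule smap_mem_semi_triangular[OF k(2,3)])
  also have "\<dots> \<longleftrightarrow> s' z1 * (x' * w' - y' * z') = 0"
    using s'(2) by (simp add: field_aut_eq_0[OF s'(1)])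
  also have "s' z1 * (x' * w' - y' * z') = x' * z - x * z'"
    unfolding xz by (simp add: algebra_simps)
  finally show ?thesis by auto
qed

lemma coset_smap:
  assumes s: "field_aut s" "x * w - y * z \<noteq> 0"
  shows "semi_triangular #>\<^bsub>group_G F\<^esub> smap s x y z w u v t = line x z"
proof (cases "x = 0")
  case True
  then have z: "z \<noteq> 0" using assms by auto
  show ?thesis
    unfolding line_def if_P[OF True]
    by (subst coset_smap_eq_iff[OF s field_aut_id(2)]) (simp_all add: True z)
next
  case False
  show ?thesis
    unfolding line_def if_not_P[OF False]
    by (subst coset_smap_eq_iff[OF s field_aut_id(2)]) (simp_all add: False)
qed

lemma line_rep:
  assumes "p \<noteq> 0 \<or> q \<noteq> 0"
  obtains y w where "p * w - y * q \<noteq> 0" "line p q = semi_triangular #>\<^bsub>group_G F\<^esub> smap id p y q w 0 0 0"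
proof (cases "p = 0")
  case True
  then show ?thesis using that[of 0 1] assms by (simp add: line_def)
next
  case False
  then show ?thesis using that[of 1 0] by (simp add: line_def)
qed

lemma line_eq_iff:
  assumes "p \<noteq> 0 \<or> q \<noteq> 0" "p' \<noteq> 0 \<or> q' \<noteq> 0"
  shows "line p q = line p' q' \<longleftrightarrow> p * q' = p' * q"
proof -
  obtain y w where 1: "p * w - y * q \<noteq> 0"
    "line p q = semi_triangular #>\<^bsub>group_G F\<^esub> smap id p y q w 0 0 0"
    using line_rep[OF assms(1)] .
  obtain y' w' where 2: "p' * w' - y' * q' \<noteq> 0"
    "line p' q' = semi_triangular #>\<^bsub>group_G F\<^esub> smap id p' y' q' w' 0 0 0"
    using line_rep[OF assms(2)] .
  show ?thesis
    unfolding 1(2) 2(2) by (rule coset_smap_eq_iff[OF field_aut_id(2) 1(1) field_aut_id(2) 2(1)])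
qed

lemma line_act:
  assumes s: "field_aut s" "x * w - y * z \<noteq> 0" and pq: "p \<noteq> 0 \<or> q \<noteq> 0"
  shows "line p q #>\<^bsub>group_G F\<^esub> smap s x y z w u v t = line (x * s p + y * s q) (z * s p + w * s q)"
proof -
  interpret group "group_G F" by (rule group_group_G)
  obtain y' w' where 1: "p * w' - y' * q \<noteq> 0"
    "line p q = semi_triangular #>\<^bsub>group_G F\<^esub> smap id p y' q w' 0 0 0"
    using line_rep[OF pq] .
  let ?h = "smap id p y' q w' 0 0 0" and ?g = "smap s x y z w u v t"
  have c: "?g \<in> carrier (group_G F)" "?h \<in> carrier (group_G F)"
    using smap_mem[OF s] smap_mem[OF field_aut_id(2) 1(1)] mem_carrier_G by blast+
  have det: "(x * s p + y * s q) * (z * s y' + w * s w')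
        - (x * s y' + y * s w') * (z * s p + w * s q) = (x * w - y * z) * s (p * w' - y' * q)"
    by (simp add: field_aut_add[OF s(1)] field_aut_diff[OF s(1)] field_aut_mult[OF s(1)] algebra_simps)
  have "line p q #>\<^bsub>group_G F\<^esub> ?g = semi_triangular #>\<^bsub>group_G F\<^esub> (?g \<circ> ?h)"
    unfolding 1(2) using coset_mult_assoc[OF subgroup.subset[OF group_G_subgroups(3)] c(2,1)]
    by (simp add: group_G_simps(2))
  also have "\<dots> = line (x * s p + y * s q) (z * s p + w * s q)"
    unfolding smap_comp[OF s(1)]
    by (rule coset_smap[OF field_aut_comp[OF s(1) field_aut_id(2)]])
      (simp only: det mult_eq_0_iff field_aut_eq_0[OF s(1)] 1(1) s(2) simp_thms)
  finally show ?thesis .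
qed

text \<open>Conjugation by \<delta> replaces the matrix by its cofactor matrix; in particular it
  exchanges the diagonal entries.\<close>

lemma delta_conj:
  "smap s x y z w u v t \<circ> perm_delta = perm_delta \<circ> smap s w (- z) (- y) x (- v) u t"
  if "field_aut s"
  by (auto simp: fun_eq_iff perm_delta_def smap_def field_aut_uminus[OF that] mult.commute)

text \<open>An element of the core lies in the kernels of the actions on the two base neighbourhoods,
  hence is a translation; conjugating with \<open>\<tau>\<^sub>1\<close> and \<open>\<delta>\<close> shows that it is trivial.\<close>

lemma core_free:
  assumes g: "g \<in> carrier (group_G F)"
    and fixH: "\<And>a. a \<in> carrier (group_G F) \<Longrightarrow>
      semi_affine #>\<^bsub>group_G F\<^esub> (a \<otimes>\<^bsub>group_G F\<^esub> g) = semi_affine #>\<^bsub>group_G F\<^esub> a"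
    and fixK: "\<And>a. a \<in> carrier (group_G F) \<Longrightarrow>
      semi_triangular #>\<^bsub>group_G F\<^esub> (a \<otimes>\<^bsub>group_G F\<^esub> g) = semi_triangular #>\<^bsub>group_G F\<^esub> a"
  shows "g = \<one>\<^bsub>group_G F\<^esub>"
proof -
  interpret group "group_G F" by (rule group_group_G)
  \<comment> \<open>The kernel of the action on one type of cosets. Being closed under conjugation,
    it allows every restriction on its elements to be applied to their conjugates as well.\<close>
  define core where "core L = {h \<in> carrier (group_G F). \<forall>a\<in>carrier (group_G F).
    L #>\<^bsub>group_G F\<^esub> (a \<otimes>\<^bsub>group_G F\<^esub> h) = L #>\<^bsub>group_G F\<^esub> a}" for L
  define N where "N = core semi_affine \<inter> core semi_triangular"
  have core_sub: "h \<in> L" if h: "h \<in> core L" and L: "subgroup L (group_G F)" for h L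
  proof -
    have hc: "h \<in> carrier (group_G F)" using h by (simp add: core_def)
    moreover have "L #>\<^bsub>group_G F\<^esub> (\<one>\<^bsub>group_G F\<^esub> \<otimes>\<^bsub>group_G F\<^esub> h) = L #>\<^bsub>group_G F\<^esub> \<one>\<^bsub>group_G F\<^esub>"
      using h unfolding core_def by blast
    ultimately show "h \<in> L"
      using coset_join1[OF _ hc L] coset_mult_one[OF subgroup.subset[OF L]] by simp
  qed
  have core_conj: "h' \<in> core L" if h: "h \<in> core L" and L: "subgroup L (group_G F)"
    and b: "b \<in> carrier (group_G F)" and h': "h' \<in> carrier (group_G F)"
    and eq: "b \<otimes>\<^bsub>group_G F\<^esub> h = h' \<otimes>\<^bsub>group_G F\<^esub> b" for h h' b L
  proof -
    have hc: "h \<in> carrier (group_G F)" using h by (simp add: core_def)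
    have "L #>\<^bsub>group_G F\<^esub> (a \<otimes>\<^bsub>group_G F\<^esub> h') = L #>\<^bsub>group_G F\<^esub> a" if a: "a \<in> carrier (group_G F)" for a
    proof -
      have "a \<otimes>\<^bsub>group_G F\<^esub> h' = a \<otimes>\<^bsub>group_G F\<^esub> (h' \<otimes>\<^bsub>group_G F\<^esub> b) \<otimes>\<^bsub>group_G F\<^esub> inv\<^bsub>group_G F\<^esub> b"
        using a b h' by (simp add: m_assoc)
      also have "\<dots> = a \<otimes>\<^bsub>group_G F\<^esub> b \<otimes>\<^bsub>group_G F\<^esub> h \<otimes>\<^bsub>group_G F\<^esub> inv\<^bsub>group_G F\<^esub> b"
        unfolding eq[symmetric] using a b hc by (simp add: m_assoc)
      finally have "L #>\<^bsub>group_G F\<^esub> (a \<otimes>\<^bsub>group_G F\<^esub> h')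
        = L #>\<^bsub>group_G F\<^esub> (a \<otimes>\<^bsub>group_G F\<^esub> b \<otimes>\<^bsub>group_G F\<^esub> h) #>\<^bsub>group_G F\<^esub> inv\<^bsub>group_G F\<^esub> b"
        using a b hc by (simp add: coset_mult_assoc subgroup.subset[OF L])
      also have "\<dots> = L #>\<^bsub>group_G F\<^esub> (a \<otimes>\<^bsub>group_G F\<^esub> b) #>\<^bsub>group_G F\<^esub> inv\<^bsub>group_G F\<^esub> b"
        using h m_closed[OF a b] unfolding core_def by simp
      also have "\<dots> = L #>\<^bsub>group_G F\<^esub> a"
        using a b by (simp add: coset_mult_assoc subgroup.subset[OF L] m_assoc)
      finally show ?thesis .
    qed
    then show ?thesis using h' by (simp add: core_def)
  qed
  have N_sub: "h \<in> semi_affine" "h \<in> semi_triangular" if "h \<in> N" for h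
    using that core_sub group_G_subgroups by (auto simp: N_def)
  have N_conj: "h' \<in> N" if "h \<in> N" "b \<in> carrier (group_G F)" "h' \<in> carrier (group_G F)" "h \<circ> b = b \<circ> h'" for h h' b
    using that core_conj[OF _ group_G_subgroups(2), of h b h'] core_conj[OF _ group_G_subgroups(3), of h b h']
    by (simp add: N_def group_G_simps(2))
  have dc: "perm_delta \<in> carrier (group_G F)" "perm_tau 1 \<in> carrier (group_G F)"
    "perm_alpha u v t \<in> carrier (group_G F)" for u v t
    using generators_mem mem_carrier_G by blast+
  \<comment> \<open>All neighbours \<tau>_c are fixed, so c = l / m^2 s(c) for every c: c = 1 gives
    l = m^2, and then s is trivial. Membership in \<open>semi_affine\<close> removes d.\<close>
  have shape: "\<exists>s l m e u v t. h = bmap s l m e 0 u v t \<and> field_aut s \<and> l \<noteq> 0 \<and> m \<noteq> 0 \<and> l = m\<^sup>2 \<and> s = id"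
    if h: "h \<in> N" for h
  proof -
    obtain s l m e d u v t where 1: "h = bmap s l m e d u v t" "field_aut s" "l \<noteq> 0" "m \<noteq> 0"
      using N_sub(2)[OF h] by (rule semi_triangularE)
    have d: "d = 0" using N_sub(1)[OF h] 1 by (simp add: bmap_mem_semi_affine)
    have "c = l / m\<^sup>2 * s c" for c
    proof -
      have "semi_affine #>\<^bsub>group_G F\<^esub> (perm_tau c \<otimes>\<^bsub>group_G F\<^esub> h) = semi_affine #>\<^bsub>group_G F\<^esub> perm_tau c"
        using h generators_mem(1) mem_carrier_G(2) by (simp add: N_def core_def)
      then show ?thesis
        using coset_tau_act[OF 1(2-4), of c e d u v t] coset_tau_eq_iff unfolding 1(1) d by auto
    qed
    note c = this
    have lm: "l = m\<^sup>2" using c[of 1] 1(3,4) by (simp add: field_aut_1[OF 1(2)])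
    then have "s = id" using c 1(4) by (auto simp: fun_eq_iff)
    then show ?thesis using 1 d lm by blast
  qed
  \<comment> \<open>The conjugate by \<delta> has l and m exchanged and - e as lower left entry. So
    e = 0 and also m = l^2, whence m^3 = 1 and m = 1 in characteristic 3.\<close>
  have transl: "\<exists>u v t. h = perm_alpha u v t" if h: "h \<in> N" for h
  proof -
    obtain l m e u v t where 1: "h = bmap id l m e 0 u v t" "l \<noteq> 0" "m \<noteq> 0" "l = m\<^sup>2"
      using shape[OF h] by blast
    have h1: "h = smap id l e 0 m u v t" unfolding 1 by (simp add: bmap_eq_smap)
    let ?h' = "smap id m 0 (- e) l (- v) u t"
    have "?h' \<in> semi_affine" using 1 by (intro smap_mem field_aut_id) auto
    then have h': "?h' \<in> N"
      using N_conj[OF h dc(1), of ?h'] delta_conj[OF field_aut_id(2), of l e 0 m u v t] mem_carrier_G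
      unfolding h1 by simp
    then have "e = 0"
      using N_sub(2)[OF h'] smap_mem_semi_triangular[OF field_aut_id(2), of m l 0 "- e"] 1 by simp
    then have h'b: "?h' = bmap id m l 0 0 (- v) u t" by (simp add: bmap_eq_smap)
    obtain l' m' e' u' v' t' where "?h' = bmap id l' m' e' 0 u' v' t'" "l' = m'\<^sup>2"
      using shape[OF h'] by blast
    then have "m = l\<^sup>2" unfolding h'b using bmap_eq_iff[OF field_aut_id(2) field_aut_id(2) 1(3)] by metis
    then have "m = m * m ^ 3" using 1(4) by (simp add: power2_eq_square power3_eq_cube mult.assoc)
    then have "m ^ 3 = 1" using 1(3) by simp
    then have "m = 1" using cbrt_cube(1)[of m] by (simp add: cbrt_simps)
    then show ?thesis using 1 \<open>e = 0\<close> by (auto simp: perm_alpha_bmap[symmetric])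
  qed
  \<comment> \<open>Conjugating by \<tau>_1 puts v into the corner entry and changes u to u - v^2 -
    t; the conjugate is again a translation, so v = 0.\<close>
  have tau: "v = 0 \<and> perm_alpha (u - t) 0 t \<in> N" if h: "perm_alpha u v t \<in> N" for u v t
  proof -
    let ?h' = "bmap id 1 1 v 0 (u - v\<^sup>2 - t) v t"
    have h'b: "?h' \<in> semi_triangular" by (intro bmap_mem field_aut_id) auto
    have "perm_alpha u v t \<circ> perm_tau 1 = perm_tau 1 \<circ> ?h'"
      unfolding perm_alpha_bmap bmap_comp_tau[OF field_aut_id(2)] tau_comp_bmap[OF one_neq_zero]
      by (simp add: cbrt_simps)
    then have h': "?h' \<in> N" using N_conj[OF h dc(2)] h'b mem_carrier_G by blast
    then obtain u' v' t' where "?h' = bmap id 1 1 0 0 u' v' t'"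
      using transl[OF h'] by (auto simp: perm_alpha_bmap)
    then have "v = 0" using bmap_eq_iff[OF field_aut_id(2) field_aut_id(2) one_neq_zero] by metis
    then show ?thesis using h' by (simp add: perm_alpha_bmap[symmetric])
  qed
  have delta: "perm_alpha (- v) u t \<in> N" if h: "perm_alpha u v t \<in> N" for u v t
  proof -
    have "perm_alpha u v t \<circ> perm_delta = perm_delta \<circ> perm_alpha (- v) u t"
      using delta_conj[OF field_aut_id(2), of 1 0 0 1 u v t] by (simp add: perm_alpha_smap)
    then show ?thesis using N_conj[OF h dc(1) dc(3)] by blast
  qed
  have "g \<in> N" using assms by (simp add: N_def core_def)
  then obtain u v t where g: "g = perm_alpha u v t" "perm_alpha u v t \<in> N" using transl by blast
  have "v = 0" using tau g(2) by blast
  moreover have "u = 0" using tau delta g(2) by blast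
  \<comment> \<open>\<open>tau\<close> turns the vector into (u - t, 0, t) and \<open>delta\<close>
    into (0, u - t, t), to which \<open>tau\<close> applies once more.\<close>
  moreover have "u - t = 0" using tau delta tau[OF g(2)] by blast
  ultimately show ?thesis
    unfolding g(1) group_G_simps by (simp add: fun_eq_iff perm_alpha_def)
qed

sublocale G: coset_pair "group_G F" semi_affine semi_triangular
proof -
  interpret group "group_G F" by (rule group_group_G)
  interpret S: group "SymOmega :: 'a perm monoid" by (rule group_symm_group)
  have "perm_tau (1::'a) \<in> semi_triangular" "perm_tau (1::'a) \<notin> semi_affine"
    using generators_mem(1) bmap_mem_semi_affine[OF field_aut_id(2)] by (simp_all add: perm_tau_bmap)
  then have neq: "semi_affine \<noteq> semi_triangular" by blast
  have "semi_affine \<union> semi_triangular \<subseteq> carrier (group_G F)" using mem_carrier_G by blast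
  then have gen: "generate (group_G F) (semi_affine \<union> semi_triangular) = carrier (group_G F)"
    using S.generate_consistent[OF _ group_G_subgroups(1)] by (simp add: group_G_def grp_G1_eq grp_G2_eq)
  show "coset_pair (group_G F) semi_affine semi_triangular"
  proof (intro coset_pair.intro coset_pair_axioms.intro)
    show "finite (carrier (group_G F))" by simp
  qed (use group_group_G group_G_subgroups neq gen core_free in auto)
qed

lemma coset_graph_eq: "coset_graph F = G.\<Gamma>" "right_mult F = G.\<rho>"
proof -
  show 1: "coset_graph F = G.\<Gamma>"
    by (simp add: coset_graph_def coset_graph_on_def grp_G1_eq grp_G2_eq)
  show "right_mult F = G.\<rho>"
    unfolding right_mult_def[abs_def] coset_action_def[abs_def] 1 ..
qed

end

lemma (in group) normal_in_subgroupI: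
  assumes N: "subgroup N G" and L: "subgroup L G" and "N \<subseteq> L"
    and conj: "\<And>x h. x \<in> L \<Longrightarrow> h \<in> N \<Longrightarrow> \<exists>h'\<in>N. x \<otimes> h = h' \<otimes> x"
  shows "N \<lhd> G\<lparr>carrier := L\<rparr>"
proof -
  interpret L: group "G\<lparr>carrier := L\<rparr>" using subgroup.subgroup_is_group[OF L is_group] .
  have inv: "inv\<^bsub>G\<lparr>carrier := L\<rparr>\<^esub> x = inv x" if "x \<in> L" for x
    using m_inv_consistent[OF L that] .
  show ?thesis
  proof (rule L.normal_invI)
    show "subgroup N (G\<lparr>carrier := L\<rparr>)" by (rule subgroup_incl[OF N L \<open>N \<subseteq> L\<close>])
    fix x h assume x: "x \<in> carrier (G\<lparr>carrier := L\<rparr>)" and h: "h \<in> N"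
    then obtain h' where h': "h' \<in> N" "x \<otimes> h = h' \<otimes> x" using conj[of x h] by auto
    have c: "x \<in> carrier G" "h' \<in> carrier G"
      using x h' subgroup.subset[OF L] subgroup.subset[OF N] by auto
    have "x \<otimes> h \<otimes> inv x = h'" unfolding h'(2) using c by (simp add: m_assoc)
    then show "x \<otimes>\<^bsub>G\<lparr>carrier := L\<rparr>\<^esub> h \<otimes>\<^bsub>G\<lparr>carrier := L\<rparr>\<^esub> inv\<^bsub>G\<lparr>carrier := L\<rparr>\<^esub> x \<in> N"
      using h'(1) x inv[of x] by simp
  qed
qed

section \<open>Neighbourhoods of the two base vertices\<close>

context field_char_3
begin

abbreviation cosH where "cosH a \<equiv> semi_affine #>\<^bsub>group_G F\<^esub> a"
abbreviation cosK where "cosK a \<equiv> semi_triangular #>\<^bsub>group_G F\<^esub> a"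

lemma line_0: "line 1 0 = semi_triangular"
  using coset_smap[OF field_aut_id(2), of 1 1 0 0 0 0 0] G.base_cosets(2)
  by (simp add: group_G_simps(3) flip: perm_alpha_smap) (simp add: perm_alpha_def id_def case_prod_unfold)

lemma tau_0: "perm_tau 0 = (id :: 'a perm)"
  by (auto simp: fun_eq_iff perm_tau_bmap bmap_def cbrt_simps)

lemma action_tau:
  assumes "field_aut s" "l \<noteq> 0" "m \<noteq> 0"
  shows "G.\<rho> (bmap s l m e d u v t) (cosH (perm_tau c)) = cosH (perm_tau (l / m\<^sup>2 * (s c + d)))"
  using G.action_coset(1)[OF mem_carrier_G(2)[OF generators_mem(1)] mem_carrier_G(2)[OF bmap_mem[OF assms]]]
    coset_tau_act[OF assms] by simp

lemma line_in_verts: "p \<noteq> 0 \<or> q \<noteq> 0 \<Longrightarrow> line p q \<in> verts G.\<Gamma>"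
proof -
  assume "p \<noteq> 0 \<or> q \<noteq> 0"
  then obtain y w where *: "p * w - y * q \<noteq> 0" "line p q = cosK (smap id p y q w 0 0 0)"
    by (rule line_rep)
  show ?thesis
    unfolding *(2) by (rule G.coset_in_verts(2)[OF mem_carrier_G(1)[OF smap_mem[OF field_aut_id(2) *(1)]]])
qed

lemma action_line:
  assumes "field_aut s" "x * w - y * z \<noteq> 0" and pq: "p \<noteq> 0 \<or> q \<noteq> 0"
  shows "G.\<rho> (smap s x y z w u v t) (line p q) = line (x * s p + y * s q) (z * s p + w * s q)"
  using line_act[OF assms] line_in_verts[OF pq] by (simp add: coset_action_def)

lemma nbrs_triangular: "nbrs G.\<Gamma> semi_triangular = range (\<lambda>d. cosH (perm_tau d))"
  unfolding G.nbrs_base_K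
proof (intro subset_antisym subsetI)
  fix X assume "X \<in> (#>\<^bsub>group_G F\<^esub>) semi_affine ` semi_triangular"
  then obtain g where g: "g \<in> semi_triangular" "X = cosH g" by blast
  obtain s l m e d u v t where *: "g = bmap s l m e d u v t" "field_aut s" "l \<noteq> 0" "m \<noteq> 0"
    using g(1) by (rule semi_triangularE)
  have "X = cosH (perm_tau 0 \<otimes>\<^bsub>group_G F\<^esub> g)" by (simp add: g(2) group_G_simps(2) tau_0)
  then have "X = cosH (perm_tau (l / m\<^sup>2 * (s 0 + d)))"
    unfolding *(1) by (simp only: coset_tau_act[OF *(2-4)])
  then show "X \<in> range (\<lambda>d. cosH (perm_tau d))" by (rule range_eqI)
qed (use generators_mem(1) in blast)

lemma nbrs_affine: "nbrs G.\<Gamma> semi_affine = {line p q | p q. p \<noteq> 0 \<or> q \<noteq> 0}"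
  unfolding G.nbrs_base_H
proof (intro subset_antisym subsetI)
  fix X assume "X \<in> (#>\<^bsub>group_G F\<^esub>) semi_triangular ` semi_affine"
  then obtain g where g: "g \<in> semi_affine" "X = cosK g" by blast
  obtain s x y z w u v t where *: "g = smap s x y z w u v t" "field_aut s" "x * w - y * z \<noteq> 0"
    using g(1) by (rule semi_affineE)
  have "X = line x z" unfolding g(2) *(1) by (rule coset_smap[OF *(2,3)])
  moreover have "x \<noteq> 0 \<or> z \<noteq> 0" using *(3) by auto
  ultimately show "X \<in> {line p q | p q. p \<noteq> 0 \<or> q \<noteq> 0}" by blast
next
  fix X assume "X \<in> {line p q | p q. p \<noteq> 0 \<or> q \<noteq> 0}"
  then obtain p q where X: "X = line p q" "p \<noteq> 0 \<or> q \<noteq> 0" by blast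
  obtain y w where *: "p * w - y * q \<noteq> 0" "line p q = cosK (smap id p y q w 0 0 0)"
    using line_rep[OF X(2)] .
  then show "X \<in> (#>\<^bsub>group_G F\<^esub>) semi_triangular ` semi_affine"
    unfolding X(1) using smap_mem[OF field_aut_id(2) *(1)] by blast
qed

text \<open>The projective line as one point at infinity and q affine points, the form suited to
  counting.\<close>

lemma nbrs_affine_alt: "nbrs G.\<Gamma> semi_affine = insert (line 1 0) (range (\<lambda>e. line e 1))"
proof -
  have "line p q \<in> insert (line 1 0) (range (\<lambda>e. line e 1))" if "p \<noteq> 0 \<or> q \<noteq> 0" for p q
  proof (cases "q = 0")
    case True
    then have "line p q = line 1 0" using that line_eq_iff[of p q 1 0] by simp
    then show ?thesis by simp
  next
    case False
    then have "line p q = line (p / q) 1" using line_eq_iff[of p q "p / q" 1] by simp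
    then show ?thesis by (intro insertI2) (rule range_eqI)
  qed
  moreover have "line 1 0 \<in> nbrs G.\<Gamma> semi_affine" "line e 1 \<in> nbrs G.\<Gamma> semi_affine" for e
    unfolding nbrs_affine mem_Collect_eq using one_neq_zero by metis+
  ultimately show ?thesis by (auto simp: nbrs_affine)
qed

lemma card_nbrs_affine: "card (nbrs G.\<Gamma> semi_affine) = 3 ^ r + 1"
proof -
  have "inj (\<lambda>e. line e 1)" by (rule injI) (simp add: line_eq_iff)
  moreover have "line 1 0 \<notin> range (\<lambda>e. line e 1)" by (auto simp: line_eq_iff)
  ultimately show ?thesis
    unfolding nbrs_affine_alt by (simp add: card_image CARD)
qed

lemma card_nbrs_triangular: "card (nbrs G.\<Gamma> semi_triangular) = 3 ^ r"
proof -
  have "inj (\<lambda>d. cosH (perm_tau d))" by (rule injI) (simp add: coset_tau_eq_iff)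
  then show ?thesis unfolding nbrs_triangular by (simp add: card_image CARD)
qed

section \<open>Local kernels and their \<open>3\<close>-cores\<close>

text \<open>The group A of the construction, as a parametrized set.\<close>

definition translation_group :: "'a perm set" where
  "translation_group = range (\<lambda>(u, v, t). perm_alpha u v t)"

text \<open>The group Q = AC of the construction, as a parametrized set.\<close>

definition unipotent_group :: "'a perm set" where
  "unipotent_group = range (\<lambda>(e, u, v, t). bmap id 1 1 e 0 u v t)"

lemma perm_alpha_mem: "perm_alpha u v t \<in> translation_group"
  unfolding translation_group_def by (rule range_eqI[of _ _ "(u, v, t)"]) simp

lemma unipotent_mem: "bmap id 1 1 e 0 u v t \<in> unipotent_group"
  unfolding unipotent_group_def by (rule range_eqI[of _ _ "(e, u, v, t)"]) simp

lemma translation_groupE: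
  assumes "g \<in> translation_group" obtains u v t where "g = perm_alpha u v t"
  using assms unfolding translation_group_def by auto

lemma unipotent_groupE:
  assumes "g \<in> unipotent_group" obtains e u v t where "g = bmap id 1 1 e 0 u v t"
  using assms unfolding unipotent_group_def by auto

text \<open>Fixing the lines through (1, 0), (0, 1) and (1, 1) makes the matrix scalar; fixing those
  through (c, 1) makes the field automorphism trivial.\<close>

lemma local_kernel_affine:
  "carrier (local_kernel G.\<Gamma> (group_G F) G.\<rho> semi_affine) = {smap id x 0 0 x u v t | x u v t. x \<noteq> 0}"
proof (intro subset_antisym subsetI)
  fix g assume "g \<in> carrier (local_kernel G.\<Gamma> (group_G F) G.\<rho> semi_affine)"
  then have g: "g \<in> semi_affine" and fix_line: "\<And>p q. p \<noteq> 0 \<or> q \<noteq> 0 \<Longrightarrow> G.\<rho> g (line p q) = line p q"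
    by (auto simp: local_kernel_def G.stabilizer_H nbrs_affine)
  obtain s x y z w u v t where *: "g = smap s x y z w u v t" "field_aut s" "x * w - y * z \<noteq> 0"
    using g by (rule semi_affineE)
  have lin: "(x * s p + y * s q) * q = p * (z * s p + w * s q)" if pq: "p \<noteq> 0 \<or> q \<noteq> 0" for p q
  proof -
    \<comment> \<open>\<open>line_eq_iff\<close> speaks of nonzero vectors only; invertibility of
      the matrix provides this for the image.\<close>
    have "x * s p + y * s q \<noteq> 0 \<or> z * s p + w * s q \<noteq> 0"
    proof (rule ccontr)
      assume "\<not> ?thesis"
      then have 0: "x * s p + y * s q = 0" "z * s p + w * s q = 0" by simp_all
      have "(x * w - y * z) * s p = w * (x * s p + y * s q) - y * (z * s p + w * s q)"
        "(x * w - y * z) * s q = x * (z * s p + w * s q) - z * (x * s p + y * s q)"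
        by (simp_all add: algebra_simps)
      then show False using *(3) pq unfolding 0 by (simp add: field_aut_eq_0[OF *(2)])
    qed
    then show ?thesis
      using fix_line[OF pq] line_eq_iff[OF _ pq] unfolding *(1) action_line[OF *(2,3) pq] by blast
  qed
  note s01 = field_aut_0[OF *(2)] field_aut_1[OF *(2)]
  have z: "z = 0" using lin[of 1 0] by (simp add: s01)
  have y: "y = 0" using lin[of 0 1] by (simp add: s01)
  have w: "w = x" using lin[of 1 1] y z by (simp add: s01)
  have x: "x \<noteq> 0" using *(3) y w by auto
  have "s c = c" for c using lin[of c 1] x y z w by (simp add: s01 mult.commute)
  then have "s = id" by auto
  then show "g \<in> {smap id x 0 0 x u v t | x u v t. x \<noteq> 0}" using *(1) x y z w by blast
next
  fix g assume "g \<in> {smap id x 0 0 x u v t | x u v t. x \<noteq> 0}"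
  then obtain x u v t where g: "g = smap id x 0 0 x u v t" "x \<noteq> 0" by blast
  have det: "x * x - 0 * 0 \<noteq> 0" using g(2) by simp
  have "G.\<rho> g (line p q) = line p q" if pq: "p \<noteq> 0 \<or> q \<noteq> 0" for p q
    unfolding g(1) action_line[OF field_aut_id(2) det pq] using g(2) pq
    by (subst line_eq_iff) auto
  moreover have "g \<in> semi_affine" unfolding g(1) by (rule smap_mem[OF field_aut_id(2) det])
  ultimately show "g \<in> carrier (local_kernel G.\<Gamma> (group_G F) G.\<rho> semi_affine)"
    using mem_carrier_G(1) by (auto simp: local_kernel_def G.stabilizer_H nbrs_affine)
qed

text \<open>The index c is moved to l / m^2 (s(c) + d). Fixing c = 0 gives d = 0, fixing c = 1 gives
  l = m^2, and then s fixes every c.\<close>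

lemma local_kernel_triangular:
  "carrier (local_kernel G.\<Gamma> (group_G F) G.\<rho> semi_triangular) =
    {bmap id (m\<^sup>2) m e 0 u v t | m e u v t. m \<noteq> 0}"
proof (intro subset_antisym subsetI)
  fix g assume "g \<in> carrier (local_kernel G.\<Gamma> (group_G F) G.\<rho> semi_triangular)"
  then have g: "g \<in> semi_triangular" and fix_c: "\<And>c. G.\<rho> g (cosH (perm_tau c)) = cosH (perm_tau c)"
    by (auto simp: local_kernel_def G.stabilizer_K nbrs_triangular)
  obtain s l m e d u v t where *: "g = bmap s l m e d u v t" "field_aut s" "l \<noteq> 0" "m \<noteq> 0"
    using g by (rule semi_triangularE)
  have c: "l / m\<^sup>2 * (s c + d) = c" for c
    using fix_c[of c] unfolding *(1) action_tau[OF *(2-4)] coset_tau_eq_iff .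
  have d: "d = 0" using c[of 0] *(3,4) by (simp add: field_aut_0[OF *(2)])
  have l: "l = m\<^sup>2" using c[of 1] *(4) d by (simp add: field_aut_1[OF *(2)])
  have "s = id" using c d l *(4) by (auto simp: fun_eq_iff)
  then show "g \<in> {bmap id (m\<^sup>2) m e 0 u v t | m e u v t. m \<noteq> 0}" using * d l by blast
next
  fix g assume "g \<in> {bmap id (m\<^sup>2) m e 0 u v t | m e u v t. m \<noteq> 0}"
  then obtain m e u v t where g: "g = bmap id (m\<^sup>2) m e 0 u v t" "m \<noteq> 0" by blast
  have m2: "m\<^sup>2 \<noteq> 0" using g(2) by simp
  have "G.\<rho> g (cosH (perm_tau c)) = cosH (perm_tau c)" for c
    unfolding g(1) action_tau[OF field_aut_id(2) m2 g(2)] using g(2) by simp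
  moreover have "g \<in> semi_triangular" unfolding g(1) by (rule bmap_mem[OF field_aut_id(2) m2 g(2)])
  ultimately show "g \<in> carrier (local_kernel G.\<Gamma> (group_G F) G.\<rho> semi_triangular)"
    using mem_carrier_G(2) by (auto simp: local_kernel_def G.stabilizer_K nbrs_triangular)
qed

lemma translation_group_subset: "translation_group \<subseteq> unipotent_group" "translation_group \<subseteq> semi_affine"
    "unipotent_group \<subseteq> semi_triangular" "unipotent_group \<subseteq> semi_affine"
  using unipotent_mem by (auto simp: perm_alpha_bmap bmap_mem field_aut_id bmap_mem_semi_affine
      elim!: translation_groupE unipotent_groupE)

lemma subgroup_translation_group: "subgroup translation_group (group_G F)"
proof (rule G.subgroup_of_finite)
  show "translation_group \<subseteq> carrier (group_G F)" using translation_group_subset(2) mem_carrier_G(1) by blast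
  show "translation_group \<noteq> {}" using perm_alpha_mem by blast
  show "f \<otimes>\<^bsub>group_G F\<^esub> g \<in> translation_group" if fg: "f \<in> translation_group" "g \<in> translation_group" for f g
  proof -
    obtain u v t where f: "f = perm_alpha u v t" using fg(1) by (rule translation_groupE)
    obtain u' v' t' where g: "g = perm_alpha u' v' t'" using fg(2) by (rule translation_groupE)
    have "g \<circ> f = perm_alpha (u + u') (v + v') (t + t')"
      unfolding f g by (auto simp: fun_eq_iff perm_alpha_def)
    then show ?thesis by (simp add: group_G_simps(2) perm_alpha_mem)
  qed
qed simp

lemma subgroup_unipotent_group: "subgroup unipotent_group (group_G F)"
proof (rule G.subgroup_of_finite)
  show "unipotent_group \<subseteq> carrier (group_G F)" using translation_group_subset(3) mem_carrier_G(2) by blast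
  show "unipotent_group \<noteq> {}" using unipotent_mem by blast
  show "f \<otimes>\<^bsub>group_G F\<^esub> g \<in> unipotent_group" if fg: "f \<in> unipotent_group" "g \<in> unipotent_group" for f g
  proof -
    obtain e u v t where f: "f = bmap id 1 1 e 0 u v t" using fg(1) by (rule unipotent_groupE)
    obtain e' u' v' t' where g: "g = bmap id 1 1 e' 0 u' v' t'" using fg(2) by (rule unipotent_groupE)
    have "g \<circ> f = bmap id 1 1 (e + e') 0 (u + e' * v + u') (v + v') (t + t')"
      unfolding f g bmap_comp[OF field_aut_id(2) one_neq_zero] by (simp add: cbrt_simps id_def)
    then show ?thesis by (simp add: group_G_simps(2) unipotent_mem)
  qed
qed simp

text \<open>Normality of A in G1, written without inverses: the vector is pulled back through the
  matrix by Cramer's rule and then through the field automorphism.\<close>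

lemma translation_group_conj:
  assumes x: "x \<in> semi_affine" and h: "h \<in> translation_group"
  shows "\<exists>h'\<in>translation_group. h \<circ> x = x \<circ> h'"
proof -
  obtain s a b c d u v t where *: "x = smap s a b c d u v t" "field_aut s" "a * d - b * c \<noteq> 0"
    using x by (rule semi_affineE)
  obtain u' v' t' where h: "h = perm_alpha u' v' t'" using h by (rule translation_groupE)
  define D where "D = a * d - b * c"
  obtain U V T where U: "s U = (d * u' - b * v') / D" and V: "s V = (a * v' - c * u') / D"
    and T: "s T = t' / (cbrt D)\<^sup>2" using field_aut_surjE[OF *(2)] by metis
  have D: "D \<noteq> 0" "(cbrt D)\<^sup>2 \<noteq> 0" using *(3) by (simp_all add: D_def cbrt_eq_0)
  have "D * (a * s U + b * s V) = D * u'" "D * (c * s U + d * s V) = D * v'"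
    using D unfolding U V by (simp_all add: distrib_left) (simp_all add: D_def algebra_simps)
  then have "a * s U + b * s V = u'" "c * s U + d * s V = v'" using D by simp_all
  moreover have "(cbrt D)\<^sup>2 * s T = t'" using T D by simp
  ultimately have "h \<circ> x = x \<circ> perm_alpha U V T"
    unfolding h *(1) perm_alpha_smap smap_comp[OF *(2)] smap_comp[OF field_aut_id(2)] D_def[symmetric]
    by (simp add: field_aut_0[OF *(2)] field_aut_1[OF *(2)] cbrt_simps(4) add.commute)
  then show ?thesis using perm_alpha_mem by blast
qed

text \<open>Normality of Q in G2. V and T are determined by the last two coordinates, then E, which
  also absorbs the cross term of the quadratic part, and finally U.\<close>

lemma unipotent_group_conj:
  assumes x: "x \<in> semi_triangular" and h: "h \<in> unipotent_group"
  shows "\<exists>h'\<in>unipotent_group. h \<circ> x = x \<circ> h'"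
proof -
  obtain s l m e d u v t where *: "x = bmap s l m e d u v t" "field_aut s" "l \<noteq> 0" "m \<noteq> 0"
    using x by (rule semi_triangularE)
  obtain e' u' v' t' where h: "h = bmap id 1 1 e' 0 u' v' t'" using h by (rule unipotent_groupE)
  define c where "c = (cbrt (l * m))\<^sup>2"
  have c: "c \<noteq> 0" using *(3,4) by (simp add: c_def cbrt_eq_0)
  obtain V T where V: "s V = v' / m" and T: "s T = t' / c" using field_aut_surjE[OF *(2)] by metis
  obtain E U where E: "s E = (e' * m + l * d * s V) / l"
    and U: "s U = (u' + e' * v - e * s V) / l - d * (s V)\<^sup>2 - cbrt d * s T"
    using field_aut_surjE[OF *(2)] by metis
  have 1: "m * s V = v'" "c * s T = t'" "l * s E = e' * m + l * d * s V" using V T E *(3,4) c by simp_all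
  have "l * (s U + (d * (s V)\<^sup>2 + cbrt d * s T)) = u' + e' * v - e * s V"
    unfolding U using *(3) by simp
  then have 2: "l * s U + e * s V + l * (d * (s V)\<^sup>2 + cbrt d * s T) + u = u' + e' * v + u"
    by (simp add: algebra_simps)
  have "h \<circ> x = x \<circ> bmap id 1 1 E 0 U V T"
    unfolding h *(1) bmap_comp[OF *(2) one_neq_zero] bmap_comp[OF field_aut_id(2) *(3)] 2
      c_def[symmetric] 1
    by (simp add: field_aut_0[OF *(2)] field_aut_1[OF *(2)] cbrt_simps) (simp add: algebra_simps)
  then show ?thesis using unipotent_mem by blast
qed

lemma card_translation_group: "card translation_group = 3 ^ (3 * r)"
proof -
  have "inj (\<lambda>(u, v, t). perm_alpha u v (t::'a))"
  proof (rule injI)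
    fix p p' :: "'a omega"
    assume "(\<lambda>(u, v, t). perm_alpha u v t) p = (\<lambda>(u, v, t). perm_alpha u v t) p'"
    then have "(\<lambda>(u, v, t). perm_alpha u v t) p (0, 0, 0) = (\<lambda>(u, v, t). perm_alpha u v t) p' (0, 0, 0)"
      by simp
    then show "p = p'" by (simp add: perm_alpha_def case_prod_unfold prod_eq_iff)
  qed
  then have "card translation_group = CARD('a omega)" by (simp add: translation_group_def card_image)
  also have "\<dots> = (3 ^ r) * (3 ^ r * 3 ^ r)" by (simp add: CARD)
  also have "\<dots> = 3 ^ (3 * r)" by (simp flip: power_add)
  finally show ?thesis .
qed

lemma card_unipotent_group: "card unipotent_group = 3 ^ (4 * r)"
proof -
  have "inj (\<lambda>(e, u, v, t). bmap id 1 1 e 0 u v t)"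
    by (rule injI) (auto simp: bmap_eq_iff[OF field_aut_id(2) field_aut_id(2) one_neq_zero])
  then have "card unipotent_group = CARD('a \<times> 'a omega)" by (simp add: unipotent_group_def card_image)
  also have "\<dots> = 3 ^ r * (3 ^ r * (3 ^ r * 3 ^ r))" by (simp add: CARD)
  also have "\<dots> = 3 ^ (4 * r)" by (simp flip: power_add)
  finally show ?thesis .
qed

lemma card_nonzero: "card {x::'a. x \<noteq> 0} = 3 ^ r - 1"
proof -
  have "{x::'a. x \<noteq> 0} = UNIV - {0}" by auto
  then show ?thesis by (simp add: card_Diff_singleton CARD)
qed

lemma coprime_nonzero: "coprime (3 ^ r - 1 :: nat) 3"
proof -
  have "\<not> (3::nat) dvd 3 ^ r - 1"
  proof
    assume "(3::nat) dvd 3 ^ r - 1"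
    moreover have "(3::nat) dvd 3 ^ r" using r by (simp add: dvd_power)
    ultimately have "(3::nat) dvd 3 ^ r - (3 ^ r - 1)" by (rule dvd_diff_nat[rotated])
    then show False by (simp add: Suc_leI)
  qed
  then have "coprime 3 (3 ^ r - 1 :: nat)" by (intro prime_imp_coprime) simp_all
  then show ?thesis by (simp add: coprime_commute)
qed

text \<open>The kernel is the translation group extended by the scalars; the index q - 1 is prime to
  3.\<close>

lemma p_core_affine: "p_core 3 (local_kernel G.\<Gamma> (group_G F) G.\<rho> semi_affine) = translation_group"
proof -
  let ?L = "{smap id x 0 0 x u v t | x u v t. x \<noteq> 0}"
  have L: "local_kernel G.\<Gamma> (group_G F) G.\<rho> semi_affine = (group_G F)\<lparr>carrier := ?L\<rparr>"
    using local_kernel_affine by (simp add: local_kernel_def)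
  have sub: "subgroup ?L (group_G F)"
    using G.local_kernel_subgroup[of semi_affine] unfolding local_kernel_affine .
  have LH: "?L \<subseteq> semi_affine" by (auto intro!: smap_mem field_aut_id)
  have TL: "translation_group \<subseteq> ?L"
  proof
    fix g assume "g \<in> translation_group"
    then obtain u v t where "g = smap id 1 0 0 1 u v t"
      unfolding perm_alpha_smap[symmetric] by (rule translation_groupE)
    then show "g \<in> ?L" using one_neq_zero by blast
  qed
  have normal: "translation_group \<lhd> (group_G F)\<lparr>carrier := ?L\<rparr>"
  proof (rule G.normal_in_subgroupI[OF subgroup_translation_group sub TL])
    fix x h assume "x \<in> ?L" "h \<in> translation_group"
    then show "\<exists>h'\<in>translation_group. x \<otimes>\<^bsub>group_G F\<^esub> h = h' \<otimes>\<^bsub>group_G F\<^esub> x"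
      using translation_group_conj[of x h] LH unfolding group_G_simps(2) by blast
  qed
  have "?L = (\<lambda>(x, u, v, t). smap id x 0 0 x u v t) ` ({x. x \<noteq> 0} \<times> UNIV)"
  proof (intro subset_antisym subsetI)
    fix g assume "g \<in> ?L"
    then obtain x u v t where "g = smap id x 0 0 x u v t" "x \<noteq> 0" by blast
    then show "g \<in> (\<lambda>(x, u, v, t). smap id x 0 0 x u v t) ` ({x. x \<noteq> 0} \<times> UNIV)"
      by (intro image_eqI[of _ _ "(x, u, v, t)"]) simp_all
  qed auto
  moreover have "inj_on (\<lambda>(x, u, v, t). smap id x 0 0 x u v t) ({x. x \<noteq> 0} \<times> UNIV)"
  proof (rule inj_onI)
    fix p p' :: "'a \<times> 'a omega"
    assume p: "p \<in> {x. x \<noteq> 0} \<times> UNIV" and eq: "(\<lambda>(x, u, v, t). smap id x 0 0 x u v t) p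
      = (\<lambda>(x, u, v, t). smap id x 0 0 x u v t) p'"
    obtain x u v t x' u' v' t' where pp: "p = (x, u, v, t)" "p' = (x', u', v', t')"
      by (metis prod_cases4)
    have "x * x - 0 * 0 \<noteq> 0" using p pp by simp
    then show "p = p'"
      using eq smap_eq_iff[OF field_aut_id(2) field_aut_id(2), of x x 0 0 u v t x' 0 0 x' u' v' t']
      by (simp add: pp)
  qed
  ultimately have "card ?L = card ({x::'a. x \<noteq> 0} \<times> (UNIV :: 'a omega set))"
    by (simp only: card_image)
  also have "\<dots> = (3 ^ r - 1) * (3 ^ r * (3 ^ r * 3 ^ r))"
    by (simp only: card_cartesian_product card_nonzero) (simp add: CARD)
  also have "\<dots> = card translation_group * (3 ^ r - 1)"
    unfolding card_translation_group by (simp flip: power_add)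
  finally show ?thesis
    unfolding L
    by (intro group.p_core_eqI[OF subgroup.subgroup_is_group[OF sub group_group_G] _ normal card_translation_group
        _ coprime_nonzero]) simp_all
qed

text \<open>The kernel is \<open>unipotent_group\<close> extended by the diagonal maps with entries
  m^2, m; the index is again q - 1.\<close>

lemma p_core_triangular: "p_core 3 (local_kernel G.\<Gamma> (group_G F) G.\<rho> semi_triangular) = unipotent_group"
proof -
  let ?L = "{bmap id (m\<^sup>2) m e 0 u v t | m e u v t. m \<noteq> 0}"
  have L: "local_kernel G.\<Gamma> (group_G F) G.\<rho> semi_triangular = (group_G F)\<lparr>carrier := ?L\<rparr>"
    using local_kernel_triangular by (simp add: local_kernel_def)
  have sub: "subgroup ?L (group_G F)"
    using G.local_kernel_subgroup[of semi_triangular] unfolding local_kernel_triangular .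
  have LK: "?L \<subseteq> semi_triangular" by (auto intro!: bmap_mem field_aut_id)
  have UL: "unipotent_group \<subseteq> ?L"
  proof
    fix g assume "g \<in> unipotent_group"
    then obtain e u v t where "g = bmap id (1\<^sup>2) 1 e 0 u v t"
      unfolding one_power2 by (rule unipotent_groupE)
    then show "g \<in> ?L" using one_neq_zero by blast
  qed
  have normal: "unipotent_group \<lhd> (group_G F)\<lparr>carrier := ?L\<rparr>"
  proof (rule G.normal_in_subgroupI[OF subgroup_unipotent_group sub UL])
    fix x h assume "x \<in> ?L" "h \<in> unipotent_group"
    then show "\<exists>h'\<in>unipotent_group. x \<otimes>\<^bsub>group_G F\<^esub> h = h' \<otimes>\<^bsub>group_G F\<^esub> x"
      using unipotent_group_conj[of x h] LK unfolding group_G_simps(2) by blast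
  qed
  have "?L = (\<lambda>(m, e, u, v, t). bmap id (m\<^sup>2) m e 0 u v t) ` ({x. x \<noteq> 0} \<times> UNIV)"
  proof (intro subset_antisym subsetI)
    fix g assume "g \<in> ?L"
    then obtain m e u v t where "g = bmap id (m\<^sup>2) m e 0 u v t" "m \<noteq> 0" by blast
    then show "g \<in> (\<lambda>(m, e, u, v, t). bmap id (m\<^sup>2) m e 0 u v t) ` ({x. x \<noteq> 0} \<times> UNIV)"
      by (intro image_eqI[of _ _ "(m, e, u, v, t)"]) simp_all
  qed (clarsimp, blast)
  moreover have "inj_on (\<lambda>(m, e, u, v, t). bmap id (m\<^sup>2) m e 0 u v t) ({x. x \<noteq> 0} \<times> UNIV)"
  proof (rule inj_onI)
    fix p p' :: "'a \<times> 'a \<times> 'a omega"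
    assume p: "p \<in> {x. x \<noteq> 0} \<times> UNIV" and eq: "(\<lambda>(m, e, u, v, t). bmap id (m\<^sup>2) m e 0 u v t) p
      = (\<lambda>(m, e, u, v, t). bmap id (m\<^sup>2) m e 0 u v t) p'"
    obtain m e u v t m' e' u' v' t' where pp: "p = (m, e, u, v, t)" "p' = (m', e', u', v', t')"
      by (metis prod_cases5)
    have "m\<^sup>2 \<noteq> 0" using p pp by simp
    then show "p = p'"
      using eq bmap_eq_iff[OF field_aut_id(2) field_aut_id(2), of "m\<^sup>2" m e 0 u v t "m'\<^sup>2" m' e' 0 u' v' t']
      by (simp add: pp)
  qed
  ultimately have "card ?L = card ({x::'a. x \<noteq> 0} \<times> (UNIV :: ('a \<times> 'a omega) set))"
    by (simp only: card_image)
  also have "\<dots> = (3 ^ r - 1) * (3 ^ r * (3 ^ r * (3 ^ r * 3 ^ r)))"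
    by (simp only: card_cartesian_product card_nonzero) (simp add: CARD)
  also have "\<dots> = card unipotent_group * (3 ^ r - 1)"
    unfolding card_unipotent_group by (simp flip: power_add)
  finally show ?thesis
    unfolding L
    by (intro group.p_core_eqI[OF subgroup.subgroup_is_group[OF sub group_group_G] _ normal card_unipotent_group
        _ coprime_nonzero]) simp_all
qed

text \<open>Translations are transitive on \<Omega>, so a map commuting with all of them is
  determined by its value at the origin and agrees with the translation having that value.\<close>

lemma centralizes_translation_group:
  fixes g :: "'a perm"
  assumes "\<And>h. h \<in> translation_group \<Longrightarrow> h \<circ> g = g \<circ> h"
  shows "g \<in> translation_group"
proof -
  obtain u v t where g0: "g (0, 0, 0) = (u, v, t)" by (metis prod_cases3)
  have "g p = perm_alpha u v t p" for p
  proof -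
    obtain a b c where p: "p = (a, b, c)" by (metis prod_cases3)
    have "(g \<circ> perm_alpha a b c) (0, 0, 0) = (perm_alpha a b c \<circ> g) (0, 0, 0)"
      using assms[OF perm_alpha_mem] by simp
    then show ?thesis by (simp add: p perm_alpha_def g0 add.commute)
  qed
  then have "g = perm_alpha u v t" by (rule ext)
  then show ?thesis using perm_alpha_mem by blast
qed

text \<open>Both base vertices are settled by the centralizer of A: what centralizes Q centralizes A
  \<le> Q, hence lies in A and so in Q.\<close>

lemma local_characteristic_coset_graph: "local_characteristic G.\<Gamma> (group_G F) G.\<rho> 3"
  unfolding local_characteristic_def
proof (intro conjI ballI)
  have H: "centralizer (vstab (group_G F) G.\<rho> semi_affine) (p_core 3 (local_kernel G.\<Gamma> (group_G F) G.\<rho> semi_affine))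
      \<subseteq> p_core 3 (local_kernel G.\<Gamma> (group_G F) G.\<rho> semi_affine)"
    unfolding p_core_affine
    using centralizes_translation_group by (auto simp: centralizer_def vstab_def group_G_simps(2))
  have K: "centralizer (vstab (group_G F) G.\<rho> semi_triangular) (p_core 3 (local_kernel G.\<Gamma> (group_G F) G.\<rho> semi_triangular))
      \<subseteq> p_core 3 (local_kernel G.\<Gamma> (group_G F) G.\<rho> semi_triangular)"
    unfolding p_core_triangular
    using centralizes_translation_group translation_group_subset(1)
    by (fastforce simp: centralizer_def vstab_def group_G_simps(2))
  fix z assume "z \<in> verts G.\<Gamma>"
  then show "centralizer (vstab (group_G F) G.\<rho> z) (p_core 3 (local_kernel G.\<Gamma> (group_G F) G.\<rho> z))
      \<subseteq> p_core 3 (local_kernel G.\<Gamma> (group_G F) G.\<rho> z)"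
  proof (cases rule: G.vert_cases)
    case (1 g)
    then show ?thesis using G.local_characteristic_action[OF _ G.base_verts(1) H] by simp
  next
    case (2 g)
    then show ?thesis using G.local_characteristic_action[OF _ G.base_verts(2) K] by simp
  qed
qed simp

lemma pushing_up_coset_graph: "pushing_up_type G.\<Gamma> (group_G F) G.\<rho> 3"
proof -
  have "{semi_affine, semi_triangular} \<in> edges G.\<Gamma>"
    using imageI[OF G.one_closed, of "\<lambda>a. {cosH a, cosK a}"] unfolding G.edges G.base_cosets .
  then have "s_arc_from G.\<Gamma> 1 semi_affine [semi_affine, semi_triangular]"
    using G.base_verts by (simp add: s_arc_from_def)
  then have "pushing_up_type_wrt G.\<Gamma> (group_G F) G.\<rho> semi_affine semi_triangular 3"
    unfolding pushing_up_type_wrt_def p_core_affine p_core_triangular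
    using local_characteristic_coset_graph translation_group_subset(1) by blast
  then show ?thesis unfolding pushing_up_type_def by blast
qed

end

section \<open>Arcs\<close>

context field_char_3
begin

text \<open>\<open>fixes_flag h g b\<close>: right multiplication by \<open>h\<close> fixes both cosets \<open>cosH g\<close> and \<open>cosK g\<close> of the
  flag at \<open>g\<close>, and acts on the neighbours of these cosets as \<open>b\<close> does at the base flag.\<close>

definition fixes_flag :: "'a perm \<Rightarrow> 'a perm \<Rightarrow> 'a perm \<Rightarrow> bool" where
  "fixes_flag h g b \<longleftrightarrow> b \<in> semi_affine \<and> b \<in> semi_triangular \<and> g \<in> carrier (group_G F) \<and> h \<circ> g = g \<circ> b"

lemma fixes_flag_act:
  assumes h: "h \<in> carrier (group_G F)" and f: "fixes_flag h g b" and a: "a \<in> carrier (group_G F)"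
  shows "G.\<rho> h (cosH (g \<circ> a)) = cosH (g \<circ> (b \<circ> a))" "G.\<rho> h (cosK (g \<circ> a)) = cosK (g \<circ> (b \<circ> a))"
proof -
  have g: "g \<in> carrier (group_G F)" and b: "h \<circ> g = g \<circ> b" using f by (auto simp: fixes_flag_def)
  have ag: "g \<circ> a \<in> carrier (group_G F)" using G.m_closed[OF a g] by (simp add: group_G_simps(2))
  have "(a \<otimes>\<^bsub>group_G F\<^esub> g) \<otimes>\<^bsub>group_G F\<^esub> h = g \<circ> (b \<circ> a)"
    by (simp add: group_G_simps(2) b flip: comp_assoc)
  then show "G.\<rho> h (cosH (g \<circ> a)) = cosH (g \<circ> (b \<circ> a))" "G.\<rho> h (cosK (g \<circ> a)) = cosK (g \<circ> (b \<circ> a))"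
    using G.action_coset[OF ag h] by (simp_all add: group_G_simps(2))
qed

lemma fixes_flag_fixes:
  assumes h: "h \<in> carrier (group_G F)" and f: "fixes_flag h g b"
  shows "G.\<rho> h (cosH g) = cosH g" "G.\<rho> h (cosK g) = cosK g"
proof -
  have g: "g \<in> carrier (group_G F)" and b: "b \<in> semi_affine" "b \<in> semi_triangular"
    using f by (auto simp: fixes_flag_def)
  have "cosH (b \<otimes>\<^bsub>group_G F\<^esub> g) = cosH g" "cosK (b \<otimes>\<^bsub>group_G F\<^esub> g) = cosK g"
    using b g mem_carrier_G G.rcos_eq_iff_factor[OF group_G_subgroups(2)]
      G.rcos_eq_iff_factor[OF group_G_subgroups(3)] G.m_closed by blast+
  then show "G.\<rho> h (cosH g) = cosH g" "G.\<rho> h (cosK g) = cosK g"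
    using fixes_flag_act[OF h f, of id] G.one_closed by (simp_all add: group_G_simps(2,3))
qed

lemma fixes_flag_id:
  "h \<in> semi_affine \<Longrightarrow> h \<in> semi_triangular \<Longrightarrow> fixes_flag h id h"
  using G.one_closed by (simp add: fixes_flag_def group_G_simps(3))

text \<open>This carries the local form of h from one flag of the path to the next: passing a
  generator a replaces b by its conjugate c, and h fixes the new flag as long as c stays in both
  subgroups.\<close>

lemma fixes_flag_comp:
  assumes f: "fixes_flag h g b" and a: "a \<in> carrier (group_G F)" "b \<circ> a = a \<circ> c"
    and c: "c \<in> semi_affine" "c \<in> semi_triangular"
  shows "fixes_flag h (g \<circ> a) c"
proof -
  have "g \<circ> a \<in> carrier (group_G F)"
    using f G.m_closed[OF a(1), of g] by (simp add: fixes_flag_def group_G_simps(2))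
  moreover have "h \<circ> (g \<circ> a) = g \<circ> (b \<circ> a)" using f by (simp add: fixes_flag_def flip: comp_assoc)
  ultimately show ?thesis using c by (simp add: fixes_flag_def a(2) comp_assoc)
qed

lemma nbrs_cosK:
  assumes g: "g \<in> carrier (group_G F)" and w: "w \<in> nbrs G.\<Gamma> (cosK g)" and ne: "w \<noteq> cosH g"
  obtains d where "d \<noteq> 0" "w = cosH (g \<circ> perm_tau d)"
proof -
  have "nbrs G.\<Gamma> (cosK g) = G.\<rho> g ` nbrs G.\<Gamma> semi_triangular"
    using G.nbrs_action[OF g G.base_verts(2)] G.action_base(2)[OF g] by simp
  then obtain d where "w = G.\<rho> g (cosH (perm_tau d))" using w unfolding nbrs_triangular by blast
  then have w: "w = cosH (g \<circ> perm_tau d)"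
    using G.action_coset(1)[OF mem_carrier_G(2)[OF generators_mem(1)] g] by (simp add: group_G_simps(2))
  moreover have "d \<noteq> 0" using w ne by (auto simp: tau_0)
  ultimately show ?thesis using that by blast
qed

text \<open>The neighbour \<open>cosK g\<close> corresponds to the line through (1, 0); all other
  lines are represented by products of some \<open>perm_gamma\<close> with \<delta>.\<close>

lemma nbrs_cosH:
  assumes g: "g \<in> carrier (group_G F)" and w: "w \<in> nbrs G.\<Gamma> (cosH g)" and ne: "w \<noteq> cosK g"
  obtains e where "w = cosK (g \<circ> (perm_gamma e \<circ> perm_delta))"
proof -
  have gd: "perm_gamma e \<circ> perm_delta \<in> carrier (group_G F)" for e :: 'a
    using G.m_closed[OF mem_carrier_G(1)[OF generators_mem(4)] mem_carrier_G(1)[OF generators_mem(3)]]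
    by (simp add: group_G_simps(2))
  have gds: "perm_gamma e \<circ> perm_delta = smap id (- e) 1 (- 1) 0 0 0 0" for e :: 'a
    by (auto simp: fun_eq_iff perm_gamma_def perm_delta_def smap_def cbrt_simps)
  have "nbrs G.\<Gamma> (cosH g) = G.\<rho> g ` nbrs G.\<Gamma> semi_affine"
    using G.nbrs_action[OF g G.base_verts(1)] G.action_base(1)[OF g] by simp
  then obtain p q where pq: "p \<noteq> 0 \<or> q \<noteq> 0" "w = G.\<rho> g (line p q)"
    using w unfolding nbrs_affine by blast
  have "q \<noteq> 0"
  proof
    assume "q = 0"
    then have "line p q = line 1 0" using line_eq_iff[of p q 1 0] pq by simp
    then show False using ne pq(2) G.action_base(2)[OF g] by (simp add: line_0)
  qed
  \<comment> \<open>The vector is rescaled to the first column (- e, - 1) of the product of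
    \<open>perm_gamma e\<close> and \<delta>.\<close>
  then have "line p q = line (- (p / q)) (- 1)" using line_eq_iff[of p q "- (p / q)" "- 1"] by simp
  also have "\<dots> = cosK (perm_gamma (p / q) \<circ> perm_delta)"
    unfolding gds by (rule coset_smap[symmetric]) (simp_all add: field_aut_id)
  finally have "w = cosK (g \<circ> (perm_gamma (p / q) \<circ> perm_delta))"
    using pq(2) G.action_coset(2)[OF gd g] by (simp add: group_G_simps(2))
  then show ?thesis using that by blast
qed

text \<open>A diagonal local form multiplies the index of \<tau>_d by l / m^2, so the torus
  normalizes the index to 1.\<close>

lemma extend_at_cosK:
  assumes h: "h \<in> carrier (group_G F)" and f: "fixes_flag h g (perm_beta l m)"
    and lm: "l \<noteq> 0" "m \<noteq> 0" and d: "l / m\<^sup>2 * d = 1"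
  shows "G.\<rho> h (cosH (g \<circ> perm_tau d)) = cosH (g \<circ> perm_tau 1)"
proof -
  have g: "g \<in> carrier (group_G F)" using f by (simp add: fixes_flag_def)
  have c: "perm_tau d \<in> carrier (group_G F)" "perm_beta l m \<in> carrier (group_G F)"
    "perm_tau 1 \<in> carrier (group_G F)" "perm_beta l m \<circ> perm_tau d \<in> carrier (group_G F)"
    using generators_mem(1,7) lm mem_carrier_G(2) G.m_closed[of "perm_tau d" "perm_beta l m"]
    by (simp_all add: group_G_simps(2))
  have "cosH (perm_beta l m \<circ> perm_tau d) = cosH (perm_tau 1)"
    using coset_tau_act[OF field_aut_id(2) lm, of d 0 0 0 0 0] d
    by (simp add: perm_beta_bmap group_G_simps(2))
  then have "cosH (g \<circ> (perm_beta l m \<circ> perm_tau d)) = cosH (g \<circ> perm_tau 1)"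
    using G.action_coset(1)[OF c(4) g] G.action_coset(1)[OF c(3) g] by (simp add: group_G_simps(2))
  then show ?thesis using fixes_flag_act(1)[OF h f c(1)] by simp
qed

text \<open>The corner entry - e of the local form cancels \<open>perm_gamma e\<close>; the
  remaining translation does not affect the line.\<close>

lemma extend_at_cosH:
  assumes h: "h \<in> carrier (group_G F)" and f: "fixes_flag h g (bmap id 1 1 (- e) 0 u v t)"
  shows "G.\<rho> h (cosK (g \<circ> (perm_gamma e \<circ> perm_delta))) = cosK (g \<circ> perm_delta)"
proof -
  let ?b = "bmap id 1 1 (- e) 0 u v t"
  have g: "g \<in> carrier (group_G F)" using f by (simp add: fixes_flag_def)
  have d: "perm_delta \<in> carrier (group_G F)" using generators_mem(4) mem_carrier_G(1) by blast
  have gd: "perm_gamma e \<circ> perm_delta \<in> carrier (group_G F)"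
    using G.m_closed[OF mem_carrier_G(1)[OF generators_mem(4)] mem_carrier_G(1)[OF generators_mem(3)]]
    by (simp add: group_G_simps(2))
  have b: "?b \<in> carrier (group_G F)" by (intro mem_carrier_G(2) bmap_mem field_aut_id) simp_all
  have bgd: "?b \<circ> (perm_gamma e \<circ> perm_delta) \<in> carrier (group_G F)"
    using G.m_closed[OF gd b] by (simp add: group_G_simps(2))
  have "?b \<circ> (perm_gamma e \<circ> perm_delta) = smap id 0 1 (- 1) 0 u v t"
    by (auto simp: fun_eq_iff perm_gamma_def perm_delta_def smap_def bmap_def cbrt_simps)
  then have "cosK (?b \<circ> (perm_gamma e \<circ> perm_delta)) = cosK perm_delta"
    unfolding perm_delta_smap by (simp only: coset_smap field_aut_id) (subst (1 2) coset_smap; simp add: field_aut_id)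
  then have "cosK (g \<circ> (?b \<circ> (perm_gamma e \<circ> perm_delta))) = cosK (g \<circ> perm_delta)"
    using G.action_coset(2)[OF bgd g] G.action_coset(2)[OF d g] by (simp add: group_G_simps(2))
  then show ?thesis using fixes_flag_act(2)[OF h f gd] by simp
qed

section \<open>Commutation rules along the standard path\<close>

lemma alpha_tau: "perm_alpha u 0 0 \<circ> perm_tau 1 = perm_tau 1 \<circ> perm_alpha u 0 (0::'a)"
  by (auto simp: fun_eq_iff perm_alpha_def perm_tau_def)

text \<open>The decisive rule: past \<tau>_1 a translation in the second coordinate acquires the
  corner entry v, and with it the power to move the next line.\<close>

lemma alpha_tau': "perm_alpha 0 v 0 \<circ> perm_tau 1 = perm_tau 1 \<circ> bmap id 1 1 v 0 (- v\<^sup>2) v 0"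
  unfolding perm_alpha_bmap bmap_comp_tau[OF field_aut_id(2)] tau_comp_bmap[OF one_neq_zero]
  by (simp add: cbrt_simps)

lemma alpha_delta: "perm_alpha u v 0 \<circ> perm_delta = perm_delta \<circ> perm_alpha (- v) u (0::'a)"
  by (auto simp: fun_eq_iff perm_alpha_def perm_delta_def)

text \<open>For the pair (m^2, m) the factor l / m^2 is 1, so the index of \<tau>_1 is
  preserved.\<close>

lemma beta_tau: "m \<noteq> 0 \<Longrightarrow> perm_beta (m\<^sup>2) m \<circ> perm_tau 1 = perm_tau 1 \<circ> perm_beta (m\<^sup>2) m" for m :: 'a
  unfolding perm_beta_bmap using bmap_comp_tau[OF field_aut_id(2)] tau_comp_bmap[of "m\<^sup>2"]
  by (simp add: cbrt_simps)

lemma beta_delta: "perm_beta l m \<circ> perm_delta = perm_delta \<circ> perm_beta m (l::'a)"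
  by (auto simp: fun_eq_iff perm_beta_def perm_delta_def mult.commute)

lemma gamma_tau: "perm_gamma e \<circ> perm_tau 1 = perm_tau 1 \<circ> perm_gamma (e::'a)"
  by (auto simp: fun_eq_iff perm_gamma_def perm_tau_def)

lemma step_at_base:
  assumes "L \<in> {semi_affine, semi_triangular}" "M \<in> {semi_affine, semi_triangular}"
    and w: "w \<in> nbrs G.\<Gamma> L" and "M \<noteq> L"
  shows "\<exists>g\<in>carrier (group_G F). G.\<rho> g L = L \<and> G.\<rho> g w = M"
proof -
  have LM: "nbrs G.\<Gamma> L = (\<lambda>g. G.\<rho> g M) ` L" "stabilizer (group_G F) G.\<rho> L = L" "subgroup L (group_G F)"
    using assms(1,2,4) G.nbrs_base_H G.nbrs_base_K G.stabilizer_H G.stabilizer_K group_G_subgroups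
      mem_carrier_G by (auto simp: G.action_base)
  obtain g where g: "g \<in> L" "w = G.\<rho> g M" using w LM by auto
  have i: "inv\<^bsub>group_G F\<^esub> g \<in> L" using LM(3) g(1) subgroup.m_inv_closed by metis
  then have "G.\<rho> (inv\<^bsub>group_G F\<^esub> g) L = L" "inv\<^bsub>group_G F\<^esub> g \<in> carrier (group_G F)"
    using LM(2) by (auto simp: stabilizer_def)
  moreover have "g \<in> carrier (group_G F)" using g(1) LM(3) subgroup.mem_carrier by metis
  ultimately show ?thesis using G.action_inv(1) g(2) by auto
qed

lemma gens_carrier:
  "perm_tau d \<in> carrier (group_G F)" "perm_delta \<in> carrier (group_G F)"
  "perm_alpha u v t \<in> carrier (group_G F)" "perm_gamma e \<in> carrier (group_G F)"
  "l \<noteq> 0 \<Longrightarrow> m \<noteq> 0 \<Longrightarrow> perm_beta l m \<in> carrier (group_G F)"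
  "bmap id 1 1 e 0 u v t \<in> carrier (group_G F)"
  using generators_mem mem_carrier_G bmap_mem[OF field_aut_id(2), of 1 1] by simp_all

lemma borel_mem:
  "bmap id 1 1 e 0 u v t \<in> semi_affine" "bmap id 1 1 e 0 u v t \<in> semi_triangular"
  using bmap_mem[OF field_aut_id(2), of 1 1] by (simp_all add: bmap_mem_semi_affine field_aut_id)

abbreviation (input) \<tau> where "\<tau> \<equiv> perm_tau (1::'a)"
abbreviation (input) \<delta> where "\<delta> \<equiv> perm_delta :: 'a perm"

lemma comp_carrier: "f \<in> carrier (group_G F) \<Longrightarrow> g \<in> carrier (group_G F) \<Longrightarrow> f \<circ> g \<in> carrier (group_G F)"
  using G.m_closed[of g f] by (simp add: group_G_simps(2))

lemma cos_absorb:
  assumes g: "g \<in> carrier (group_G F)"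
  shows "a \<in> semi_affine \<Longrightarrow> cosH (g \<circ> a) = cosH g" "a \<in> semi_triangular \<Longrightarrow> cosK (g \<circ> a) = cosK g"
  using G.rcos_eq_iff_factor[OF group_G_subgroups(2), of "g \<circ> a" g]
    G.rcos_eq_iff_factor[OF group_G_subgroups(3), of "g \<circ> a" g] comp_carrier[OF g mem_carrier_G(1)]
    comp_carrier[OF g mem_carrier_G(2)] g
  by (auto simp: group_G_simps(2))

lemma flag_id:
  "fixes_flag (perm_alpha u v t) id (perm_alpha u v t)"
  "fixes_flag (perm_gamma e) id (perm_gamma e)"
  "l \<noteq> 0 \<Longrightarrow> m \<noteq> 0 \<Longrightarrow> fixes_flag (perm_beta l m) id (perm_beta l m)"
  using generators_mem by (simp_all add: fixes_flag_id)

lemma flag_tau: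
  "fixes_flag h g (perm_alpha u 0 0) \<Longrightarrow> fixes_flag h (g \<circ> \<tau>) (perm_alpha u 0 0)"
  "fixes_flag h g (perm_alpha 0 v 0) \<Longrightarrow> fixes_flag h (g \<circ> \<tau>) (bmap id 1 1 v 0 (- v\<^sup>2) v 0)"
  "m \<noteq> 0 \<Longrightarrow> fixes_flag h g (perm_beta (m\<^sup>2) m) \<Longrightarrow> fixes_flag h (g \<circ> \<tau>) (perm_beta (m\<^sup>2) m)"
  "fixes_flag h g (perm_gamma e) \<Longrightarrow> fixes_flag h (g \<circ> \<tau>) (perm_gamma e)"
  using generators_mem borel_mem
  by (auto intro!: fixes_flag_comp[OF _ gens_carrier(1)] alpha_tau alpha_tau' beta_tau gamma_tau)

lemma flag_delta:
  "fixes_flag h g (perm_alpha u v 0) \<Longrightarrow> fixes_flag h (g \<circ> \<delta>) (perm_alpha (- v) u 0)"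
  "l \<noteq> 0 \<Longrightarrow> m \<noteq> 0 \<Longrightarrow> fixes_flag h g (perm_beta l m) \<Longrightarrow> fixes_flag h (g \<circ> \<delta>) (perm_beta m l)"
  using generators_mem
  by (auto intro!: fixes_flag_comp[OF _ gens_carrier(2)] alpha_delta beta_delta)

text \<open>At a flag where the diagonal local form has entries m, m^2 the index is multiplied by m
  / m^4 = m^(-3); so the cube root of d is the right m.\<close>

lemma cube_root_scale:
  assumes "d \<noteq> 0" shows "cbrt d \<noteq> 0" "cbrt d / ((cbrt d)\<^sup>2)\<^sup>2 * d = 1"
proof -
  show c: "cbrt d \<noteq> 0" using assms by (simp add: cbrt_eq_0)
  have "d = cbrt d * (cbrt d)\<^sup>2" using cbrt_cube(2)[of d] by (simp add: power2_eq_square power3_eq_cube mult.assoc)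
  then have "cbrt d * d = ((cbrt d)\<^sup>2)\<^sup>2" by (metis mult.assoc power2_eq_square)
  then show "cbrt d / ((cbrt d)\<^sup>2)\<^sup>2 * d = 1" using c by simp
qed

lemma transitive_on_arcs_affine:
  assumes "k \<le> 5"
  shows "transitive_on_s_arcs_from G.\<Gamma> (group_G F) G.\<rho> k semi_affine"
proof -
  define x where "x = (!) [cosH id, cosK id, cosH \<tau>, cosK (\<tau> \<circ> \<delta>), cosH (\<tau> \<circ> \<delta> \<circ> \<tau>),
    cosK (\<tau> \<circ> \<delta> \<circ> \<tau> \<circ> \<delta>)]"
  have x: "x 0 = cosH id" "x (Suc 0) = cosK id" "x 2 = cosH \<tau>" "x 3 = cosK (\<tau> \<circ> \<delta>)"
    "x 4 = cosH (\<tau> \<circ> \<delta> \<circ> \<tau>)" "x 5 = cosK (\<tau> \<circ> \<delta> \<circ> \<tau> \<circ> \<delta>)"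
    by (simp_all add: x_def)
  have base: "cosH id = semi_affine" "cosK id = semi_triangular"
    using G.base_cosets by (simp_all add: group_G_simps(3))
  have c: "id \<in> carrier (group_G F)" "\<tau> \<in> carrier (group_G F)" "\<tau> \<circ> \<delta> \<in> carrier (group_G F)"
    "\<tau> \<circ> \<delta> \<circ> \<tau> \<in> carrier (group_G F)"
    using G.one_closed by (simp_all add: comp_carrier gens_carrier group_G_simps(3))
  \<comment> \<open>Consecutive flags share a vertex: \<tau>_1 lies in one subgroup and \<delta> in
    the other, so each vertex has a name at both flags. This identifies the predecessor to be
    avoided.\<close>
  have ab: "cosK \<tau> = cosK id" "cosH (\<tau> \<circ> \<delta>) = cosH \<tau>" "cosK (\<tau> \<circ> \<delta> \<circ> \<tau>) = cosK (\<tau> \<circ> \<delta>)"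
    using cos_absorb(2)[OF c(1) generators_mem(1)] cos_absorb(1)[OF c(2) generators_mem(4)]
      cos_absorb(2)[OF c(3) generators_mem(1)] by simp_all
  have "transitive_on_s_arcs_from G.\<Gamma> (group_G F) G.\<rho> k (x 0)"
  proof (rule G.transitive_on_s_arcs_fromI[OF assms])
    fix i w assume i: "i < 5" and w: "w \<in> nbrs G.\<Gamma> (x i)" and ne: "0 < i \<Longrightarrow> w \<noteq> x (i - 1)"
    have J: "j = 0 \<or> j = Suc 0 \<or> j = 2 \<or> j = 3 \<or> j = 4" if "j \<le> 4" for j :: nat using that by auto
    consider "i = 0" | "i = Suc 0" | "i = 2" | "i = 3" | "i = 4" using J[of i] i by auto
    then show "\<exists>g\<in>carrier (group_G F). (\<forall>j\<le>i. G.\<rho> g (x j) = x j) \<and> G.\<rho> g w = x (Suc i)"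
    proof cases
      case 1
      then show ?thesis
        using step_at_base[of semi_affine semi_triangular w] w G.HK by (auto simp: x base)
    next
      case 2
      obtain d where d: "d \<noteq> 0" "w = cosH (id \<circ> perm_tau d)"
        using nbrs_cosK[OF c(1), of w] w ne by (auto simp: x 2)
      \<comment> \<open>At the base flag any diagonal pair may be used; this one sends the index d
        to 1.\<close>
      let ?h = "perm_beta (1 / d) 1"
      have h: "?h \<in> carrier (group_G F)" using d by (simp add: gens_carrier)
      have f: "fixes_flag ?h id ?h" using d by (simp add: flag_id)
      have "G.\<rho> ?h w = x (Suc i)"
        unfolding d(2) using extend_at_cosK[OF h f _ _, of d] d by (simp add: x 2 numeral_2_eq_2[symmetric])
      moreover have "G.\<rho> ?h (x j) = x j" if "j \<le> i" for j
        using that 2 fixes_flag_fixes[OF h f] by (auto simp: x le_Suc_eq)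
      ultimately show ?thesis using h by blast
    next
      case 3
      obtain e where e: "w = cosK (\<tau> \<circ> (perm_gamma e \<circ> \<delta>))"
        using nbrs_cosH[OF c(2), of w] w ne by (auto simp: x 3 ab)
      \<comment> \<open>It commutes with \<tau>_1, so the part already in place stays fixed.\<close>
      let ?h = "perm_gamma (- e)"
      have h: "?h \<in> carrier (group_G F)" by (simp add: gens_carrier)
      have f1: "fixes_flag ?h id ?h" by (rule flag_id(2))
      have f2: "fixes_flag ?h \<tau> (bmap id 1 1 (- e) 0 0 0 0)"
        using flag_tau(4)[OF f1] by (simp add: perm_gamma_bmap)
      have "G.\<rho> ?h w = x (Suc i)"
        unfolding e using extend_at_cosH[OF h f2] by (simp add: x 3)
      moreover have "G.\<rho> ?h (x j) = x j" if "j \<le> i" for j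
        using that 3 J[of j] fixes_flag_fixes[OF h f1] fixes_flag_fixes[OF h f2] by (auto simp: x)
      ultimately show ?thesis using h by blast
    next
      case 4
      obtain d where d: "d \<noteq> 0" "w = cosH (\<tau> \<circ> \<delta> \<circ> perm_tau d)"
        using nbrs_cosK[OF c(3), of w] w ne by (auto simp: x 4 ab)
      define m where "m = cbrt d"
      have m: "m \<noteq> 0" "m\<^sup>2 \<noteq> 0" "m / (m\<^sup>2)\<^sup>2 * d = 1" using cube_root_scale[OF d(1)] by (simp_all add: m_def)
      \<comment> \<open>Fixing the index of \<tau>_1 forces a pair (m^2, m); past \<delta> it
        becomes (m, m^2), which still acts nontrivially on indices.\<close>
      let ?h = "perm_beta (m\<^sup>2) m"
      have h: "?h \<in> carrier (group_G F)" using m by (simp add: gens_carrier)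
      have f: "fixes_flag ?h id ?h" using m by (simp add: flag_id)
      have f2: "fixes_flag ?h \<tau> ?h" using flag_tau(3)[OF m(1) f] by simp
      have f3: "fixes_flag ?h (\<tau> \<circ> \<delta>) (perm_beta m (m\<^sup>2))" by (rule flag_delta(2)[OF m(2,1) f2])
      have "G.\<rho> ?h w = x (Suc i)"
        unfolding d(2) using extend_at_cosK[OF h f3 m] by (simp add: x 4)
      moreover have "G.\<rho> ?h (x j) = x j" if "j \<le> i" for j
        using that 4 J[of j] fixes_flag_fixes[OF h f] fixes_flag_fixes[OF h f2] fixes_flag_fixes[OF h f3]
        by (auto simp: x)
      ultimately show ?thesis using h by blast
    next
      case 5
      obtain e where e: "w = cosK (\<tau> \<circ> \<delta> \<circ> \<tau> \<circ> (perm_gamma e \<circ> \<delta>))"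
        using nbrs_cosH[OF c(4), of w] w ne by (auto simp: x 5 ab)
      \<comment> \<open>The vector (- e, 0) passes \<tau>_1 unchanged, becomes (0, - e) past
        \<delta>, and acquires the corner entry - e only past the second \<tau>_1.\<close>
      let ?h = "perm_alpha (- e) 0 0"
      have h: "?h \<in> carrier (group_G F)" by (simp add: gens_carrier)
      have f: "fixes_flag ?h id ?h" by (simp add: flag_id)
      have f2: "fixes_flag ?h \<tau> ?h" using flag_tau(1)[OF f] by simp
      have f3: "fixes_flag ?h (\<tau> \<circ> \<delta>) (perm_alpha 0 (- e) 0)" using flag_delta(1)[OF f2] by simp
      have f4: "fixes_flag ?h (\<tau> \<circ> \<delta> \<circ> \<tau>) (bmap id 1 1 (- e) 0 (- (- e)\<^sup>2) (- e) 0)"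
        by (rule flag_tau(2)[OF f3])
      have "G.\<rho> ?h w = x (Suc i)"
        unfolding e using extend_at_cosH[OF h f4] by (simp add: x 5)
      moreover have "G.\<rho> ?h (x j) = x j" if "j \<le> i" for j
        using that 5 J[of j] fixes_flag_fixes[OF h f] fixes_flag_fixes[OF h f2] fixes_flag_fixes[OF h f3]
          fixes_flag_fixes[OF h f4] by (auto simp: x)
      ultimately show ?thesis using h by blast
    qed
  qed
  then show ?thesis by (simp add: x base)
qed

text \<open>Beginning with \<delta> makes the two translation directions act at different distances:
  \<open>perm_alpha (- e) 0 0\<close> adjusts the vertex of index 4, and
  \<open>perm_alpha 0 e 0\<close> only that of index 6. This gives one step more than from the other
  type of vertex.\<close>

lemma transitive_on_arcs_triangular:
  assumes "k \<le> 6"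
  shows "transitive_on_s_arcs_from G.\<Gamma> (group_G F) G.\<rho> k semi_triangular"
proof -
  define x where "x = (!) [cosK id, cosH id, cosK \<delta>, cosH (\<delta> \<circ> \<tau>), cosK (\<delta> \<circ> \<tau> \<circ> \<delta>),
    cosH (\<delta> \<circ> \<tau> \<circ> \<delta> \<circ> \<tau>), cosK (\<delta> \<circ> \<tau> \<circ> \<delta> \<circ> \<tau> \<circ> \<delta>)]"
  have x: "x 0 = cosK id" "x (Suc 0) = cosH id" "x 2 = cosK \<delta>" "x 3 = cosH (\<delta> \<circ> \<tau>)"
    "x 4 = cosK (\<delta> \<circ> \<tau> \<circ> \<delta>)" "x 5 = cosH (\<delta> \<circ> \<tau> \<circ> \<delta> \<circ> \<tau>)"
    "x 6 = cosK (\<delta> \<circ> \<tau> \<circ> \<delta> \<circ> \<tau> \<circ> \<delta>)"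
    by (simp_all add: x_def)
  have base: "cosH id = semi_affine" "cosK id = semi_triangular"
    using G.base_cosets by (simp_all add: group_G_simps(3))
  have c: "id \<in> carrier (group_G F)" "\<delta> \<in> carrier (group_G F)" "\<delta> \<circ> \<tau> \<in> carrier (group_G F)"
    "\<delta> \<circ> \<tau> \<circ> \<delta> \<in> carrier (group_G F)" "\<delta> \<circ> \<tau> \<circ> \<delta> \<circ> \<tau> \<in> carrier (group_G F)"
    using G.one_closed by (simp_all add: comp_carrier gens_carrier group_G_simps(3))
  have ab: "cosH \<delta> = cosH id" "cosK (\<delta> \<circ> \<tau>) = cosK \<delta>" "cosH (\<delta> \<circ> \<tau> \<circ> \<delta>) = cosH (\<delta> \<circ> \<tau>)"
    "cosK (\<delta> \<circ> \<tau> \<circ> \<delta> \<circ> \<tau>) = cosK (\<delta> \<circ> \<tau> \<circ> \<delta>)"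
    using cos_absorb(1)[OF c(1) generators_mem(4)] cos_absorb(2)[OF c(2) generators_mem(1)]
      cos_absorb(1)[OF c(3) generators_mem(4)] cos_absorb(2)[OF c(4) generators_mem(1)] by simp_all
  have "transitive_on_s_arcs_from G.\<Gamma> (group_G F) G.\<rho> k (x 0)"
  proof (rule G.transitive_on_s_arcs_fromI[OF assms])
    fix i w assume i: "i < 6" and w: "w \<in> nbrs G.\<Gamma> (x i)" and ne: "0 < i \<Longrightarrow> w \<noteq> x (i - 1)"
    have J: "j = 0 \<or> j = Suc 0 \<or> j = 2 \<or> j = 3 \<or> j = 4 \<or> j = 5" if "j \<le> 5" for j :: nat using that by auto
    consider "i = 0" | "i = Suc 0" | "i = 2" | "i = 3" | "i = 4" | "i = 5" using J[of i] i by auto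
    then show "\<exists>g\<in>carrier (group_G F). (\<forall>j\<le>i. G.\<rho> g (x j) = x j) \<and> G.\<rho> g w = x (Suc i)"
    proof cases
      case 1
      then show ?thesis
        using step_at_base[of semi_triangular semi_affine w] w G.HK by (auto simp: x base)
    next
      case 2
      obtain e where e: "w = cosK (id \<circ> (perm_gamma e \<circ> \<delta>))"
        using nbrs_cosH[OF c(1), of w] w ne by (auto simp: x 2)
      let ?h = "perm_gamma (- e)"
      have h: "?h \<in> carrier (group_G F)" by (simp add: gens_carrier)
      have f: "fixes_flag ?h id (bmap id 1 1 (- e) 0 0 0 0)"
        using flag_id(2)[of "- e"] by (simp add: perm_gamma_bmap)
      have "G.\<rho> ?h w = x (Suc i)"
        unfolding e using extend_at_cosH[OF h f] by (simp add: x 2 numeral_2_eq_2[symmetric])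
      moreover have "G.\<rho> ?h (x j) = x j" if "j \<le> i" for j
        using that 2 fixes_flag_fixes[OF h f] by (auto simp: x le_Suc_eq)
      ultimately show ?thesis using h by blast
    next
      case 3
      obtain d where d: "d \<noteq> 0" "w = cosH (\<delta> \<circ> perm_tau d)"
        using nbrs_cosK[OF c(2), of w] w ne by (auto simp: x 3 ab)
      \<comment> \<open>The entries are those wanted at the next flag, exchanged by
        \<delta>.\<close>
      let ?h = "perm_beta 1 (1 / d)"
      have h: "?h \<in> carrier (group_G F)" using d by (simp add: gens_carrier)
      have f: "fixes_flag ?h id ?h" using d by (simp add: flag_id)
      have f2: "fixes_flag ?h \<delta> (perm_beta (1 / d) 1)" using flag_delta(2)[OF _ _ f] d by simp
      have "G.\<rho> ?h w = x (Suc i)"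
        unfolding d(2) using extend_at_cosK[OF h f2, of d] d by (simp add: x 3)
      moreover have "G.\<rho> ?h (x j) = x j" if "j \<le> i" for j
        using that 3 J[of j] fixes_flag_fixes[OF h f] fixes_flag_fixes[OF h f2] by (auto simp: x)
      ultimately show ?thesis using h by blast
    next
      case 4
      obtain e where e: "w = cosK (\<delta> \<circ> \<tau> \<circ> (perm_gamma e \<circ> \<delta>))"
        using nbrs_cosH[OF c(3), of w] w ne by (auto simp: x 4 ab)
      let ?h = "perm_alpha (- e) 0 0"
      have h: "?h \<in> carrier (group_G F)" by (simp add: gens_carrier)
      have f: "fixes_flag ?h id ?h" by (simp add: flag_id)
      have f2: "fixes_flag ?h \<delta> (perm_alpha 0 (- e) 0)" using flag_delta(1)[OF f] by simp
      have f3: "fixes_flag ?h (\<delta> \<circ> \<tau>) (bmap id 1 1 (- e) 0 (- (- e)\<^sup>2) (- e) 0)"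
        by (rule flag_tau(2)[OF f2])
      have "G.\<rho> ?h w = x (Suc i)"
        unfolding e using extend_at_cosH[OF h f3] by (simp add: x 4)
      moreover have "G.\<rho> ?h (x j) = x j" if "j \<le> i" for j
        using that 4 J[of j] fixes_flag_fixes[OF h f] fixes_flag_fixes[OF h f2] fixes_flag_fixes[OF h f3]
        by (auto simp: x)
      ultimately show ?thesis using h by blast
    next
      case 5
      obtain d where d: "d \<noteq> 0" "w = cosH (\<delta> \<circ> \<tau> \<circ> \<delta> \<circ> perm_tau d)"
        using nbrs_cosK[OF c(4), of w] w ne by (auto simp: x 5 ab)
      define m where "m = cbrt d"
      have m: "m \<noteq> 0" "m\<^sup>2 \<noteq> 0" "m / (m\<^sup>2)\<^sup>2 * d = 1" using cube_root_scale[OF d(1)] by (simp_all add: m_def)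
      \<comment> \<open>Between the two passages through \<delta> the pair is (m^2, m), which is
        harmless at \<tau>_1; afterwards it is (m, m^2) again and rescales the index.\<close>
      let ?h = "perm_beta m (m\<^sup>2)"
      have h: "?h \<in> carrier (group_G F)" using m by (simp add: gens_carrier)
      have f: "fixes_flag ?h id ?h" using m by (simp add: flag_id)
      have f2: "fixes_flag ?h \<delta> (perm_beta (m\<^sup>2) m)" using flag_delta(2)[OF m(1,2) f] by simp
      have f3: "fixes_flag ?h (\<delta> \<circ> \<tau>) (perm_beta (m\<^sup>2) m)" by (rule flag_tau(3)[OF m(1) f2])
      have f4: "fixes_flag ?h (\<delta> \<circ> \<tau> \<circ> \<delta>) ?h" by (rule flag_delta(2)[OF m(2,1) f3])
      have "G.\<rho> ?h w = x (Suc i)"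
        unfolding d(2) using extend_at_cosK[OF h f4 m] by (simp add: x 5)
      moreover have "G.\<rho> ?h (x j) = x j" if "j \<le> i" for j
        using that 5 J[of j] fixes_flag_fixes[OF h f] fixes_flag_fixes[OF h f2] fixes_flag_fixes[OF h f3]
          fixes_flag_fixes[OF h f4] by (auto simp: x)
      ultimately show ?thesis using h by blast
    next
      case 6
      obtain e where e: "w = cosK (\<delta> \<circ> \<tau> \<circ> \<delta> \<circ> \<tau> \<circ> (perm_gamma e \<circ> \<delta>))"
        using nbrs_cosH[OF c(5), of w] w ne by (auto simp: x 6 ab)
      \<comment> \<open>The first \<delta> turns the vector into (- e, 0), which the first \<tau>_1
        does not affect; the second \<delta> gives (0, - e), and the second \<tau>_1 the corner
        entry - e.\<close>
      let ?h = "perm_alpha 0 e 0"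
      have h: "?h \<in> carrier (group_G F)" by (simp add: gens_carrier)
      have f: "fixes_flag ?h id ?h" by (simp add: flag_id)
      have f2: "fixes_flag ?h \<delta> (perm_alpha (- e) 0 0)" using flag_delta(1)[OF f] by simp
      have f3: "fixes_flag ?h (\<delta> \<circ> \<tau>) (perm_alpha (- e) 0 0)" by (rule flag_tau(1)[OF f2])
      have f4: "fixes_flag ?h (\<delta> \<circ> \<tau> \<circ> \<delta>) (perm_alpha 0 (- e) 0)" using flag_delta(1)[OF f3] by simp
      have f5: "fixes_flag ?h (\<delta> \<circ> \<tau> \<circ> \<delta> \<circ> \<tau>) (bmap id 1 1 (- e) 0 (- (- e)\<^sup>2) (- e) 0)"
        by (rule flag_tau(2)[OF f4])
      have "G.\<rho> ?h w = x (Suc i)"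
        unfolding e using extend_at_cosH[OF h f5] by (simp add: x 6)
      moreover have "G.\<rho> ?h (x j) = x j" if "j \<le> i" for j
        using that 6 J[of j] fixes_flag_fixes[OF h f] fixes_flag_fixes[OF h f2] fixes_flag_fixes[OF h f3]
          fixes_flag_fixes[OF h f4] fixes_flag_fixes[OF h f5] by (auto simp: x)
      ultimately show ?thesis using h by blast
    qed
  qed
  then show ?thesis by (simp add: x base)
qed

lemma locally_5_arc_transitive: "locally_s_arc_transitive G.\<Gamma> (group_G F) G.\<rho> 5"
  unfolding locally_s_arc_transitive_def
proof
  fix z assume "z \<in> verts G.\<Gamma>"
  then show "transitive_on_s_arcs_from G.\<Gamma> (group_G F) G.\<rho> 5 z"
  proof (cases rule: G.vert_cases)
    case (1 g)
    then show ?thesis using G.transitive_on_s_arcs_from_action transitive_on_arcs_affine by simp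
  next
    case (2 g)
    then show ?thesis using G.transitive_on_s_arcs_from_action transitive_on_arcs_triangular by simp
  qed
qed

end

section \<open>Semilinear maps of the plane\<close>

definition sl :: "('a::{finite,field} \<Rightarrow> 'a) \<Rightarrow> 'a \<Rightarrow> 'a \<Rightarrow> 'a \<Rightarrow> 'a \<Rightarrow> 'a^2 \<Rightarrow> 'a^2" where
  "sl s x y z w = (\<lambda>p. vector [x * s (p $ 1) + y * s (p $ 2), z * s (p $ 1) + w * s (p $ 2)])"

lemma vec2_eq_iff: "p = q \<longleftrightarrow> p $ 1 = q $ 1 \<and> p $ 2 = q $ 2" for p q :: "'a^2"
  by (simp add: vec_eq_iff forall_2)

lemma sl_nth: "sl s x y z w p $ 1 = x * s (p $ 1) + y * s (p $ 2)"
    "sl s x y z w p $ 2 = z * s (p $ 1) + w * s (p $ 2)"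
  by (simp_all add: sl_def)

lemma sl_comp:
  assumes s': "field_aut s'"
  shows "sl s' x' y' z' w' \<circ> sl s x y z w =
    sl (\<lambda>a. s' (s a)) (x' * s' x + y' * s' z) (x' * s' y + y' * s' w)
      (z' * s' x + w' * s' z) (z' * s' y + w' * s' w)"
  by (rule ext) (simp add: vec2_eq_iff sl_nth field_aut_add[OF s'] field_aut_mult[OF s'] algebra_simps)

lemma det_comp:
  assumes s': "field_aut s'"
  shows "(x' * s' x + y' * s' z) * (z' * s' y + w' * s' w)
      - (x' * s' y + y' * s' w) * (z' * s' x + w' * s' z) = (x' * w' - y' * z') * s' (x * w - y * z)"
  by (simp add: field_aut_add[OF s'] field_aut_diff[OF s'] field_aut_mult[OF s'] algebra_simps)

lemma sl_eq_iff:
  assumes "field_aut s" "field_aut s'" "x * w - y * z \<noteq> 0"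
  shows "sl s x y z w = sl s' x' y' z' w' \<longleftrightarrow> s = s' \<and> x = x' \<and> y = y' \<and> z = z' \<and> w = w'"
    (is "?l \<longleftrightarrow> ?r")
proof
  assume eq: ?l
  note s01 = field_aut_0[OF assms(1)] field_aut_0[OF assms(2)] field_aut_1[OF assms(1)]
    field_aut_1[OF assms(2)]
  have 1: "x = x'" "z = z'" using fun_cong[OF eq, of "vector [1, 0]"] by (simp_all add: vec2_eq_iff sl_nth s01)
  have 2: "y = y'" "w = w'" using fun_cong[OF eq, of "vector [0, 1]"] by (simp_all add: vec2_eq_iff sl_nth s01)
  have "x * s a = x * s' a \<and> z * s a = z * s' a" for a
    using fun_cong[OF eq, of "vector [a, 0]"] 1 by (simp add: vec2_eq_iff sl_nth s01)
  moreover have "x \<noteq> 0 \<or> z \<noteq> 0" using assms(3) by auto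
  ultimately have "s = s'" by (auto simp: fun_eq_iff)
  then show ?r using 1 2 by simp
qed simp

lemma linear_system_2:
  fixes x :: "'a::field"
  assumes "x * w - y * z \<noteq> 0" and e: "x * a + y * b = 0" "z * a + w * b = 0"
  shows "a = 0 \<and> b = 0"
proof -
  have "(x * w - y * z) * a = w * (x * a + y * b) - y * (z * a + w * b)"
    "(x * w - y * z) * b = x * (z * a + w * b) - z * (x * a + y * b)"
    by (simp_all add: algebra_simps)
  then show ?thesis using assms(1) unfolding e by simp
qed

lemma sl_bij:
  assumes s: "field_aut s" and det: "x * w - y * z \<noteq> 0"
  shows "bij (sl s x y z w)"
proof -
  have "inj (sl s x y z w)"
  proof (rule injI)
    fix p p' assume eq: "sl s x y z w p = sl s x y z w p'"
    have lin: "a * (A - A') + b * (B - B') = (a * A + b * B) - (a * A' + b * B')" for a b A A' B B' :: 'a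
      by (simp add: algebra_simps)
    have "x * s (p $ 1) + y * s (p $ 2) = x * s (p' $ 1) + y * s (p' $ 2)"
      "z * s (p $ 1) + w * s (p $ 2) = z * s (p' $ 1) + w * s (p' $ 2)"
      using arg_cong[OF eq, of "\<lambda>v. v $ 1"] arg_cong[OF eq, of "\<lambda>v. v $ 2"]
      unfolding sl_nth by blast+
    then have e: "x * (s (p $ 1) - s (p' $ 1)) + y * (s (p $ 2) - s (p' $ 2)) = 0"
      "z * (s (p $ 1) - s (p' $ 1)) + w * (s (p $ 2) - s (p' $ 2)) = 0"
      unfolding lin by simp_all
    then show "p = p'"
      using linear_system_2[OF det e] by (simp add: vec2_eq_iff field_aut_inj[OF s])
  qed
  then show ?thesis by (simp add: bij_def finite_UNIV_inj_surj)
qed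

text \<open>The upper unitriangular matrices, that is, the stabilizer in SL2 of the first unit
  vector.\<close>

definition unip2 :: "'a::{finite,field} itself \<Rightarrow> ('a^2 \<Rightarrow> 'a^2) set" where
  "unip2 F = range (\<lambda>e. sl id 1 e 0 1)"

context
  fixes F :: "'a::{finite,field} itself"
begin

lemma GammaL2_carrier:
  "carrier (GammaL2 F) = {sl s x y z w | s x y z w. field_aut s \<and> x * w - y * z \<noteq> 0}"
proof (intro subset_antisym subsetI)
  fix f assume "f \<in> carrier (GammaL2 F)"
  then obtain s where f: "bij f" "\<And>v w. f (v + w) = f v + f w" and s: "field_aut s"
    and fs: "\<And>c v. f (c *s v) = s c *s f v" by (auto simp: GammaL2_def)
  define e1 :: "'a^2" where "e1 = vector [1, 0]"
  define e2 :: "'a^2" where "e2 = vector [0, 1]"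
  define x where "x = f e1 $ 1"
  define z where "z = f e1 $ 2"
  define y where "y = f e2 $ 1"
  define w where "w = f e2 $ 2"
  have eq: "f = sl s x y z w"
  proof
    fix p :: "'a^2"
    have "p = (p $ 1) *s e1 + (p $ 2) *s e2" by (simp add: vec2_eq_iff e1_def e2_def)
    then have "f p = s (p $ 1) *s f e1 + s (p $ 2) *s f e2" by (metis f(2) fs)
    then show "f p = sl s x y z w p"
      by (simp add: vec2_eq_iff sl_nth x_def y_def z_def w_def mult.commute)
  qed
  have "x * w - y * z \<noteq> 0"
  proof
    assume det: "x * w - y * z = 0"
    have zero: "p = 0 \<and> q = 0" if "x * p + y * q = 0" "z * p + w * q = 0" for p q
    proof -
      obtain p' q' where pq: "s p' = p" "s q' = q" using s by (metis bij_pointE field_aut_def)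
      have "f (vector [p', q']) = f 0"
        unfolding eq using that by (simp add: vec2_eq_iff sl_nth pq field_aut_0[OF s])
      then have "(vector [p', q'] :: 'a^2) = 0" using f(1) by (simp add: bij_def inj_eq)
      then show ?thesis using pq by (simp add: vec2_eq_iff field_aut_0[OF s] flip: pq)
    qed
    \<comment> \<open>If the determinant vanished, (y, - x) and (w, - z) would lie in the kernel;
      injectivity makes all entries zero, which is absurd.\<close>
    have "y = 0 \<and> - x = 0" "w = 0 \<and> - z = 0"
      using zero[of y "- x"] zero[of w "- z"] det by (simp_all add: algebra_simps)
    then show False using zero[of 1 0] by simp
  qed
  then show "f \<in> {sl s x y z w | s x y z w. field_aut s \<and> x * w - y * z \<noteq> 0}" using eq s by blast
next
  fix f :: "'a^2 \<Rightarrow> 'a^2"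
  assume "f \<in> {sl s x y z w | s x y z w. field_aut s \<and> x * w - y * z \<noteq> 0}"
  then obtain s x y z w where f: "f = sl s x y z w" "field_aut s" "x * w - y * z \<noteq> 0" by blast
  have "f (v + v') = f v + f v'" "f (c *s v) = s c *s f v" for v v' c
    unfolding f(1)
    by (simp_all add: vec2_eq_iff sl_nth field_aut_add[OF f(2)] field_aut_mult[OF f(2)] algebra_simps)
  then show "f \<in> carrier (GammaL2 F)"
    using sl_bij[OF f(2,3)] f by (auto simp: GammaL2_def)
qed

lemma sl_mem: "field_aut s \<Longrightarrow> x * w - y * z \<noteq> 0 \<Longrightarrow> sl s x y z w \<in> carrier (GammaL2 F)"
  unfolding GammaL2_carrier by blast

lemma GammaL2E:
  assumes "f \<in> carrier (GammaL2 F)"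
  obtains s x y z w where "f = sl s x y z w" "field_aut s" "x * w - y * z \<noteq> 0"
  using assms unfolding GammaL2_carrier by blast

lemma GammaL2_simps: "f \<otimes>\<^bsub>GammaL2 F\<^esub> g = f \<circ> g" "\<one>\<^bsub>GammaL2 F\<^esub> = id"
  by (simp_all add: GammaL2_def)

lemma group_GammaL2: "group (GammaL2 F)"
proof -
  have "group \<lparr>carrier = carrier (GammaL2 F), mult = (\<circ>), one = id\<rparr>"
  proof (rule group_of_bijections)
    show "carrier (GammaL2 F) \<subseteq> {f. bij f}" by (auto simp: GammaL2_def)
    show "carrier (GammaL2 F) \<noteq> {}" using sl_mem[OF field_aut_id(2), of 1 1 0 0] by auto
    fix f g assume fg: "f \<in> carrier (GammaL2 F)" "g \<in> carrier (GammaL2 F)"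
    obtain s x y z w where f: "f = sl s x y z w" "field_aut s" "x * w - y * z \<noteq> 0"
      using fg(1) by (rule GammaL2E)
    obtain s' x' y' z' w' where g: "g = sl s' x' y' z' w'" "field_aut s'" "x' * w' - y' * z' \<noteq> 0"
      using fg(2) by (rule GammaL2E)
    show "f \<circ> g \<in> carrier (GammaL2 F)"
      unfolding f(1) g(1) sl_comp[OF f(2)]
      by (rule sl_mem[OF field_aut_comp[OF f(2) g(2)]])
        (simp only: det_comp[OF f(2)] mult_eq_0_iff field_aut_eq_0[OF f(2)] f(3) g(3) simp_thms)
  qed
  then show ?thesis by (simp add: GammaL2_def)
qed

lemma scalar_sl: "(*s) c = sl id c 0 0 c"
  by (rule ext) (simp add: vec2_eq_iff sl_nth)

lemma scalars2_iff: "f \<in> scalars2 F \<longleftrightarrow> (\<exists>c. c \<noteq> 0 \<and> f = (*s) c)"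
  unfolding scalars2_def by blast

lemma scalars2_carrier: "scalars2 F \<subseteq> carrier (GammaL2 F)"
proof
  fix f assume "f \<in> scalars2 F"
  then obtain c where "c \<noteq> 0" "f = sl id c 0 0 c" unfolding scalars2_iff scalar_sl by blast
  then show "f \<in> carrier (GammaL2 F)" using sl_mem[OF field_aut_id(2), of c c 0 0] by simp
qed

lemma normal_scalars2: "scalars2 F \<lhd> GammaL2 F"
proof -
  interpret group "GammaL2 F" by (rule group_GammaL2)
  have sub: "subgroup (scalars2 F) (GammaL2 F)"
  proof (rule subgroup_of_finite)
    show "scalars2 F \<noteq> {}" using scalars2_iff one_neq_zero by blast
    fix f g assume "f \<in> scalars2 F" "g \<in> scalars2 F"
    then obtain c d where fg: "c \<noteq> 0" "f = (*s) c" "d \<noteq> 0" "g = (*s) d" unfolding scalars2_iff by blast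
    have "f \<circ> g = (*s) (c * d)" unfolding fg by (rule ext) (simp add: vec2_eq_iff mult.assoc)
    moreover have "c * d \<noteq> 0" using fg by simp
    ultimately show "f \<otimes>\<^bsub>GammaL2 F\<^esub> g \<in> scalars2 F" unfolding GammaL2_simps scalars2_iff by blast
  qed (simp_all add: scalars2_carrier)
  have "\<exists>h'\<in>scalars2 F. x \<otimes>\<^bsub>GammaL2 F\<^esub> h = h' \<otimes>\<^bsub>GammaL2 F\<^esub> x"
    if x: "x \<in> carrier (GammaL2 F)" and h: "h \<in> scalars2 F" for x h
  proof -
    obtain s where s: "field_aut s" "\<And>c v. x (c *s v) = s c *s x v" using x by (auto simp: GammaL2_def)
    obtain c where c: "c \<noteq> 0" "h = (*s) c" using h unfolding scalars2_iff by blast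
    have "x \<circ> h = (*s) (s c) \<circ> x" unfolding c(2) by (rule ext) (simp add: s(2))
    moreover have "s c \<noteq> 0" using c(1) field_aut_eq_0[OF s(1)] by simp
    ultimately show ?thesis unfolding GammaL2_simps Bex_def scalars2_iff by blast
  qed
  then have "scalars2 F \<lhd> (GammaL2 F)\<lparr>carrier := carrier (GammaL2 F)\<rparr>"
    by (intro normal_in_subgroupI sub subgroup_self scalars2_carrier)
  then show ?thesis by simp
qed

lemma group_PGammaL2: "group (PGammaL2 F)"
  unfolding PGammaL2_def using normal.factorgroup_is_group[OF normal_scalars2] .

lemma scalars2_coset_eq_iff:
  assumes f: "f \<in> carrier (GammaL2 F)" and g: "g \<in> carrier (GammaL2 F)"
  shows "scalars2 F #>\<^bsub>GammaL2 F\<^esub> f = scalars2 F #>\<^bsub>GammaL2 F\<^esub> g \<longleftrightarrow> (\<exists>c. c \<noteq> 0 \<and> f = (*s) c \<circ> g)"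
  unfolding group.rcos_eq_iff_factor[OF group_GammaL2 normal_imp_subgroup[OF normal_scalars2] f g]
    GammaL2_simps Bex_def scalars2_iff by blast

section \<open>The affine semilinear group of the line and SL2\<close>

lemma AGammaL1_carrier: "carrier (AGammaL1 F) = {\<lambda>x. a * s x + b | a s b. a \<noteq> 0 \<and> field_aut s}"
  by (simp add: AGammaL1_def)

lemma group_AGammaL1: "group (AGammaL1 F)"
proof -
  have "group \<lparr>carrier = carrier (AGammaL1 F), mult = (\<circ>), one = id\<rparr>"
  proof (rule group_of_bijections)
    show "carrier (AGammaL1 F) \<subseteq> {f. bij f}"
    proof
      fix f assume "f \<in> carrier (AGammaL1 F)"
      then obtain a s b where f: "f = (\<lambda>x. a * s x + b)" "a \<noteq> 0" "field_aut s"
        unfolding AGammaL1_carrier by blast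
      then have "inj f" by (auto intro!: injI simp: field_aut_inj)
      then show "f \<in> {f. bij f}" by (simp add: bij_def finite_UNIV_inj_surj)
    qed
    show "carrier (AGammaL1 F) \<noteq> {}" unfolding AGammaL1_carrier using field_aut_id(1) one_neq_zero by blast
    fix f g assume "f \<in> carrier (AGammaL1 F)" "g \<in> carrier (AGammaL1 F)"
    then obtain a s b a' s' b' where f: "f = (\<lambda>x. a * s x + b)" "a \<noteq> 0" "field_aut s"
      and g: "g = (\<lambda>x. a' * s' x + b')" "a' \<noteq> 0" "field_aut s'"
      unfolding AGammaL1_carrier by blast
    have "f \<circ> g = (\<lambda>x. (a * s a') * s (s' x) + (a * s b' + b))"
      by (simp add: fun_eq_iff f g field_aut_add[OF f(3)] field_aut_mult[OF f(3)] algebra_simps)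
    moreover have "a * s a' \<noteq> 0" using f g by (simp add: field_aut_eq_0)
    ultimately show "f \<circ> g \<in> carrier (AGammaL1 F)"
      unfolding AGammaL1_carrier mem_Collect_eq using field_aut_comp[OF f(3) g(3)]
      by (intro exI[of _ "a * s a'"] exI[of _ "\<lambda>x. s (s' x)"] exI[of _ "a * s b' + b"]) simp
  qed
  then show ?thesis by (simp add: AGammaL1_def)
qed

lemma SL2_carrier: "carrier (SL2 F) = {sl id x y z w | x y z w. x * w - y * z = 1}"
proof (intro subset_antisym subsetI)
  have mv: "(*v) A = sl id (A $ 1 $ 1) (A $ 1 $ 2) (A $ 2 $ 1) (A $ 2 $ 2)" for A :: "'a^2^2"
    by (rule ext) (simp add: vec2_eq_iff sl_nth matrix_vector_mult_def sum_2)
  {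
    fix f assume "f \<in> carrier (SL2 F)"
    then obtain A where "f = (*v) A" "det A = 1" by (auto simp: SL2_def)
    then show "f \<in> {sl id x y z w | x y z w. x * w - y * z = 1}" unfolding mv det_2 by blast
  next
    fix f assume "f \<in> {sl id x y z w | x y z w. x * w - y * z = (1::'a)}"
    then obtain x y z w where f: "f = sl id x y z w" "x * w - y * z = 1" by blast
    define A :: "'a^2^2" where "A = vector [vector [x, y], vector [z, w]]"
    have "f = (*v) A" "det A = 1" unfolding mv det_2 using f by (simp_all add: A_def)
    then show "f \<in> carrier (SL2 F)" by (auto simp: SL2_def)
  }
qed

lemma SL2_simps: "f \<otimes>\<^bsub>SL2 F\<^esub> g = f \<circ> g" "\<one>\<^bsub>SL2 F\<^esub> = id"
  by (simp_all add: SL2_def)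

lemma SL2_subset: "carrier (SL2 F) \<subseteq> carrier (GammaL2 F)"
proof
  fix f assume "f \<in> carrier (SL2 F)"
  then obtain x y z w where "f = sl id x y z w" "x * w - y * z = 1" unfolding SL2_carrier by blast
  then show "f \<in> carrier (GammaL2 F)" using sl_mem[OF field_aut_id(2), of x w y z] by simp
qed

lemma SL2_mult_closed: "f \<in> carrier (SL2 F) \<Longrightarrow> g \<in> carrier (SL2 F) \<Longrightarrow> f \<circ> g \<in> carrier (SL2 F)"
proof -
  assume "f \<in> carrier (SL2 F)" "g \<in> carrier (SL2 F)"
  then obtain x y z w x' y' z' w' where f: "f = sl id x y z w" "x * w - y * z = 1"
    and g: "g = sl id x' y' z' w'" "x' * w' - y' * z' = 1" unfolding SL2_carrier by blast
  have "f \<circ> g = sl id (x * x' + y * z') (x * y' + y * w') (z * x' + w * z') (z * y' + w * w')"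
    unfolding f g sl_comp[OF field_aut_id(2)] by (simp add: id_def)
  moreover have "(x * x' + y * z') * (z * y' + w * w') - (x * y' + y * w') * (z * x' + w * z') = 1"
    using det_comp[OF field_aut_id(2), of x x' y z' z y' w w'] f g by simp
  ultimately show "f \<circ> g \<in> carrier (SL2 F)" unfolding SL2_carrier by blast
qed

lemma id_SL2: "id \<in> carrier (SL2 F)"
proof -
  have "id = sl id 1 0 0 1" by (rule ext) (simp add: vec2_eq_iff sl_nth)
  moreover have "(1::'a) * 1 - 0 * 0 = 1" by simp
  ultimately show ?thesis unfolding SL2_carrier by blast
qed

lemma group_SL2: "group (SL2 F)"
proof -
  have "group \<lparr>carrier = carrier (SL2 F), mult = (\<circ>), one = id\<rparr>"
    using SL2_subset SL2_mult_closed id_SL2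
    by (intro group_of_bijections) (force simp: GammaL2_def)+
  then show ?thesis by (simp add: SL2_def)
qed

lemma unip2_comp: "sl id 1 e 0 1 \<circ> sl id 1 e' 0 1 = sl id 1 (e + e') 0 1"
  unfolding sl_comp[OF field_aut_id(2)] by (simp add: id_def add.commute)

lemma unip2_eq_iff: "sl id 1 e 0 1 = sl id 1 e' 0 1 \<longleftrightarrow> e = e'"
  by (simp add: sl_eq_iff[OF field_aut_id(2) field_aut_id(2)])

lemma unip2_subset: "unip2 F \<subseteq> carrier (SL2 F)"
  unfolding unip2_def SL2_carrier by force

lemma card_unip2: "card (unip2 F) = CARD('a)"
  unfolding unip2_def by (rule card_image) (rule injI, simp add: unip2_eq_iff)

end

section \<open>Sylow \<open>3\<close>-subgroups\<close>

text \<open>Orbit lengths are powers of p; without a fixed point all of them would be divisible by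
  p, and so would their sum.\<close>

lemma (in group_action) p_group_fixed_point:
  assumes "finite E" and "Coset.order G = p ^ k" and p: "prime p" and "\<not> p dvd card E"
  shows "\<exists>x\<in>E. \<forall>g\<in>carrier G. \<phi> g x = x"
proof (rule ccontr)
  assume no_fix: "\<not> ?thesis"
  have union: "\<Union>(orbits G E \<phi>) = E" by (rule orbits_coverture)
  have "p dvd card c" if c: "c \<in> orbits G E \<phi>" for c
  proof -
    obtain x where x: "x \<in> E" "c = orbit G \<phi> x" using c by (auto simp: orbits_def)
    have "card c dvd p ^ k" using orbit_stabilizer_theorem[OF x(1)] x(2) assms(2) by (metis dvd_triv_left)
    then obtain j where j: "card c = p ^ j" using p divides_primepow_nat by blast
    have "j \<noteq> 0"
    proof
      assume "j = 0"
      then have "card c = 1" using j by simp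
      then obtain y where y: "c = {y}" by (auto simp: card_1_singleton_iff)
      have "x \<in> c" using x orbit_refl by simp
      then have "c = {x}" using y by simp
      then have "\<phi> g x = x" if "g \<in> carrier G" for g
        using that x(2) by (auto simp: orbit_def)
      then show False using no_fix x(1) by blast
    qed
    then show ?thesis using j by simp
  qed
  then have "p dvd card (\<Union>(orbits G E \<phi>))"
    using disjoint_union assms(1) union by (intro dvd_partition) auto
  then show False using union assms(4) by simp
qed

context field_char_3
begin

lemma card_nonzero_vectors: "card {v::'a^2. v \<noteq> 0} = 3 ^ r * 3 ^ r - 1"
proof -
  have "{v::'a^2. v \<noteq> 0} = UNIV - {0}" by auto
  then show ?thesis by (simp add: card_Diff_singleton CARD power2_eq_square)
qed

lemma not_3_dvd: "\<not> 3 dvd (3 ^ r * 3 ^ r - 1 :: nat)"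
proof
  assume "(3::nat) dvd 3 ^ r * 3 ^ r - 1"
  moreover have "(3::nat) dvd 3 ^ r * 3 ^ r" using r by (simp add: dvd_power)
  ultimately have "(3::nat) dvd 3 ^ r * 3 ^ r - (3 ^ r * 3 ^ r - 1)" by (rule dvd_diff_nat[rotated])
  then show False by (simp add: Suc_leI)
qed

text \<open>A matrix of determinant 1 is given by its first column v, any nonzero vector, and a
  second column; the latter is determined up to adding a multiple k v, which explains the two
  formulas.\<close>

lemma card_SL2: "card (carrier (SL2 F)) = 3 ^ r * (3 ^ r * 3 ^ r - 1)"
proof -
  let ?f = "\<lambda>(v::'a^2, k). if v $ 1 = 0 then sl id 0 (- 1 / v $ 2) (v $ 2) (k * v $ 2)
    else sl id (v $ 1) (k * v $ 1) (v $ 2) (1 / v $ 1 + k * v $ 2)"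
  have "bij_betw ?f ({v. v \<noteq> 0} \<times> UNIV) (carrier (SL2 F))"
    unfolding bij_betw_def
  proof
    show "inj_on ?f ({v. v \<noteq> 0} \<times> UNIV)"
    proof (rule inj_onI)
      fix p p' assume p: "p \<in> {v. v \<noteq> 0} \<times> UNIV" "p' \<in> {v. v \<noteq> 0} \<times> UNIV" and "?f p = ?f p'"
      obtain v k v' k' where pp: "p = (v, k)" "p' = (v', k')" by (metis surj_pair)
      have v: "v \<noteq> 0" "v' \<noteq> 0" and eq: "?f (v, k) = ?f (v', k')" using p \<open>?f p = ?f p'\<close> pp by simp_all
      have "?f (v, k) (vector [1, 0]) = v" "?f (v', k') (vector [1, 0]) = v'"
        by (auto simp: vec2_eq_iff sl_nth)
      then have vv: "v = v'" using eq by simp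
      have "?f (v, k) (vector [0, 1]) = ?f (v, k') (vector [0, 1])" using eq vv by simp
      then have "k = k'" using v(1) by (auto simp: vec2_eq_iff sl_nth split: if_splits)
      then show "p = p'" using vv pp by simp
    qed
    show "?f ` ({v. v \<noteq> 0} \<times> UNIV) = carrier (SL2 F)"
    proof (intro subset_antisym subsetI)
      fix f assume "f \<in> ?f ` ({v. v \<noteq> 0} \<times> UNIV)"
      then obtain v k where v: "v \<noteq> 0" and f: "f = ?f (v, k)" by auto
      show "f \<in> carrier (SL2 F)"
      proof (cases "v $ 1 = 0")
        case True
        then have "v $ 2 \<noteq> 0" using v by (auto simp: vec2_eq_iff)
        then have "0 * (k * v $ 2) - (- 1 / v $ 2) * v $ 2 = 1" by simp
        moreover have "f = sl id 0 (- 1 / v $ 2) (v $ 2) (k * v $ 2)" using f True by simp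
        ultimately show ?thesis unfolding SL2_carrier by blast
      next
        case False
        then have "v $ 1 * (1 / v $ 1 + k * v $ 2) - (k * v $ 1) * v $ 2 = 1"
          by (simp add: algebra_simps)
        moreover have "f = sl id (v $ 1) (k * v $ 1) (v $ 2) (1 / v $ 1 + k * v $ 2)" using f False by simp
        ultimately show ?thesis unfolding SL2_carrier by blast
      qed
    next
      fix f assume "f \<in> carrier (SL2 F)"
      then obtain x y z w where f: "f = sl id x y z w" "x * w - y * z = 1" unfolding SL2_carrier by blast
      let ?v = "vector [x, z] :: 'a^2"
      have v: "?v \<noteq> 0" using f(2) by (auto simp: vec2_eq_iff)
      show "f \<in> ?f ` ({v. v \<noteq> 0} \<times> UNIV)"
      proof (cases "x = 0")
        case True
        then have z: "z \<noteq> 0" using f(2) by auto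
        have "y * z = - 1" using f(2) True by (simp add: minus_equation_iff)
        moreover have "y = y * z / z" using z by simp
        ultimately have "y = - 1 / z" by metis
        then have "f = ?f (?v, w / z)" using True z f(1) by simp
        then show ?thesis using v by (intro image_eqI[of _ _ "(?v, w / z)"]) auto
      next
        case False
        have "w = 1 / x + y / x * z" using f(2) False by (simp add: field_simps)
        then have "f = ?f (?v, y / x)" using False f(1) by simp
        then show ?thesis using v by (intro image_eqI[of _ _ "(?v, y / x)"]) auto
      qed
    qed
  qed
  then have "card (carrier (SL2 F)) = card ({v::'a^2. v \<noteq> 0} \<times> (UNIV::'a set))"
    by (rule bij_betw_same_card[symmetric])
  then show ?thesis
    by (simp only: card_cartesian_product card_nonzero_vectors CARD mult.commute)
qed

text \<open>The exponent k is left free to cover both SL2, of order q (q^2 - 1), and ASL2, of order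
  q^3 (q^2 - 1).\<close>

lemma multiplicity_card:
  fixes n :: nat
  assumes "n = 3 ^ k * (3 ^ r * 3 ^ r - 1)" shows "multiplicity 3 n = k"
proof (rule multiplicity_eqI)
  show "3 ^ k dvd n" by (simp add: assms)
  show "\<not> 3 ^ Suc k dvd n" using not_3_dvd by (simp add: assms mult.commute[of "3::nat"])
qed

lemma SL2_move_vector:
  assumes "v \<noteq> 0"
  obtains g where "g \<in> carrier (SL2 F)" "g (vector [1, 0]) = v"
proof (cases "v $ 1 = 0")
  case True
  then have v2: "v $ 2 \<noteq> 0" using assms by (auto simp: vec2_eq_iff)
  have "0 * 0 - (- 1 / v $ 2) * v $ 2 = 1" using v2 by simp
  then have "sl id 0 (- 1 / v $ 2) (v $ 2) 0 \<in> carrier (SL2 F)" unfolding SL2_carrier by blast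
  then show ?thesis by (rule that) (simp add: vec2_eq_iff sl_nth True)
next
  case False
  have "v $ 1 * (1 / v $ 1) - 0 * v $ 2 = 1" using False by simp
  then have "sl id (v $ 1) 0 (v $ 2) (1 / v $ 1) \<in> carrier (SL2 F)" unfolding SL2_carrier by blast
  then show ?thesis by (rule that) (simp add: vec2_eq_iff sl_nth)
qed

lemma SL2_fixes_vector:
  assumes "f \<in> carrier (SL2 F)" "f (vector [1, 0]) = vector [1, 0]" shows "f \<in> unip2 F"
proof -
  obtain x y z w where f: "f = sl id x y z w" "x * w - y * z = 1"
    using assms(1) unfolding SL2_carrier by blast
  have "x = 1" "z = 0" using assms(2) by (simp_all add: f vec2_eq_iff sl_nth)
  then show ?thesis using f by (simp add: unip2_def)
qed

lemma sylow_SL2_conj: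
  assumes S0: "sylow_subgroup 3 (SL2 F) S0"
  obtains g where "g \<in> carrier (SL2 F)" "S0 = {f \<in> carrier (SL2 F). \<exists>u\<in>unip2 F. f \<circ> g = g \<circ> u}"
proof -
  have sub: "subgroup S0 (SL2 F)" and card: "card S0 = 3 ^ r"
    using S0 multiplicity_card[OF card_SL2] by (simp_all add: sylow_subgroup_def)
  have S0c: "f \<in> carrier (SL2 F)" if "f \<in> S0" for f using that subgroup.mem_carrier[OF sub] by blast
  have fB: "bij f" "f 0 = 0" if "f \<in> S0" for f
  proof -
    have f: "f \<in> carrier (GammaL2 F)" using S0c[OF that] SL2_subset by blast
    then show "bij f" by (simp add: GammaL2_def)
    have "\<And>v w. f (v + w) = f v + f w" using f by (simp add: GammaL2_def)
    then have "f (0 + 0) = f 0 + f 0" .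
    then show "f 0 = 0" by (metis add.right_neutral add_cancel_left_right)
  qed
  let ?E = "{v::'a^2. v \<noteq> 0}" and ?G = "(SL2 F)\<lparr>carrier := S0\<rparr>"
  have mem: "f v \<in> ?E \<longleftrightarrow> v \<in> ?E" if "f \<in> S0" for f v
  proof -
    have "f v = f 0 \<longleftrightarrow> v = 0" using fB(1)[OF that] unfolding bij_def by (simp only: inj_eq)
    then show ?thesis by (simp add: fB(2)[OF that])
  qed
  have bij: "bij_betw f ?E ?E" if f: "f \<in> S0" for f
  proof (rule bij_betwI')
    show "f v = f v' \<longleftrightarrow> v = v'" for v v' using fB(1)[OF f] unfolding bij_def by (simp only: inj_eq)
    show "f v \<in> ?E" if "v \<in> ?E" for v using mem[OF f] that by blast
    show "\<exists>v\<in>?E. w = f v" if w: "w \<in> ?E" for w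
    proof -
      obtain v where "w = f v" using fB(1)[OF f] by (metis bij_pointE)
      then show ?thesis using mem[OF f, of v] w by blast
    qed
  qed
  have "group_action ?G ?E (\<lambda>f. restrict f ?E)"
  proof (rule group_action.intro)
    show "group_hom ?G (BijGroup ?E) (\<lambda>f. restrict f ?E)"
      unfolding group_hom_def group_hom_axioms_def
    proof (intro conjI group_BijGroup homI)
      show "group ?G" using subgroup.subgroup_is_group[OF sub group_SL2] .
      fix f g assume fg: "f \<in> carrier ?G" "g \<in> carrier ?G"
      have R: "restrict f ?E \<in> Bij ?E" if "f \<in> S0" for f
        using bij[OF that] by (simp add: Bij_def)
      show "restrict f ?E \<in> carrier (BijGroup ?E)" using R fg by (simp add: BijGroup_def)
      show "restrict (f \<otimes>\<^bsub>?G\<^esub> g) ?E = restrict f ?E \<otimes>\<^bsub>BijGroup ?E\<^esub> restrict g ?E"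
        using R fg mem[of g] by (auto simp: BijGroup_def SL2_simps compose_def fun_eq_iff)
    qed
  qed
  then interpret group_action ?G ?E "\<lambda>f. restrict f ?E" .
  \<comment> \<open>The q^2 - 1 nonzero vectors are not divisible by 3 in number, so the 3-group
    \<open>S0\<close> fixes one of them.\<close>
  have "\<exists>v\<in>?E. \<forall>f\<in>carrier ?G. restrict f ?E v = v"
    by (rule p_group_fixed_point[of 3 r]) (use card not_3_dvd card_nonzero_vectors in \<open>auto simp: Coset.order_def\<close>)
  then obtain v where v: "v \<noteq> 0" "\<And>f. f \<in> S0 \<Longrightarrow> f v = v" by auto
  obtain g where g: "g \<in> carrier (SL2 F)" "g (vector [1, 0]) = v" using SL2_move_vector[OF v(1)] .
  interpret SL: group "SL2 F" by (rule group_SL2)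
  define g' where "g' = inv\<^bsub>SL2 F\<^esub> g"
  have g': "g' \<in> carrier (SL2 F)" "g \<circ> g' = id" "g' \<circ> g = id"
    using g SL.r_inv[OF g(1)] SL.l_inv[OF g(1)] by (simp_all add: g'_def SL2_simps)
  let ?T = "{f \<in> carrier (SL2 F). \<exists>u\<in>unip2 F. f \<circ> g = g \<circ> u}"
  have "S0 \<subseteq> ?T"
  proof
    fix f assume f: "f \<in> S0"
    let ?u = "g' \<circ> (f \<circ> g)"
    have "?u (vector [1, 0]) = g' (g (vector [1, 0]))" using v(2)[OF f] g(2) by simp
    also have "\<dots> = vector [1, 0]" using g'(3) by (metis comp_apply id_apply)
    finally have fix_e1: "?u (vector [1, 0]) = vector [1, 0]" .
    have "?u \<in> carrier (SL2 F)" by (intro SL2_mult_closed g'(1) g(1) S0c[OF f])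
    then have "?u \<in> unip2 F" using fix_e1 by (rule SL2_fixes_vector)
    moreover have "f \<circ> g = g \<circ> ?u" by (simp add: g'(2) flip: comp_assoc)
    ultimately show "f \<in> ?T" using S0c[OF f] by blast
  qed
  \<comment> \<open>\<open>?T\<close> lies in a conjugate of \<open>unip2 F\<close> and so has at
    most q elements, the order of \<open>S0\<close>; the inclusion is an equality.\<close>
  moreover have "card ?T \<le> 3 ^ r"
  proof -
    have "?T \<subseteq> (\<lambda>u. g \<circ> (u \<circ> g')) ` unip2 F"
    proof
      fix f assume "f \<in> ?T"
      then obtain u where u: "u \<in> unip2 F" "f \<circ> g = g \<circ> u" by blast
      have "f = f \<circ> g \<circ> g'" by (simp add: comp_assoc g'(2))
      then have "f = g \<circ> (u \<circ> g')" by (simp add: u(2) comp_assoc)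
      then show "f \<in> (\<lambda>u. g \<circ> (u \<circ> g')) ` unip2 F" using u(1) by blast
    qed
    then have "card ?T \<le> card (unip2 F)" by (rule surj_card_le[rotated]) simp
    then show ?thesis by (simp add: card_unip2 CARD)
  qed
  ultimately have "S0 = ?T" using card by (intro card_seteq) simp_all
  then show ?thesis using that g(1) by blast
qed

end

section \<open>Elementary abelian groups, normalizers and ASL2\<close>

lemma comm_group_additive:
  "comm_group \<lparr>carrier = (UNIV :: 'b::ab_group_add set), mult = (+), one = 0\<rparr>"
proof (rule comm_groupI)
  fix x :: 'b
  show "\<exists>y\<in>carrier \<lparr>carrier = UNIV, mult = (+), one = 0\<rparr>.
      y \<otimes>\<^bsub>\<lparr>carrier = UNIV, mult = (+), one = 0\<rparr>\<^esub> x = \<one>\<^bsub>\<lparr>carrier = UNIV, mult = (+), one = 0\<rparr>\<^esub>"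
    by (intro bexI[of _ "- x"]) auto
qed (auto simp: ac_simps)

lemma elementary_abelian_additive:
  assumes "\<And>x::'b::{ab_group_add,finite}. x + x + x = 0"
  shows "elementary_abelian 3 \<lparr>carrier = (UNIV :: 'b set), mult = (+), one = 0\<rparr>"
  using assms comm_group_additive[where 'b = 'b]
  by (simp add: elementary_abelian_def numeral_3_eq_3 nat_pow_def)

text \<open>Conjugation is injective, so for a finite set mapping it into itself already means
  mapping it onto itself. The equational form avoids inverses in later computations.\<close>

lemma (in group) normalizer_iff:
  assumes S: "finite S" "S \<subseteq> carrier G"
  shows "f \<in> normalizer G S \<longleftrightarrow> f \<in> carrier G \<and> (\<forall>u\<in>S. \<exists>u'\<in>S. f \<otimes> u = u' \<otimes> f)"
proof (cases "f \<in> carrier G")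
  case f: True
  have img: "f <# S #> inv f = (\<lambda>u. f \<otimes> u \<otimes> inv f) ` S"
    by (auto simp: l_coset_def r_coset_def)
  have inj: "inj_on (\<lambda>u. f \<otimes> u \<otimes> inv f) S"
    by (rule inj_onI) (use f S in \<open>auto simp: subset_iff\<close>)
  have "f \<in> normalizer G S \<longleftrightarrow> (\<lambda>u. f \<otimes> u \<otimes> inv f) ` S = S"
    using f S by (simp add: normalizer_def stabilizer_def img)
  also have "\<dots> \<longleftrightarrow> (\<lambda>u. f \<otimes> u \<otimes> inv f) ` S \<subseteq> S"
    using endo_inj_surj[OF S(1) _ inj] by auto
  also have "\<dots> \<longleftrightarrow> (\<forall>u\<in>S. f \<otimes> u \<otimes> inv f \<in> S)" by auto
  also have "\<dots> \<longleftrightarrow> (\<forall>u\<in>S. \<exists>u'\<in>S. f \<otimes> u = u' \<otimes> f)"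
  proof (intro ball_cong refl)
    fix u assume "u \<in> S"
    then have u: "u \<in> carrier G" using S by blast
    show "f \<otimes> u \<otimes> inv f \<in> S \<longleftrightarrow> (\<exists>u'\<in>S. f \<otimes> u = u' \<otimes> f)"
    proof
      assume *: "f \<otimes> u \<otimes> inv f \<in> S"
      have "f \<otimes> u = f \<otimes> u \<otimes> inv f \<otimes> f" using f u by (simp add: m_assoc)
      then show "\<exists>u'\<in>S. f \<otimes> u = u' \<otimes> f" by (rule bexI[OF _ *])
    next
      assume "\<exists>u'\<in>S. f \<otimes> u = u' \<otimes> f"
      then obtain u' where u': "u' \<in> S" "f \<otimes> u = u' \<otimes> f" by blast
      have "u' \<in> carrier G" using u'(1) S by blast
      then have "f \<otimes> u \<otimes> inv f = u'" unfolding u'(2) using f by (simp add: m_assoc)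
      then show "f \<otimes> u \<otimes> inv f \<in> S" using u'(1) by simp
    qed
  qed
  finally show ?thesis using f by simp
next
  case False
  then show ?thesis by (simp add: normalizer_def stabilizer_def)
qed

lemma (in group) normalizer_conj_iso:
  assumes S: "finite S" "S \<subseteq> carrier G" and g: "g \<in> carrier G"
  shows "G\<lparr>carrier := normalizer G S\<rparr> \<cong> G\<lparr>carrier := normalizer G ((\<lambda>u. inv g \<otimes> u \<otimes> g) ` S)\<rparr>"
proof -
  let ?c = "\<lambda>u. inv g \<otimes> u \<otimes> g"
  have iso: "?c \<in> iso (G\<lparr>carrier := carrier G\<rparr>) (G\<lparr>carrier := ?c ` carrier G\<rparr>)"
    by (rule conjugation_iso[OF g subset_refl])
  have cm: "?c (x \<otimes> y) = ?c x \<otimes> ?c y" if "x \<in> carrier G" "y \<in> carrier G" for x y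
    using iso that by (auto simp: iso_def hom_def)
  have ci: "x = y" if "?c x = ?c y" "x \<in> carrier G" "y \<in> carrier G" for x y
    using iso that by (auto simp: iso_def bij_betw_def inj_on_def)
  have S': "finite (?c ` S)" "?c ` S \<subseteq> carrier G" using S g by auto
  have nS: "normalizer G S \<subseteq> carrier G" by (auto simp: normalizer_def stabilizer_def)
  have mem: "?c y \<in> normalizer G (?c ` S) \<longleftrightarrow> y \<in> normalizer G S" if y: "y \<in> carrier G" for y
  proof -
    have "?c y \<otimes> ?c u = ?c u' \<otimes> ?c y \<longleftrightarrow> y \<otimes> u = u' \<otimes> y" if "u \<in> S" "u' \<in> S" for u u'
    proof -
      have c: "u \<in> carrier G" "u' \<in> carrier G" using that S by auto
      show ?thesis
        unfolding cm[OF y c(1), symmetric] cm[OF c(2) y, symmetric]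
        using ci[OF _ m_closed[OF y c(1)] m_closed[OF c(2) y]] by metis
    qed
    then have "(\<forall>u\<in>?c ` S. \<exists>u'\<in>?c ` S. ?c y \<otimes> u = u' \<otimes> ?c y) \<longleftrightarrow> (\<forall>u\<in>S. \<exists>u'\<in>S. y \<otimes> u = u' \<otimes> y)"
      by (simp only: ball_simps bex_simps cong: ball_cong bex_cong)
    moreover have "?c y \<in> carrier G" using y g by simp
    ultimately show ?thesis
      unfolding normalizer_iff[OF S] normalizer_iff[OF S'] using y by blast
  qed
  have "normalizer G (?c ` S) = ?c ` normalizer G S"
  proof (intro subset_antisym subsetI)
    fix x assume x: "x \<in> normalizer G (?c ` S)"
    then have xc: "x \<in> carrier G" by (simp add: normalizer_def stabilizer_def)
    have "x \<in> ?c ` carrier G" unfolding conj_mem_iff[OF g subset_refl] using xc g by simp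
    then obtain y where "y \<in> carrier G" "x = ?c y" by blast
    then show "x \<in> ?c ` normalizer G S" using mem[of y] x by simp
  qed (use mem nS in auto)
  then show ?thesis using is_isoI[OF conjugation_iso[OF g nS]] by simp
qed

context
  fixes F :: "'a::{finite,field} itself"
begin

lemma unip2I: "sl id 1 e 0 1 \<in> unip2 F"
  by (simp add: unip2_def)

lemma unip2E:
  assumes "u \<in> unip2 F" obtains e where "u = sl id 1 e 0 1"
  using assms unfolding unip2_def by blast

lemma normalizer_unip2:
  "normalizer (GammaL2 F) (unip2 F) = {sl s x y 0 w | s x y w. field_aut s \<and> x \<noteq> 0 \<and> w \<noteq> 0}"
proof -
  interpret group "GammaL2 F" by (rule group_GammaL2)
  have S: "finite (unip2 F)" "unip2 F \<subseteq> carrier (GammaL2 F)"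
    using subset_trans[OF unip2_subset SL2_subset] by simp_all
  show ?thesis
  proof (intro subset_antisym subsetI)
    fix f assume "f \<in> normalizer (GammaL2 F) (unip2 F)"
    then have fn: "f \<in> carrier (GammaL2 F) \<and> (\<forall>u\<in>unip2 F. \<exists>u'\<in>unip2 F. f \<circ> u = u' \<circ> f)"
      unfolding normalizer_iff[OF S] GammaL2_simps .
    then have f: "f \<in> carrier (GammaL2 F)" ..
    obtain s x y z w where *: "f = sl s x y z w" "field_aut s" "x * w - y * z \<noteq> 0"
      using f by (rule GammaL2E)
    obtain u where u: "u \<in> unip2 F" "f \<circ> sl id 1 1 0 1 = u \<circ> f"
      using bspec[OF conjunct2[OF fn] unip2I[of 1]] by (rule bexE)
    obtain e where "u = sl id 1 e 0 1" using u(1) by (rule unip2E)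
    then have e: "f \<circ> sl id 1 1 0 1 = sl id 1 e 0 1 \<circ> f" using u(2) by simp
    have "z = 0"
      \<comment> \<open>At (0, 1) the second coordinates of the two sides are z + w and w.\<close>
      using arg_cong[OF fun_cong[OF e, of "vector [0, 1]"], of "\<lambda>v. v $ 2"]
      by (simp add: *(1) sl_nth field_aut_0[OF *(2)] field_aut_1[OF *(2)])
    moreover from this have "x \<noteq> 0" "w \<noteq> 0" using *(3) by auto
    ultimately show "f \<in> {sl s x y 0 w | s x y w. field_aut s \<and> x \<noteq> 0 \<and> w \<noteq> 0}" using *(1,2) by blast
  next
    fix f :: "'a^2 \<Rightarrow> 'a^2"
    assume "f \<in> {sl s x y 0 w | s x y w. field_aut s \<and> x \<noteq> 0 \<and> w \<noteq> 0}"
    then obtain s x y w where *: "f = sl s x y 0 w" "field_aut s" "x \<noteq> 0" "w \<noteq> 0" by blast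
    have "f \<in> carrier (GammaL2 F)" unfolding *(1) by (rule sl_mem) (use * in simp_all)
    moreover have "\<exists>u'\<in>unip2 F. f \<circ> u = u' \<circ> f" if u: "u \<in> unip2 F" for u
    proof -
      obtain e where "u = sl id 1 e 0 1" using u by (rule unip2E)
      \<comment> \<open>Conjugation by a triangular semilinear map multiplies the corner entry by
        the quotient x / w of the diagonal entries.\<close>
      then have "f \<circ> u = sl id 1 (x * s e / w) 0 1 \<circ> f"
        unfolding *(1) using *(4) by (simp only: sl_comp[OF *(2)] sl_comp[OF field_aut_id(2)])
          (simp add: field_aut_0[OF *(2)] field_aut_1[OF *(2)] add.commute)
      then show ?thesis using unip2I by (rule bexI)
    qed
    ultimately show "f \<in> normalizer (GammaL2 F) (unip2 F)"
      unfolding normalizer_iff[OF S] GammaL2_simps by simp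
  qed
qed

lemma SL2_additive: "f \<in> carrier (SL2 F) \<Longrightarrow> f (v + w) = f v + f w"
proof -
  assume "f \<in> carrier (SL2 F)"
  then have "f \<in> carrier (GammaL2 F)" using SL2_subset by blast
  then show ?thesis by (simp add: GammaL2_def)
qed

lemma ASL2_simps:
  "carrier (ASL2 F) = UNIV \<times> carrier (SL2 F)" "\<one>\<^bsub>ASL2 F\<^esub> = (0, id)"
  "(n, k) \<otimes>\<^bsub>ASL2 F\<^esub> (n', k') = (n + k n', k \<circ> k')"
  by (simp_all add: ASL2_def semidirect_def SL2_simps)

lemma group_ASL2: "group (ASL2 F)"
proof (rule groupI)
  fix p assume "p \<in> carrier (ASL2 F)"
  then obtain n k where p: "p = (n, k)" "k \<in> carrier (SL2 F)" by (auto simp: ASL2_simps)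
  interpret SL: group "SL2 F" by (rule group_SL2)
  let ?k = "inv\<^bsub>SL2 F\<^esub> k"
  have "?k \<in> carrier (SL2 F)" "?k \<circ> k = id" using p SL.l_inv[of k] by (simp_all add: SL2_simps)
  then show "\<exists>q\<in>carrier (ASL2 F). q \<otimes>\<^bsub>ASL2 F\<^esub> p = \<one>\<^bsub>ASL2 F\<^esub>"
    by (intro bexI[of _ "(- ?k n, ?k)"]) (simp_all add: p ASL2_simps)
next
  fix p q t assume "p \<in> carrier (ASL2 F)" "q \<in> carrier (ASL2 F)" "t \<in> carrier (ASL2 F)"
  then show "p \<otimes>\<^bsub>ASL2 F\<^esub> q \<otimes>\<^bsub>ASL2 F\<^esub> t = p \<otimes>\<^bsub>ASL2 F\<^esub> (q \<otimes>\<^bsub>ASL2 F\<^esub> t)"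
    by (auto simp: ASL2_simps SL2_additive comp_assoc add.assoc)
qed (auto simp: ASL2_simps SL2_mult_closed id_SL2)

end

context field_char_3
begin

lemma sylow_ASL2: "sylow_subgroup 3 (ASL2 F) (UNIV \<times> unip2 F)"
proof -
  interpret group "ASL2 F" by (rule group_ASL2)
  let ?P = "(UNIV :: ('a^2) set) \<times> unip2 F"
  have sub: "subgroup ?P (ASL2 F)"
  proof (rule subgroup_of_finite)
    show "?P \<subseteq> carrier (ASL2 F)" using unip2_subset unfolding ASL2_simps by blast
    show "?P \<noteq> {}" by (auto simp: unip2_def)
    fix p q :: "('a^2) \<times> ('a^2 \<Rightarrow> 'a^2)" assume "p \<in> ?P" "q \<in> ?P"
    then obtain n e n' e' where "p = (n, sl id 1 e 0 1)" "q = (n', sl id 1 e' 0 1)"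
      by (auto simp: unip2_def)
    then show "p \<otimes>\<^bsub>ASL2 F\<^esub> q \<in> ?P"
      by (simp add: ASL2_simps unip2_comp) (simp add: unip2_def)
  qed simp
  have vec: "CARD('a^2) = 3 ^ r * 3 ^ r" by (simp add: CARD power2_eq_square)
  have "card (?P) = 3 ^ (3 * r)"
    unfolding card_cartesian_product card_unip2 vec CARD by (simp flip: power_add)
  moreover have "card (carrier (ASL2 F)) = 3 ^ (3 * r) * (3 ^ r * 3 ^ r - 1)"
    unfolding ASL2_simps card_cartesian_product vec card_SL2 by (simp flip: power_add add: mult.assoc)
  ultimately show ?thesis
    unfolding sylow_subgroup_def using multiplicity_card[of _ "3 * r"] sub by simp
qed

lemma sylow_normalizer_iso:
  assumes S0: "sylow_subgroup 3 (SL2 F) S0"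
  shows "GammaL2_normalizer F (unip2 F) \<cong> GammaL2_normalizer F S0"
proof -
  interpret group "GammaL2 F" by (rule group_GammaL2)
  have S: "finite (unip2 F)" "unip2 F \<subseteq> carrier (GammaL2 F)"
    using subset_trans[OF unip2_subset SL2_subset] by simp_all
  obtain g where g: "g \<in> carrier (SL2 F)" and S0': "S0 = {f \<in> carrier (SL2 F). \<exists>u\<in>unip2 F. f \<circ> g = g \<circ> u}"
    using sylow_SL2_conj[OF S0] .
  interpret SL: group "SL2 F" by (rule group_SL2)
  define g' where "g' = inv\<^bsub>SL2 F\<^esub> g"
  have g': "g' \<in> carrier (SL2 F)" "g \<circ> g' = id" "g' \<circ> g = id"
    using g SL.r_inv[OF g(1)] SL.l_inv[OF g(1)] by (simp_all add: g'_def SL2_simps)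
  have gc: "g \<in> carrier (GammaL2 F)" "g' \<in> carrier (GammaL2 F)" using g g' SL2_subset by blast+
  have inv: "inv\<^bsub>GammaL2 F\<^esub> g' = g" by (rule inv_equality) (use g' gc in \<open>simp_all add: GammaL2_simps\<close>)
  have "S0 = (\<lambda>u. g \<circ> u \<circ> g') ` unip2 F"
  proof (intro subset_antisym subsetI)
    fix f assume "f \<in> S0"
    then obtain u where u: "u \<in> unip2 F" "f \<circ> g = g \<circ> u" unfolding S0' by blast
    have "f = f \<circ> g \<circ> g'" by (simp add: comp_assoc g'(2))
    then show "f \<in> (\<lambda>u. g \<circ> u \<circ> g') ` unip2 F" using u by auto
  next
    fix f assume "f \<in> (\<lambda>u. g \<circ> u \<circ> g') ` unip2 F"
    then obtain u where u: "u \<in> unip2 F" "f = g \<circ> u \<circ> g'" by blast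
    have "u \<in> carrier (SL2 F)" using u(1) unip2_subset by blast
    then have "f \<in> carrier (SL2 F)" unfolding u(2) by (intro SL2_mult_closed g g'(1))
    moreover have "f \<circ> g = g \<circ> u" by (simp add: u(2) comp_assoc g'(3))
    ultimately show "f \<in> S0" unfolding S0' using u(1) by blast
  qed
  \<comment> \<open>\<open>normalizer_conj_iso\<close> conjugates with the inverse on the left, so
    it is used with g' = g^(-1).\<close>
  then have "S0 = (\<lambda>u. inv\<^bsub>GammaL2 F\<^esub> g' \<otimes>\<^bsub>GammaL2 F\<^esub> u \<otimes>\<^bsub>GammaL2 F\<^esub> g') ` unip2 F"
    by (simp add: inv GammaL2_simps)
  then show ?thesis
    unfolding GammaL2_normalizer_def using normalizer_conj_iso[OF S gc(2)] by simp
qed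

section \<open>Local groups and vertex stabilizers\<close>

text \<open>Extracts the linear part from the map itself by subtracting the image of the origin, so
  that no choice of parameters is involved.\<close>

definition lin :: "'a perm \<Rightarrow> 'a^2 \<Rightarrow> 'a^2" where
  "lin g = (\<lambda>v. vector [fst (g (v $ 1, v $ 2, 0)) - fst (g (0, 0, 0)),
     fst (snd (g (v $ 1, v $ 2, 0))) - fst (snd (g (0, 0, 0)))])"

lemma lin_smap: "field_aut s \<Longrightarrow> lin (smap s x y z w u v t) = sl s x y z w"
  by (rule ext) (simp add: lin_def vec2_eq_iff sl_nth smap_def field_aut_0)

lemma lin_mem: "g \<in> semi_affine \<Longrightarrow> lin g \<in> carrier (GammaL2 F)"
  by (erule semi_affineE) (simp add: lin_smap sl_mem)

lemma lin_comp:
  assumes g: "g \<in> semi_affine" and h: "h \<in> semi_affine"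
  shows "lin (g \<circ> h) = lin g \<circ> lin h"
proof -
  obtain s x y z w u v t where g: "g = smap s x y z w u v t" "field_aut s" "x * w - y * z \<noteq> 0"
    using g by (rule semi_affineE)
  obtain s' x' y' z' w' u' v' t' where
    h: "h = smap s' x' y' z' w' u' v' t'" "field_aut s'" "x' * w' - y' * z' \<noteq> 0"
    using h by (rule semi_affineE)
  show ?thesis
    unfolding g(1) h(1) smap_comp[OF g(2)] lin_smap[OF g(2)] lin_smap[OF h(2)]
      lin_smap[OF field_aut_comp[OF g(2) h(2)]] sl_comp[OF g(2)] ..
qed

lemma lin_surj:
  assumes "f \<in> carrier (GammaL2 F)"
  obtains s x y z w where "f = lin (smap s x y z w 0 0 0)" "field_aut s" "x * w - y * z \<noteq> 0"
  using assms by (rule GammaL2E) (use lin_smap that in metis)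

text \<open>Two elements of G1 induce the same permutation of the lines iff their linear parts
  differ by a scalar, that is, iff they define the same coset of \<open>scalars2\<close>.\<close>

lemma local_group_affine: "local_group G.\<Gamma> (group_G F) G.\<rho> semi_affine \<cong> PGammaL2 F"
proof (rule G.local_group_isoI[OF G.base_verts(1) group_PGammaL2, unfolded G.stabilizer_H])
  let ?\<psi> = "\<lambda>g. scalars2 F #>\<^bsub>GammaL2 F\<^esub> lin g"
  show "?\<psi> ` semi_affine = carrier (PGammaL2 F)"
  proof (intro subset_antisym subsetI)
    fix X assume "X \<in> ?\<psi> ` semi_affine"
    then show "X \<in> carrier (PGammaL2 F)"
      using lin_mem by (auto simp: PGammaL2_def FactGroup_def RCOSETS_def)
  next
    fix X assume "X \<in> carrier (PGammaL2 F)"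
    then obtain f where f: "f \<in> carrier (GammaL2 F)" "X = scalars2 F #>\<^bsub>GammaL2 F\<^esub> f"
      by (auto simp: PGammaL2_def FactGroup_def RCOSETS_def)
    obtain s x y z w where "f = lin (smap s x y z w 0 0 0)" "field_aut s" "x * w - y * z \<noteq> 0"
      using f(1) by (rule lin_surj)
    then show "X \<in> ?\<psi> ` semi_affine" using f(2) smap_mem by blast
  qed
  fix g h assume gh: "g \<in> semi_affine" "h \<in> semi_affine"
  obtain s x y z w u v t where g: "g = smap s x y z w u v t" "field_aut s" "x * w - y * z \<noteq> 0"
    using gh(1) by (rule semi_affineE)
  obtain s' x' y' z' w' u' v' t' where
    h: "h = smap s' x' y' z' w' u' v' t'" "field_aut s'" "x' * w' - y' * z' \<noteq> 0"
    using gh(2) by (rule semi_affineE)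
  have ne: "x * s p + y * s q \<noteq> 0 \<or> z * s p + w * s q \<noteq> 0"
    if "field_aut s" "x * w - y * z \<noteq> 0" "p \<noteq> 0 \<or> q \<noteq> 0" for s x y z w p q
    using linear_system_2[OF that(2), of "s p" "s q"] that(3) field_aut_eq_0[OF that(1)] by metis
  have act: "G.\<rho> g (line p q) = G.\<rho> h (line p q) \<longleftrightarrow>
      (x * s p + y * s q) * (z' * s' p + w' * s' q) = (x' * s' p + y' * s' q) * (z * s p + w * s q)"
    if pq: "p \<noteq> 0 \<or> q \<noteq> 0" for p q
    unfolding g(1) h(1) action_line[OF g(2,3) pq] action_line[OF h(2,3) pq]
    by (rule line_eq_iff[OF ne[OF g(2,3) pq] ne[OF h(2,3) pq]])
  have eq_sl: "?\<psi> g = ?\<psi> h \<longleftrightarrow> (\<exists>c. c \<noteq> 0 \<and> sl s x y z w = (*s) c \<circ> sl s' x' y' z' w')"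
    unfolding scalars2_coset_eq_iff[OF lin_mem[OF gh(1)] lin_mem[OF gh(2)]]
    by (simp only: g(1) h(1) lin_smap[OF g(2)] lin_smap[OF h(2)])
  show "(\<forall>X\<in>nbrs G.\<Gamma> semi_affine. G.\<rho> g X = G.\<rho> h X) \<longleftrightarrow> ?\<psi> g = ?\<psi> h"
  proof
    assume "\<forall>X\<in>nbrs G.\<Gamma> semi_affine. G.\<rho> g X = G.\<rho> h X"
    then have a: "(x * s p + y * s q) * (z' * s' p + w' * s' q) = (x' * s' p + y' * s' q) * (z * s p + w * s q)"
      if "p \<noteq> 0 \<or> q \<noteq> 0" for p q
      using act[OF that] that unfolding nbrs_affine by blast
    note s01 = field_aut_0[OF g(2)] field_aut_0[OF h(2)] field_aut_1[OF g(2)] field_aut_1[OF h(2)]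
    have parallel: "\<exists>c. a = c * a' \<and> b = c * b'" if "a * b' = a' * b" "a' \<noteq> 0 \<or> b' \<noteq> 0" for a b a' b' :: 'a
    proof (cases "a' = 0")
      case True
      then show ?thesis using that by (intro exI[of _ "b / b'"]) auto
    next
      case False
      then show ?thesis using that by (intro exI[of _ "a / a'"]) (auto simp: field_simps)
    qed
    have "x' \<noteq> 0 \<or> z' \<noteq> 0" "y' \<noteq> 0 \<or> w' \<noteq> 0" using h(3) by auto
    moreover have "x * z' = x' * z" "y * w' = y' * w" using a[of 1 0] a[of 0 1] by (simp_all add: s01)
    ultimately obtain c d where cd: "x = c * x'" "z = c * z'" "y = d * y'" "w = d * w'" using parallel by meson
    have "(x' * w' - y' * z') * (c * s p * s' q - d * s q * s' p) = 0" if "p \<noteq> 0 \<or> q \<noteq> 0" for p q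
      using a[OF that] unfolding cd by (simp add: algebra_simps)
    then have b: "c * s p * s' q = d * s q * s' p" if "p \<noteq> 0 \<or> q \<noteq> 0" for p q using that h(3) by simp
    \<comment> \<open>The two axes only make the columns proportional, with separate factors c and
      d; the line through (1, 1) equates the factors, and the lines through (p, 1) equate the field
      automorphisms.\<close>
    have "c = d" using b[of 1 1] by (simp add: s01)
    moreover have c: "c \<noteq> 0" using g(3) cd \<open>c = d\<close> by auto
    ultimately have "s p = s' p" for p using b[of p 1] by (simp add: s01)
    then have "sl s x y z w = (*s) c \<circ> sl s' x' y' z' w'"
      using cd \<open>c = d\<close> by (auto simp: fun_eq_iff vec2_eq_iff sl_nth algebra_simps)
    then show "?\<psi> g = ?\<psi> h" using eq_sl c by blast
  next
    assume "?\<psi> g = ?\<psi> h"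
    then obtain c where c: "c \<noteq> 0" "sl s x y z w = (*s) c \<circ> sl s' x' y' z' w'" using eq_sl by blast
    have "x * s p + y * s q = c * (x' * s' p + y' * s' q)" "z * s p + w * s q = c * (z' * s' p + w' * s' q)" for p q
      using fun_cong[OF c(2), of "vector [p, q]"] by (simp_all add: vec2_eq_iff sl_nth)
    then have "G.\<rho> g (line p q) = G.\<rho> h (line p q)" if "p \<noteq> 0 \<or> q \<noteq> 0" for p q
      unfolding act[OF that] by (simp only: mult.assoc mult.commute mult.left_commute)
    then show "\<forall>X\<in>nbrs G.\<Gamma> semi_affine. G.\<rho> g X = G.\<rho> h X" unfolding nbrs_affine by blast
  qed
  show "?\<psi> h \<otimes>\<^bsub>PGammaL2 F\<^esub> ?\<psi> g = ?\<psi> (g \<otimes>\<^bsub>group_G F\<^esub> h)"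
    using normal.rcos_sum[OF normal_scalars2 lin_mem[OF gh(2)] lin_mem[OF gh(1)]]
    by (simp add: PGammaL2_def FactGroup_def group_G_simps(2) GammaL2_simps lin_comp gh)
qed

text \<open>The neighbours are labelled by field elements, and \<open>\<psi>\<close> g is the
  induced map of labels, read off from the action. Multiplicativity then follows from the action
  law.\<close>

lemma local_group_triangular: "local_group G.\<Gamma> (group_G F) G.\<rho> semi_triangular \<cong> AGammaL1 F"
proof (rule G.local_group_isoI[OF G.base_verts(2) group_AGammaL1, unfolded G.stabilizer_K])
  define \<psi> where "\<psi> g c = (THE d. G.\<rho> g (cosH (perm_tau c)) = cosH (perm_tau d))" for g c
  have \<psi>_bmap: "\<psi> (bmap s l m e d u v t) = (\<lambda>c. l / m\<^sup>2 * s c + l / m\<^sup>2 * d)"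
    if "field_aut s" "l \<noteq> 0" "m \<noteq> 0" for s l m e d u v t
    unfolding \<psi>_def action_tau[OF that] coset_tau_eq_iff by (simp add: distrib_left)
  have \<psi>: "G.\<rho> g (cosH (perm_tau c)) = cosH (perm_tau (\<psi> g c))" if g: "g \<in> semi_triangular" for g c
  proof -
    obtain s l m e d u v t where *: "g = bmap s l m e d u v t" "field_aut s" "l \<noteq> 0" "m \<noteq> 0"
      using g by (rule semi_triangularE)
    show ?thesis
      unfolding *(1) \<psi>_bmap[OF *(2-4)] action_tau[OF *(2-4)] by (simp add: distrib_left)
  qed
  show "\<psi> ` semi_triangular = carrier (AGammaL1 F)"
  proof (intro subset_antisym subsetI)
    fix f assume "f \<in> \<psi> ` semi_triangular"
    then obtain g where g: "g \<in> semi_triangular" "f = \<psi> g" by blast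
    obtain s l m e d u v t where *: "g = bmap s l m e d u v t" "field_aut s" "l \<noteq> 0" "m \<noteq> 0"
      using g(1) by (rule semi_triangularE)
    have "l / m\<^sup>2 \<noteq> 0" using * by simp
    then show "f \<in> carrier (AGammaL1 F)"
      unfolding AGammaL1_carrier g(2) *(1) \<psi>_bmap[OF *(2-4)] using *(2) by blast
  next
    fix f assume "f \<in> carrier (AGammaL1 F)"
    then obtain a s b where f: "f = (\<lambda>x. a * s x + b)" "a \<noteq> 0" "field_aut s"
      unfolding AGammaL1_carrier by blast
    have "f = \<psi> (bmap s a 1 0 (b / a) 0 0 0)" using f(2) by (simp add: \<psi>_bmap[OF f(3)] f(1))
    moreover have "bmap s a 1 0 (b / a) 0 0 0 \<in> semi_triangular" using f by (simp add: bmap_mem)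
    ultimately show "f \<in> \<psi> ` semi_triangular" by blast
  qed
  fix g h assume gh: "g \<in> semi_triangular" "h \<in> semi_triangular"
  show "(\<forall>X\<in>nbrs G.\<Gamma> semi_triangular. G.\<rho> g X = G.\<rho> h X) \<longleftrightarrow> \<psi> g = \<psi> h"
    unfolding nbrs_triangular by (simp add: \<psi> gh coset_tau_eq_iff fun_eq_iff)
  have "g \<otimes>\<^bsub>group_G F\<^esub> h \<in> semi_triangular"
    using gh group_G_subgroups(3) by (rule subgroup.m_closed[rotated])
  then have "cosH (perm_tau (\<psi> (g \<otimes>\<^bsub>group_G F\<^esub> h) c)) = cosH (perm_tau (\<psi> h (\<psi> g c)))" for c
    using G.action_mult[OF mem_carrier_G(2)[OF gh(1)] mem_carrier_G(2)[OF gh(2)], of "cosH (perm_tau c)"]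
    by (simp add: \<psi> gh)
  then show "\<psi> h \<otimes>\<^bsub>AGammaL1 F\<^esub> \<psi> g = \<psi> (g \<otimes>\<^bsub>group_G F\<^esub> h)"
    by (simp add: AGammaL1_def fun_eq_iff coset_tau_eq_iff)
qed

lemma vstab_subgroup_eq:
  "vstab (group_G F) G.\<rho> semi_affine = (group_G F)\<lparr>carrier := semi_affine\<rparr>"
  "vstab (group_G F) G.\<rho> semi_triangular = (group_G F)\<lparr>carrier := semi_triangular\<rparr>"
  by (simp_all add: vstab_def G.stabilizer_H G.stabilizer_K)

text \<open>The complement to the translations consists of the elements of G1 fixing the origin;
  taking linear parts identifies it with \<open>GammaL2 F\<close>.\<close>

lemma semidirect_affine:
  defines "N \<equiv> \<lparr>carrier = (UNIV :: ('a \<times> 'a \<times> 'a) set), mult = (+), one = 0\<rparr>"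
  shows "is_semidirect_product (vstab (group_G F) G.\<rho> semi_affine) N (GammaL2 F)"
proof -
  let ?H = "(group_G F)\<lparr>carrier := semi_affine\<rparr>"
  let ?K = "{smap s x y z w 0 0 0 | s x y z w. field_aut s \<and> x * w - y * z \<noteq> 0}"
  interpret H: group ?H using subgroup.subgroup_is_group[OF group_G_subgroups(2) group_group_G] .
  have KH: "?K \<subseteq> semi_affine" using smap_mem by blast
  have Kmult: "g \<circ> f \<in> ?K" if fg: "f \<in> ?K" "g \<in> ?K" for f g
  proof -
    obtain s x y z w where f: "f = smap s x y z w 0 0 0" "field_aut s" "x * w - y * z \<noteq> 0"
      using fg(1) by blast
    obtain s' x' y' z' w' where g: "g = smap s' x' y' z' w' 0 0 0" "field_aut s'" "x' * w' - y' * z' \<noteq> 0"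
      using fg(2) by blast
    have "(x' * s' x + y' * s' z) * (z' * s' y + w' * s' w)
      - (x' * s' y + y' * s' w) * (z' * s' x + w' * s' z) \<noteq> 0"
      unfolding det_comp[OF g(2)] using f(3) g(3) field_aut_eq_0[OF g(2)] by simp
    moreover have "g \<circ> f = smap (\<lambda>a. s' (s a)) (x' * s' x + y' * s' z) (x' * s' y + y' * s' w)
      (z' * s' x + w' * s' z) (z' * s' y + w' * s' w) 0 0 0"
      unfolding f(1) g(1) smap_comp[OF g(2)] by (simp add: field_aut_0[OF g(2)])
    ultimately show ?thesis using field_aut_comp[OF g(2) f(2)] by blast
  qed
  have normal: "translation_group \<lhd> ?H"
  proof (rule G.normal_in_subgroupI[OF subgroup_translation_group group_G_subgroups(2) translation_group_subset(2)])
    fix x h assume "x \<in> semi_affine" "h \<in> translation_group"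
    then show "\<exists>h'\<in>translation_group. x \<otimes>\<^bsub>group_G F\<^esub> h = h' \<otimes>\<^bsub>group_G F\<^esub> x"
      unfolding group_G_simps(2) by (rule translation_group_conj)
  qed
  have "is_semidirect_product ?H N (GammaL2 F)"
  proof (rule H.is_semidirect_productI[OF normal])
    show "subgroup ?K ?H"
    proof (rule H.subgroup_of_finite)
      have "(1::'a) * 1 - 0 * 0 \<noteq> 0" by simp
      then show "?K \<noteq> {}" using field_aut_id(2) by blast
    qed (use KH Kmult in \<open>auto simp: group_G_simps(2)\<close>)
    show "translation_group \<inter> ?K \<subseteq> {\<one>\<^bsub>?H\<^esub>}"
    proof
      fix g assume g: "g \<in> translation_group \<inter> ?K"
      then obtain u v t where 1: "g = smap id 1 0 0 1 u v t"
        unfolding perm_alpha_smap[symmetric] by (auto elim: translation_groupE)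
      obtain s x y z w where 2: "g = smap s x y z w 0 0 0" "field_aut s" using g by blast
      have "u = 0 \<and> v = 0 \<and> t = 0"
        using 1 2(1) smap_eq_iff[OF field_aut_id(2) 2(2), of 1 1 0 0 u v t x y z w 0 0 0] by simp
      then have "g = id" unfolding 1 by (auto simp: fun_eq_iff smap_def cbrt_simps)
      then show "g \<in> {\<one>\<^bsub>?H\<^esub>}" by (simp add: group_G_simps(3))
    qed
    show "carrier ?H \<subseteq> translation_group <#>\<^bsub>?H\<^esub> ?K"
    proof
      fix g assume "g \<in> carrier ?H"
      then have "g \<in> semi_affine" by simp
      then obtain s x y z w u v t where g: "g = smap s x y z w u v t" "field_aut s" "x * w - y * z \<noteq> 0"
        by (rule semi_affineE)
      let ?k = "smap s x y z w 0 0 0"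
      have "g = perm_alpha u v t \<circ> ?k" by (auto simp: g(1) fun_eq_iff smap_def perm_alpha_def)
      \<comment> \<open>In left to right notation the translation has to act first; normality moves
        it across \<open>?k\<close>.\<close>
      moreover obtain h where h: "h \<in> translation_group" "perm_alpha u v t \<circ> ?k = ?k \<circ> h"
        using translation_group_conj[OF smap_mem[OF g(2,3)] perm_alpha_mem] by blast
      ultimately have "g = h \<otimes>\<^bsub>?H\<^esub> ?k" by (simp add: group_G_simps(2))
      moreover have k: "?k \<in> ?K" using g(2,3) by blast
      ultimately show "g \<in> translation_group <#>\<^bsub>?H\<^esub> ?K"
        unfolding set_mult_def by (simp only:) (rule UN_I[OF h(1)], rule UN_I[OF k], rule singletonI)
    qed
    show "group N"
      unfolding N_def by (rule comm_group.axioms(2)[OF comm_group_additive])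
    have "(group_G F)\<lparr>carrier := translation_group\<rparr> \<cong> N"
    proof (rule is_iso_parametrized)
      show "(\<lambda>(u, v, t). perm_alpha u v t) ` UNIV = carrier ((group_G F)\<lparr>carrier := translation_group\<rparr>)"
        by (simp add: translation_group_def)
      show "id ` UNIV = carrier N" by (simp add: N_def)
      fix p q :: "'a omega"
      show "(\<lambda>(u, v, t). perm_alpha u v t) p = (\<lambda>(u, v, t). perm_alpha u v t) q \<longleftrightarrow> id p = id q"
      proof
        assume "(\<lambda>(u, v, t). perm_alpha u v t) p = (\<lambda>(u, v, t). perm_alpha u v t) q"
        then have "(\<lambda>(u, v, t). perm_alpha u v t) p (0, 0, 0) = (\<lambda>(u, v, t). perm_alpha u v t) q (0, 0, 0)"
          by simp
        then show "id p = id q" by (simp add: perm_alpha_def case_prod_unfold prod_eq_iff)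
      qed simp
      show "\<exists>t\<in>UNIV. (\<lambda>(u, v, t). perm_alpha u v t) p \<otimes>\<^bsub>(group_G F)\<lparr>carrier := translation_group\<rparr>\<^esub>
          (\<lambda>(u, v, t). perm_alpha u v t) q = (\<lambda>(u, v, t). perm_alpha u v t) t \<and> id p \<otimes>\<^bsub>N\<^esub> id q = id t"
        by (intro bexI[of _ "p + q"])
          (auto simp: N_def group_G_simps(2) fun_eq_iff perm_alpha_def case_prod_unfold add.assoc)
    qed
    then show "?H\<lparr>carrier := translation_group\<rparr> \<cong> N" by simp
    show "group (GammaL2 F)" by (rule group_GammaL2)
    have "(group_G F)\<lparr>carrier := ?K\<rparr> \<cong> GammaL2 F"
    proof (rule is_iso_parametrized_anti[OF group_GammaL2])
      show "id ` ?K = carrier ((group_G F)\<lparr>carrier := ?K\<rparr>)" by simp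
      show "lin ` ?K = carrier (GammaL2 F)"
      proof (intro subset_antisym subsetI)
        fix f assume "f \<in> lin ` ?K"
        then show "f \<in> carrier (GammaL2 F)" using KH lin_mem by blast
      next
        fix f assume "f \<in> carrier (GammaL2 F)"
        then obtain s x y z w where "f = lin (smap s x y z w 0 0 0)" "field_aut s" "x * w - y * z \<noteq> 0"
          by (rule lin_surj)
        then show "f \<in> lin ` ?K" by blast
      qed
      fix f g assume fg: "f \<in> ?K" "g \<in> ?K"
      obtain s x y z w where f: "f = smap s x y z w 0 0 0" "field_aut s" "x * w - y * z \<noteq> 0"
        using fg(1) by blast
      obtain s' x' y' z' w' where g: "g = smap s' x' y' z' w' 0 0 0" "field_aut s'" "x' * w' - y' * z' \<noteq> 0"
        using fg(2) by blast
      show "id f = id g \<longleftrightarrow> lin f = lin g"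
        unfolding f(1) g(1) lin_smap[OF f(2)] lin_smap[OF g(2)] sl_eq_iff[OF f(2) g(2) f(3)]
          id_apply smap_eq_iff[OF f(2) g(2) f(3)] by simp
      show "\<exists>t\<in>?K. id f \<otimes>\<^bsub>(group_G F)\<lparr>carrier := ?K\<rparr>\<^esub> id g = id t \<and> lin g \<otimes>\<^bsub>GammaL2 F\<^esub> lin f = lin t"
        using lin_comp[OF subsetD[OF KH fg(2)] subsetD[OF KH fg(1)]]
        by (intro bexI[OF _ Kmult[OF fg]]) (simp add: group_G_simps(2) GammaL2_simps)
    qed
    then show "?H\<lparr>carrier := ?K\<rparr> \<cong> GammaL2 F" by simp
  qed
  then show ?thesis unfolding vstab_subgroup_eq .
qed

text \<open>The normal factor Q splits: translations in the third coordinate form a direct factor,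
  and the rest is the plane with the unitriangular maps acting on it, a Sylow subgroup of ASL2. The
  complement contains the maps \<tau>_d, which play the role of the unipotent part in the normalizer
  of a Sylow subgroup of SL2.\<close>

lemma semidirect_triangular:
  defines "N \<equiv> \<lparr>carrier = (UNIV :: 'a set), mult = (+), one = 0\<rparr>"
    and "U \<equiv> (ASL2 F)\<lparr>carrier := UNIV \<times> unip2 F\<rparr>"
  assumes S0: "sylow_subgroup 3 (SL2 F) S0"
  shows "group U" "is_semidirect_product (vstab (group_G F) G.\<rho> semi_triangular) (N \<times>\<times> U)
    (GammaL2_normalizer F S0)"
proof -
  let ?H = "(group_G F)\<lparr>carrier := semi_triangular\<rparr>"
  let ?K = "{bmap s l m 0 d 0 0 0 | s l m d. field_aut s \<and> l \<noteq> 0 \<and> m \<noteq> 0}"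
  interpret H: group ?H using subgroup.subgroup_is_group[OF group_G_subgroups(3) group_group_G] .
  have KH: "?K \<subseteq> semi_triangular" using bmap_mem by blast
  have Kcomp: "bmap s' l' m' 0 d' 0 0 0 \<circ> bmap s l m 0 d 0 0 0 =
      bmap (\<lambda>a. s' (s a)) (l' * s' l) (m' * s' m) 0 (s' d + d' * (s' m)\<^sup>2 / s' l) 0 0 0"
    if "field_aut s'" "l \<noteq> 0" for s l m d s' l' m' d'
    unfolding bmap_comp[OF that] by (simp add: field_aut_0[OF that(1)])
  have Kmult: "g \<circ> f \<in> ?K" if fg: "f \<in> ?K" "g \<in> ?K" for f g
  proof -
    obtain s l m d where f: "f = bmap s l m 0 d 0 0 0" "field_aut s" "l \<noteq> 0" "m \<noteq> 0"
      using fg(1) by blast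
    obtain s' l' m' d' where g: "g = bmap s' l' m' 0 d' 0 0 0" "field_aut s'" "l' \<noteq> 0" "m' \<noteq> 0"
      using fg(2) by blast
    have "l' * s' l \<noteq> 0" "m' * s' m \<noteq> 0" using f g by (simp_all add: field_aut_eq_0)
    then show ?thesis unfolding f(1) g(1) Kcomp[OF g(2) f(3)] using field_aut_comp[OF g(2) f(2)] by blast
  qed
  have normal: "unipotent_group \<lhd> ?H"
  proof (rule G.normal_in_subgroupI[OF subgroup_unipotent_group group_G_subgroups(3) translation_group_subset(3)])
    fix x h assume "x \<in> semi_triangular" "h \<in> unipotent_group"
    then show "\<exists>h'\<in>unipotent_group. x \<otimes>\<^bsub>group_G F\<^esub> h = h' \<otimes>\<^bsub>group_G F\<^esub> x"
      unfolding group_G_simps(2) by (rule unipotent_group_conj)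
  qed
  have "group N"
    unfolding N_def by (rule comm_group.axioms(2)[OF comm_group_additive])
  moreover show groupU: "group U"
  proof -
    have "subgroup (UNIV \<times> unip2 F) (ASL2 F)" using sylow_ASL2 unfolding sylow_subgroup_def by blast
    then show "group U" unfolding U_def by (rule subgroup.subgroup_is_group[OF _ group_ASL2])
  qed
  ultimately have groupNU: "group (N \<times>\<times> U)" by (rule DirProd_group)
  have S: "unip2 F \<subseteq> carrier (GammaL2 F)" by (rule subset_trans[OF unip2_subset SL2_subset])
  have groupK: "group (GammaL2_normalizer F (unip2 F))"
    unfolding GammaL2_normalizer_def
    using subgroup.subgroup_is_group[OF group.normalizer_imp_subgroup[OF group_GammaL2 S] group_GammaL2] .
  have S0': "S0 \<subseteq> carrier (GammaL2 F)"
    using S0 SL2_subset[of F] by (auto simp: sylow_subgroup_def dest: subgroup.subset)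
  have groupK0: "group (GammaL2_normalizer F S0)"
    unfolding GammaL2_normalizer_def
    using subgroup.subgroup_is_group[OF group.normalizer_imp_subgroup[OF group_GammaL2 S0'] group_GammaL2] .
  have "is_semidirect_product ?H (N \<times>\<times> U) (GammaL2_normalizer F S0)"
  proof (rule H.is_semidirect_productI[OF normal _ _ _ groupNU _ groupK0])
    show "subgroup ?K ?H"
    proof (rule H.subgroup_of_finite)
      show "?K \<noteq> {}" using field_aut_id(2) one_neq_zero by blast
    qed (use KH Kmult in \<open>auto simp: group_G_simps(2)\<close>)
    show "unipotent_group \<inter> ?K \<subseteq> {\<one>\<^bsub>?H\<^esub>}"
    proof
      fix g assume g: "g \<in> unipotent_group \<inter> ?K"
      then obtain e u v t where 1: "g = bmap id 1 1 e 0 u v t" by (auto elim: unipotent_groupE)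
      obtain s l m d where 2: "g = bmap s l m 0 d 0 0 0" "field_aut s" using g by blast
      have "e = 0 \<and> u = 0 \<and> v = 0 \<and> t = 0"
        using 1 2(1) bmap_eq_iff[OF field_aut_id(2) 2(2) one_neq_zero, of 1 e 0 u v t l m 0 d 0 0 0] by simp
      then have "g = id" unfolding 1 by (auto simp: fun_eq_iff bmap_def cbrt_simps)
      then show "g \<in> {\<one>\<^bsub>?H\<^esub>}" by (simp add: group_G_simps(3))
    qed
    show "carrier ?H \<subseteq> unipotent_group <#>\<^bsub>?H\<^esub> ?K"
    proof
      fix g assume "g \<in> carrier ?H"
      then have "g \<in> semi_triangular" by simp
      then obtain s l m e d u v t where g: "g = bmap s l m e d u v t" "field_aut s" "l \<noteq> 0" "m \<noteq> 0"
        by (rule semi_triangularE)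
      \<comment> \<open>The corner entry is divided by m because \<open>?k\<close> acts first and
        has already multiplied b by m.\<close>
      let ?k = "bmap s l m 0 d 0 0 0" and ?h = "bmap id 1 1 (e / m) 0 u v t"
      have "g = ?h \<circ> ?k"
        unfolding g(1) bmap_comp[OF field_aut_id(2) g(3)] using g(4) by (simp add: cbrt_simps id_def)
      moreover obtain h where h: "h \<in> unipotent_group" "?h \<circ> ?k = ?k \<circ> h"
        using unipotent_group_conj[OF bmap_mem[OF g(2-4)] unipotent_mem] by blast
      ultimately have "g = h \<otimes>\<^bsub>?H\<^esub> ?k" by (simp add: group_G_simps(2))
      moreover have k: "?k \<in> ?K" using g(2-4) by blast
      ultimately show "g \<in> unipotent_group <#>\<^bsub>?H\<^esub> ?K"
        unfolding set_mult_def by (simp only:) (rule UN_I[OF h(1)], rule UN_I[OF k], rule singletonI)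
    qed
    have "(group_G F)\<lparr>carrier := unipotent_group\<rparr> \<cong> N \<times>\<times> U"
    proof (rule is_iso_parametrized_anti[OF groupNU])
      let ?f = "\<lambda>(e, u, v, t). bmap id 1 1 e 0 u v t"
      let ?h = "\<lambda>(e, u, v, t). (t, (vector [u, v] :: 'a^2, sl id 1 e 0 1))"
      show "?f ` UNIV = carrier ((group_G F)\<lparr>carrier := unipotent_group\<rparr>)"
        by (simp add: unipotent_group_def)
      show "?h ` UNIV = carrier (N \<times>\<times> U)"
      proof (intro subset_antisym subsetI)
        fix p assume "p \<in> carrier (N \<times>\<times> U)"
        then obtain t n e where p: "p = (t, (n, sl id 1 e 0 1))"
          by (auto simp: DirProd_def N_def U_def unip2_def)
        have "p = ?h (e, n $ 1, n $ 2, t)" by (simp add: p vec2_eq_iff)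
        then show "p \<in> ?h ` UNIV" by blast
      qed (auto simp: DirProd_def N_def U_def unip2_def)
      fix p q :: "'a \<times> 'a omega"
      obtain e u v t e' u' v' t' where pq: "p = (e, u, v, t)" "q = (e', u', v', t')" by (metis prod_cases4)
      show "?f p = ?f q \<longleftrightarrow> ?h p = ?h q"
        unfolding pq prod.case bmap_eq_iff[OF field_aut_id(2) field_aut_id(2) one_neq_zero]
        by (auto simp: vec2_eq_iff[of "vector [u, v]"] unip2_eq_iff)
      have 1: "bmap id 1 1 e' 0 u' v' t' \<circ> bmap id 1 1 e 0 u v t
          = bmap id 1 1 (e + e') 0 (u + e' * v + u') (v + v') (t + t')"
        unfolding bmap_comp[OF field_aut_id(2) one_neq_zero] by (simp add: cbrt_simps id_def)
      have 2: "vector [u', v'] + sl id 1 e' 0 1 (vector [u, v]) = (vector [u + e' * v + u', v + v'] :: 'a^2)"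
        by (simp add: vec2_eq_iff sl_nth algebra_simps)
      show "\<exists>t\<in>UNIV. ?f p \<otimes>\<^bsub>(group_G F)\<lparr>carrier := unipotent_group\<rparr>\<^esub> ?f q = ?f t \<and> ?h q \<otimes>\<^bsub>N \<times>\<times> U\<^esub> ?h p = ?h t"
        by (rule bexI[of _ "(e + e', u + e' * v + u', v + v', t + t')"])
          (simp_all add: pq DirProd_def N_def U_def group_G_simps(2) 1 ASL2_simps 2 unip2_comp add.commute)
    qed
    then show "?H\<lparr>carrier := unipotent_group\<rparr> \<cong> N \<times>\<times> U" by simp
    have "(group_G F)\<lparr>carrier := ?K\<rparr> \<cong> GammaL2_normalizer F (unip2 F)"
    proof (rule is_iso_parametrized_anti[OF groupK])
      let ?P = "{(s :: 'a \<Rightarrow> 'a, l :: 'a, m :: 'a, d :: 'a). field_aut s \<and> l \<noteq> 0 \<and> m \<noteq> 0}"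
      let ?f = "\<lambda>(s, l, m, d). bmap s l m 0 d 0 0 0"
      \<comment> \<open>The complement scales the parameter d by l / m^2, whereas a triangular
        matrix scales its unipotent part by the quotient of its diagonal entries. The entries l / m
        and m have this quotient, and the corner d l / m then makes products match.\<close>
      let ?h = "\<lambda>(s, l, m, d). sl s (l / m) (d * l / m) 0 m"
      show "?f ` ?P = carrier ((group_G F)\<lparr>carrier := ?K\<rparr>)" by force
      have carrier: "carrier (GammaL2_normalizer F (unip2 F)) =
          {sl s x y 0 w | s x y w. field_aut s \<and> x \<noteq> 0 \<and> w \<noteq> 0}"
        by (simp add: GammaL2_normalizer_def normalizer_unip2)
      show "?h ` ?P = carrier (GammaL2_normalizer F (unip2 F))"
      proof (intro subset_antisym subsetI)
        fix f assume "f \<in> ?h ` ?P"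
        then obtain s l m d where f: "f = sl s (l / m) (d * l / m) 0 m" "field_aut s" "l \<noteq> 0" "m \<noteq> 0" by auto
        have "l / m \<noteq> 0" using f by simp
        then show "f \<in> carrier (GammaL2_normalizer F (unip2 F))"
          unfolding carrier f(1) using f(2,4) by blast
      next
        fix f assume "f \<in> carrier (GammaL2_normalizer F (unip2 F))"
        then obtain s x y w where f: "f = sl s x y 0 w" "field_aut s" "x \<noteq> 0" "w \<noteq> 0"
          unfolding carrier by blast
        have "f = ?h (s, x * w, w, y / x)" using f by simp
        moreover have "(s, x * w, w, y / x) \<in> ?P" using f by simp
        ultimately show "f \<in> ?h ` ?P" by blast
      qed
      fix p q assume "p \<in> ?P" "q \<in> ?P"
      then obtain s l m d s' l' m' d' where p: "p = (s, l, m, d)" "field_aut s" "l \<noteq> 0" "m \<noteq> 0"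
        and q: "q = (s', l', m', d')" "field_aut s'" "l' \<noteq> 0" "m' \<noteq> 0" by auto
      have det: "l / m * m - d * l / m * 0 \<noteq> 0" using p by simp
      show "?f p = ?f q \<longleftrightarrow> ?h p = ?h q"
        unfolding p(1) q(1) prod.case bmap_eq_iff[OF p(2) q(2) p(3)] sl_eq_iff[OF p(2) q(2) det]
        using p(3,4) q(3,4) by auto
      let ?t = "(\<lambda>a. s' (s a), l' * s' l, m' * s' m, s' d + d' * (s' m)\<^sup>2 / s' l)"
      have nz: "s' l \<noteq> 0" "s' m \<noteq> 0" using p q by (simp_all add: field_aut_eq_0)
      have "?t \<in> ?P" using nz q field_aut_comp[OF q(2) p(2)] by simp
      moreover have "?f q \<circ> ?f p = ?f ?t" unfolding p(1) q(1) prod.case by (rule Kcomp[OF q(2) p(3)])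
      moreover have "?h q \<circ> ?h p = ?h ?t"
      proof -
        have "l' / m' * s' (l / m) + d' * l' / m' * s' 0 = l' * s' l / (m' * s' m)"
          "0 * s' (l / m) + m' * s' 0 = 0" "0 * s' (d * l / m) + m' * s' m = m' * s' m"
          by (simp_all add: field_aut_0[OF q(2)] field_aut_divide[OF q(2)])
        moreover have "l' / m' * (S * L / M) + d' * l' / m' * M = (S + d' * M\<^sup>2 / L) * (l' * L) / (m' * M)"
          if "L \<noteq> 0" "M \<noteq> 0" for S L M
          using that q(4) by (simp add: field_simps power2_eq_square)
        then have "l' / m' * s' (d * l / m) + d' * l' / m' * s' m
            = (s' d + d' * (s' m)\<^sup>2 / s' l) * (l' * s' l) / (m' * s' m)"
          using nz by (simp only: field_aut_mult[OF q(2)] field_aut_divide[OF q(2)])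
        ultimately show ?thesis
          unfolding p(1) q(1) prod.case sl_comp[OF q(2)] by (simp only:)
      qed
      ultimately show "\<exists>t\<in>?P. ?f p \<otimes>\<^bsub>(group_G F)\<lparr>carrier := ?K\<rparr>\<^esub> ?f q = ?f t \<and>
          ?h q \<otimes>\<^bsub>GammaL2_normalizer F (unip2 F)\<^esub> ?h p = ?h t"
        by (intro bexI[of _ ?t]) (simp_all add: group_G_simps(2) GammaL2_normalizer_def GammaL2_simps)
    qed
    \<comment> \<open>The computation was made for the unitriangular group; conjugacy passes to the
      given Sylow subgroup \<open>S0\<close>.\<close>
    then show "?H\<lparr>carrier := ?K\<rparr> \<cong> GammaL2_normalizer F S0"
      using iso_trans[OF _ sylow_normalizer_iso[OF S0]] by simp
  qed
  then show "is_semidirect_product (vstab (group_G F) G.\<rho> semi_triangular) (N \<times>\<times> U)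
    (GammaL2_normalizer F S0)" unfolding vstab_subgroup_eq .
qed

end

theorem theorem1p1:
  fixes q r :: nat
    and F :: "'a::{finite,field} itself"
    and \<Delta> :: "'a perm set graph"
    and G :: "'a perm monoid"
    and \<phi> :: "'a perm \<Rightarrow> 'a perm set \<Rightarrow> 'a perm set"
  assumes "r \<ge> 1" and "q = 3 ^ r" and "CARD('a) = q"
    and "\<Delta> = coset_graph F" and "G = group_G F" and "\<phi> = right_mult F"
  shows "G_graph \<Delta> G \<phi> \<and> locally_finite \<Delta> G \<phi> \<and> locally_s_arc_transitive \<Delta> G \<phi> 5 \<and>
    pushing_up_type \<Delta> G \<phi> 3 \<and>
    (\<forall>e\<in>edges \<Delta>. \<exists>x1 x2. e = {x1, x2} \<and>
       card (nbrs \<Delta> x1) = q + 1 \<and> card (nbrs \<Delta> x2) = q \<and>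
       local_group \<Delta> G \<phi> x1 \<cong> PGammaL2 F \<and> local_group \<Delta> G \<phi> x2 \<cong> AGammaL1 F \<and>
       (\<exists>N :: ('a \<times> 'a \<times> 'a) monoid. elementary_abelian 3 N \<and> card (carrier N) = q ^ 3 \<and>
          is_semidirect_product (vstab G \<phi> x1) N (GammaL2 F)) \<and>
       (\<forall>S0. sylow_subgroup 3 (SL2 F) S0 \<longrightarrow>
          (\<exists>(N :: 'a monoid) (U :: (('a^2) \<times> ('a^2 \<Rightarrow> 'a^2)) monoid) P.
             elementary_abelian 3 N \<and> card (carrier N) = q \<and>
             sylow_subgroup 3 (ASL2 F) P \<and> group U \<and> U \<cong> (ASL2 F)\<lparr>carrier := P\<rparr> \<and>
             is_semidirect_product (vstab G \<phi> x2) (N \<times>\<times> U) (GammaL2_normalizer F S0))) \<and>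
       transitive_on_s_arcs_from \<Delta> G \<phi> 6 x2)"
proof -
  interpret field_char_3 F r
    using assms(1-3) by unfold_locales simp_all
  have \<Delta>: "\<Delta> = G.\<Gamma>" and G: "G = group_G F" and \<phi>: "\<phi> = G.\<rho>"
    using assms(4-6) coset_graph_eq by simp_all
  have triple0: "x + x + x = 0" for x :: 'a using triple[of x] by simp
  let ?N3 = "\<lparr>carrier = (UNIV :: ('a \<times> 'a \<times> 'a) set), mult = (+), one = 0\<rparr>"
  have N3: "elementary_abelian 3 ?N3" "card (carrier ?N3) = q ^ 3"
  proof -
    show "elementary_abelian 3 ?N3"
      by (rule elementary_abelian_additive) (simp add: prod_eq_iff three_eq_0)
    show "card (carrier ?N3) = q ^ 3" using assms(3) by (simp add: power3_eq_cube)
  qed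
  let ?N1 = "\<lparr>carrier = (UNIV :: 'a set), mult = (+), one = 0\<rparr>"
  have N1: "elementary_abelian 3 ?N1" "card (carrier ?N1) = q"
  proof -
    show "elementary_abelian 3 ?N1" by (rule elementary_abelian_additive) (rule triple0)
    show "card (carrier ?N1) = q" using assms(3) by simp
  qed
  show ?thesis
    unfolding \<Delta> G \<phi>
  proof (intro conjI ballI)
    show "G_graph G.\<Gamma> (group_G F) G.\<rho>" by (rule G.G_graph_coset)
    show "locally_finite G.\<Gamma> (group_G F) G.\<rho>" by (simp add: locally_finite_def)
    show "locally_s_arc_transitive G.\<Gamma> (group_G F) G.\<rho> 5" by (rule locally_5_arc_transitive)
    show "pushing_up_type G.\<Gamma> (group_G F) G.\<rho> 3" by (rule pushing_up_coset_graph)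
    fix e assume "e \<in> edges G.\<Gamma>"
    \<comment> \<open>Every edge is a translate of the base edge, so all local statements are
      carried over from the two base vertices by g.\<close>
    then obtain g where g: "g \<in> carrier (group_G F)" "e = {G.\<rho> g semi_affine, G.\<rho> g semi_triangular}"
      by (rule G.edge_cases)
    let ?x1 = "G.\<rho> g semi_affine" and ?x2 = "G.\<rho> g semi_triangular"
    show "\<exists>x1 x2. e = {x1, x2} \<and>
       card (nbrs G.\<Gamma> x1) = q + 1 \<and> card (nbrs G.\<Gamma> x2) = q \<and>
       local_group G.\<Gamma> (group_G F) G.\<rho> x1 \<cong> PGammaL2 F \<and>
       local_group G.\<Gamma> (group_G F) G.\<rho> x2 \<cong> AGammaL1 F \<and>
       (\<exists>N :: ('a \<times> 'a \<times> 'a) monoid. elementary_abelian 3 N \<and> card (carrier N) = q ^ 3 \<and>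
          is_semidirect_product (vstab (group_G F) G.\<rho> x1) N (GammaL2 F)) \<and>
       (\<forall>S0. sylow_subgroup 3 (SL2 F) S0 \<longrightarrow>
          (\<exists>(N :: 'a monoid) (U :: (('a^2) \<times> ('a^2 \<Rightarrow> 'a^2)) monoid) P.
             elementary_abelian 3 N \<and> card (carrier N) = q \<and>
             sylow_subgroup 3 (ASL2 F) P \<and> group U \<and> U \<cong> (ASL2 F)\<lparr>carrier := P\<rparr> \<and>
             is_semidirect_product (vstab (group_G F) G.\<rho> x2) (N \<times>\<times> U) (GammaL2_normalizer F S0))) \<and>
       transitive_on_s_arcs_from G.\<Gamma> (group_G F) G.\<rho> 6 x2"
    proof (rule exI[of _ ?x1], rule exI[of _ ?x2], intro conjI allI impI)
      show "e = {?x1, ?x2}" by (rule g(2))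
      show "card (nbrs G.\<Gamma> ?x1) = q + 1" "card (nbrs G.\<Gamma> ?x2) = q"
        using G.card_nbrs_action[OF g(1)] G.base_verts card_nbrs_affine card_nbrs_triangular assms(2)
        by simp_all
      show "local_group G.\<Gamma> (group_G F) G.\<rho> ?x1 \<cong> PGammaL2 F"
        by (rule iso_trans[OF G.local_group_action[OF g(1) G.base_verts(1)] local_group_affine])
      show "local_group G.\<Gamma> (group_G F) G.\<rho> ?x2 \<cong> AGammaL1 F"
        by (rule iso_trans[OF G.local_group_action[OF g(1) G.base_verts(2)] local_group_triangular])
      show "\<exists>N :: ('a \<times> 'a \<times> 'a) monoid. elementary_abelian 3 N \<and> card (carrier N) = q ^ 3 \<and>
          is_semidirect_product (vstab (group_G F) G.\<rho> ?x1) N (GammaL2 F)"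
        by (rule exI[of _ ?N3], intro conjI N3
            is_semidirect_product_iso[OF G.vstab_action[OF g(1)] semidirect_affine])
      show "transitive_on_s_arcs_from G.\<Gamma> (group_G F) G.\<rho> 6 ?x2"
        by (rule G.transitive_on_s_arcs_from_action[OF g(1) transitive_on_arcs_triangular]) simp
      fix S0 assume S0: "sylow_subgroup 3 (SL2 F) S0"
      let ?P = "(UNIV :: ('a^2) set) \<times> unip2 F"
      show "\<exists>(N :: 'a monoid) (U :: (('a^2) \<times> ('a^2 \<Rightarrow> 'a^2)) monoid) P.
             elementary_abelian 3 N \<and> card (carrier N) = q \<and>
             sylow_subgroup 3 (ASL2 F) P \<and> group U \<and> U \<cong> (ASL2 F)\<lparr>carrier := P\<rparr> \<and>
             is_semidirect_product (vstab (group_G F) G.\<rho> ?x2) (N \<times>\<times> U) (GammaL2_normalizer F S0)"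
        by (rule exI[of _ ?N1], rule exI[of _ "(ASL2 F)\<lparr>carrier := ?P\<rparr>"], rule exI[of _ ?P],
            intro conjI N1 sylow_ASL2 semidirect_triangular(1)[OF S0] iso_refl
            is_semidirect_product_iso[OF G.vstab_action[OF g(1)] semidirect_triangular(2)[OF S0]])
    qed
  qed
qed
end
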